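(* Let $k\ge1$ and $R>0$ be fixed, and let $X_1,\dots,X_n$ be i.i.d. from $P_\Gamma$ with $\Gamma\in\mathcal G_{k,d}$. Then there are constants $0<c\le C'$ depending only on $k$ and $R$ such that $$c\Big(\sqrt{d/n}\wedge 1\Big)\le \inf_{\hat P}\sup_{\Gamma\in\mathcal G_{k,d}}\mathbb E_\Gamma H(\hat P,P_\Gamma)\le C'\Big(\sqrt{d/n}\wedge 1\Big),$$ the infimum being over all estimators $\hat P$ (measurable functions of the sample taking values in probability distributions on $\mathbb R^d$). Furthermore, there exist an estimator $\hat\Gamma$ with values in $\mathcal G_{k,d}$ and a constant $C>0$ depending only on $R$ such that for every $\Gamma\in\mathcal G_{k,d}$ and every $\delta\in(0,\tfrac12)$, with probability at least $1-\delta$, $$H(P_{\hat\Gamma},P_\Gamma)\le C\sqrt{\frac{k^4 d+(2k)^{2k+2}}{n}\log\frac1\delta}.$$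
   Context: $R>0$ is a fixed constant. $\mathcal G_{k,d}$ is the set of $k$-atomic probability distributions on $\mathbb R^d$ with atoms in the Euclidean ball of radius $R$: $\Gamma=\sum_{j=1}^k w_j\delta_{\mu_j}$, $\|\mu_j\|_2\le R$, $w_j\ge0$, $\sum_jw_j=1$. $P_\Gamma=\Gamma*N(0,I_d)$. The Hellinger distance between distributions with densities $p,q$ w.r.t. a dominating measure $\mu$ is $H(P,Q)=\big(\int(\sqrt p-\sqrt q)^2\,d\mu\big)^{1/2}$. *)

theory Defs
  imports "HOL-Probability.Probability"
begin

definition Rd :: "nat \<Rightarrow> (nat \<Rightarrow> real) measure" where
  "Rd d = PiM {..<d} (\<lambda>_. lborel)"

definition enorm :: "nat \<Rightarrow> (nat \<Rightarrow> real) \<Rightarrow> real" where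
  "enorm d v = sqrt (\<Sum>i<d. (v i)^2)"

text \<open>A k-atomic mixing distribution is given by weights w j and atoms mu j
  (j < k).  The class G_{k,d}.\<close>
definition Gkd :: "nat \<Rightarrow> nat \<Rightarrow> real \<Rightarrow> ((nat \<Rightarrow> real) \<times> (nat \<Rightarrow> nat \<Rightarrow> real)) set" where
  "Gkd k d R = {(w, mu). (\<forall>j<k. 0 \<le> w j \<and> enorm d (mu j) \<le> R) \<and> (\<Sum>j<k. w j) = 1}"

text \<open>Density of P_Gamma = Gamma * N(0, I_d) w.r.t. Lebesgue measure on R^d.\<close>
definition mix_density :: "nat \<Rightarrow> nat \<Rightarrow> (nat \<Rightarrow> real) \<Rightarrow> (nat \<Rightarrow> nat \<Rightarrow> real) \<Rightarrow> (nat \<Rightarrow> real) \<Rightarrow> real" where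
  "mix_density k d w mu x = (\<Sum>j<k. w j * (\<Prod>i<d. normal_density (mu j i) 1 (x i)))"

definition PGamma :: "nat \<Rightarrow> nat \<Rightarrow> (nat \<Rightarrow> real) \<times> (nat \<Rightarrow> nat \<Rightarrow> real) \<Rightarrow> (nat \<Rightarrow> real) measure" where
  "PGamma k d G = density (Rd d) (\<lambda>x. ennreal (mix_density k d (fst G) (snd G) x))"

definition sum_meas :: "'a measure \<Rightarrow> 'a measure \<Rightarrow> 'a measure" where
  "sum_meas P Q = measure_of (space P) (sets P) (\<lambda>A. emeasure P A + emeasure Q A)"

definition hellinger :: "'a measure \<Rightarrow> 'a measure \<Rightarrow> real" where
  "hellinger P Q = (let \<nu> = sum_meas P Q in
     sqrt (enn2real (\<integral>\<^sup>+ x. ennreal ((sqrt (enn2real (RN_deriv \<nu> P x))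
                                   - sqrt (enn2real (RN_deriv \<nu> Q x)))^2) \<partial>\<nu>)))"

definition sample :: "nat \<Rightarrow> 'a measure \<Rightarrow> (nat \<Rightarrow> 'a) measure" where
  "sample n P = PiM {..<n} (\<lambda>_. P)"

definition estimators :: "nat \<Rightarrow> nat \<Rightarrow> ((nat \<Rightarrow> nat \<Rightarrow> real) \<Rightarrow> (nat \<Rightarrow> real) measure) set" where
  "estimators d n = measurable (PiM {..<n} (\<lambda>_. Rd d)) (prob_algebra (Rd d))"

definition minimax_risk :: "nat \<Rightarrow> nat \<Rightarrow> real \<Rightarrow> nat \<Rightarrow> ennreal" where
  "minimax_risk k d R n =
     (INF Ph\<in>estimators d n. SUP G\<in>Gkd k d R.
        \<integral>\<^sup>+ X. ennreal (hellinger (Ph X) (PGamma k d G)) \<partial>(sample n (PGamma k d G)))"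

end

(*
Upper bounds.  Write P - P' = sum_i c_i N(v_i, I) with n = 2k signed atoms.  Integrating (P - P')^2
against the inverse of a Gaussian density N(u, I) gives sum_ij c_i c_j exp<v_i - u, v_j - u>.  A Newton
interpolation argument at the atoms (the product of n differences v_i - v_s vanishes on every atom)
bounds all moment tensors of the signed measure by the first n, so both the chi^2-divergence and the
squared Hellinger distance are comparable with the distance D of the first 2k - 1 moment tensors, up to
constants whose logarithm is O_R(k log k).  These constants only enter through the logarithm of a
covering number: differences of moment tensors live over a subspace of dimension 2k, so rounding an
orthonormal frame and the core tensor to an integer lattice shows that a D-separated set has at most
(K r / eps)^(2kd + (2k)^(2k)) points in a Hellinger ball of radius r.  Maximum likelihood over a maximal
D-separated net at scale eps = sqrt(rate / n), with a union bound over Hellinger shells, gives the tail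
bound.  The net is finite, hence the estimator is a simple function.

Lower bound.  Assouad's lemma on the vertices of a cube of Gaussian location parameters.
*)
theory Submission
  imports Defs
begin

section \<open>Hellinger distance of densities\<close>

text \<open>The rate may carry neither a factor log n nor a constant growing with \<open>d\<close>.
  The first demand rules out a global covering number: only net points in a ball of radius r at
  separation \<epsilon> may be counted, by a power of r / \<epsilon>. A tensor of order l has d^l
  entries, so rounding entries is too costly; a difference of two moment tensors is a small core on
  2k directions, and rounding the frame relative to the size of that core costs only the ratio r /
  \<epsilon>. The second demand is met by expressing every tensor norm through inner products of
  atoms, as the quadratic form of a Gram kernel in the weights; triangle inequalities become
  parallelogram inequalities with factor 2. The truth need not lie in the net, so likelihood ratios
  of net points are studied under a third distribution. The cost of this is a chi^2-divergence,
  which is why the net is built in moment distance: it controls chi^2 as well as Hellinger distance.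
  With the crude bound ln x \<le> x - 1 the logarithm of all constants is O(k^2) for fixed R, and
  k^2 times the 2kd + (2k)^(2k) dimensions stays below a multiple of the stated rate.\<close>

lemma
  assumes "finite_measure P" "finite_measure Q" "sets Q = sets P"
  shows space_sum_meas: "space (sum_meas P Q) = space P"
    and sets_sum_meas: "sets (sum_meas P Q) = sets P"
    and emeasure_sum_meas: "A \<in> sets P \<Longrightarrow> emeasure (sum_meas P Q) A = emeasure P A + emeasure Q A"
proof -
  show sp: "space (sum_meas P Q) = space P" and se: "sets (sum_meas P Q) = sets P"
    by (auto simp: sum_meas_def sets.space_closed sets.sigma_sets_eq)
  have "countably_additive (sets P) (\<lambda>A. emeasure P A + emeasure Q A)"
  proof (rule countably_additiveI)
    fix A :: "nat \<Rightarrow> 'a set" assume A: "range A \<subseteq> sets P" "disjoint_family A"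
    have "(\<Sum>i. emeasure P (A i) + emeasure Q (A i)) = (\<Sum>i. emeasure P (A i)) + (\<Sum>i. emeasure Q (A i))"
      by (intro suminf_add[symmetric]) auto
    then show "(\<Sum>i. emeasure P (A i) + emeasure Q (A i)) = emeasure P (\<Union> (range A)) + emeasure Q (\<Union> (range A))"
      using A assms(3) by (simp add: suminf_emeasure)
  qed
  then show "A \<in> sets P \<Longrightarrow> emeasure (sum_meas P Q) A = emeasure P A + emeasure Q A"
    unfolding sum_meas_def
    by (intro emeasure_measure_of_sigma) (auto simp: positive_def sets.sigma_algebra_axioms)
qed

lemma sum_meas_density:
  fixes p q :: "'a \<Rightarrow> real"
  assumes [measurable]: "p \<in> borel_measurable M" "q \<in> borel_measurable M"
    and nn: "\<And>x. 0 \<le> p x" "\<And>x. 0 \<le> q x"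
    and fin: "finite_measure (density M p)" "finite_measure (density M q)"
  shows "sum_meas (density M p) (density M q) = density M (\<lambda>x. p x + q x)"
proof (rule measure_eqI)
  show "sets (sum_meas (density M p) (density M q)) = sets (density M (\<lambda>x. p x + q x))"
    by (simp add: sets_sum_meas[OF fin])
  fix A assume "A \<in> sets (sum_meas (density M p) (density M q))"
  then have A[measurable]: "A \<in> sets M" by (simp add: sets_sum_meas[OF fin])
  show "emeasure (sum_meas (density M p) (density M q)) A = emeasure (density M (\<lambda>x. p x + q x)) A"
    using A nn by (simp add: emeasure_sum_meas[OF fin] emeasure_density ennreal_plus distrib_right nn_integral_add)
qed

text \<open>The derivatives with respect to \<open>P + Q\<close> are \<open>p / s\<close> and
  \<open>q / s\<close> with \<open>s = p + q\<close>. The integrand is homogeneous of degree one in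
  the two densities, so the weight \<open>s\<close> cancels and \<open>M\<close> can serve as
  reference measure.\<close>

lemma hellinger_density:
  fixes p q :: "'a \<Rightarrow> real"
  assumes [measurable]: "p \<in> borel_measurable M" "q \<in> borel_measurable M"
    and nn: "\<And>x. 0 \<le> p x" "\<And>x. 0 \<le> q x"
    and fin: "finite_measure (density M p)" "finite_measure (density M q)"
    and P: "P = density M p" and Q: "Q = density M q"
  shows "hellinger P Q = sqrt (\<integral>x. (sqrt (p x) - sqrt (q x))\<^sup>2 \<partial>M)"
proof -
  define s where "s x = p x + q x" for x
  have [measurable]: "s \<in> borel_measurable M" by (simp add: s_def[abs_def])
  have s0: "s x \<ge> 0" for x using nn by (simp add: s_def)
  define N where "N = density M s"
  have N: "sum_meas P Q = N" unfolding N_def P Q s_def using assms by (intro sum_meas_density) auto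
  have "finite_measure N"
  proof
    show "emeasure N (space N) \<noteq> \<infinity>" unfolding N[symmetric]
      using fin[THEN finite_measure.emeasure_finite]
      by (simp add: emeasure_sum_meas[OF fin] space_sum_meas[OF fin] P Q)
  qed
  then interpret N: finite_measure N .
  have setsN[simp]: "sets N = sets M" "space N = space M" by (simp_all add: N_def)
  have meas[measurable_cong]: "sets N = sets M" by simp
  \<comment> \<open>The bound \<open>r x \<le> s x\<close> makes \<open>r\<close> vanish where
    \<open>s\<close> does, so the value of a quotient by zero is harmless.\<close>
  have D: "density N (\<lambda>x. ennreal (r x / s x)) = density M r"
    if [measurable]: "r \<in> borel_measurable M" and r: "\<And>x. 0 \<le> r x" "\<And>x. r x \<le> s x" for r :: "'a \<Rightarrow> real"
  proof -
    have "density N (\<lambda>x. ennreal (r x / s x)) = density M (\<lambda>x. ennreal (s x) * ennreal (r x / s x))"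
      unfolding N_def by (rule density_density_eq) auto
    also have "\<dots> = density M r"
    proof (rule density_cong)
      show "AE x in M. ennreal (s x) * ennreal (r x / s x) = ennreal (r x)"
      proof (rule AE_I2)
        fix x show "ennreal (s x) * ennreal (r x / s x) = ennreal (r x)"
          using r[of x] s0[of x] by (cases "s x = 0") (auto simp: ennreal_mult[symmetric])
      qed
    qed auto
    finally show ?thesis .
  qed
  have AE: "AE x in N. ennreal (p x / s x) = RN_deriv N P x" "AE x in N. ennreal (q x / s x) = RN_deriv N Q x"
  proof -
    have "density N (\<lambda>x. ennreal (p x / s x)) = P" "density N (\<lambda>x. ennreal (q x / s x)) = Q"
      unfolding P Q by (rule D; use nn in \<open>simp add: s_def\<close>)+
    then show "AE x in N. ennreal (p x / s x) = RN_deriv N P x" "AE x in N. ennreal (q x / s x) = RN_deriv N Q x"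
      by (auto intro!: N.RN_deriv_unique)
  qed
  have "(\<integral>\<^sup>+ x. ennreal ((sqrt (enn2real (RN_deriv N P x)) - sqrt (enn2real (RN_deriv N Q x)))^2) \<partial>N)
      = (\<integral>\<^sup>+ x. ennreal ((sqrt (p x / s x) - sqrt (q x / s x))^2) \<partial>N)"
  proof (rule nn_integral_cong_AE)
    have *: "0 \<le> p x / s x" "0 \<le> q x / s x" for x using nn s0 by auto
    show "AE x in N. ennreal ((sqrt (enn2real (RN_deriv N P x)) - sqrt (enn2real (RN_deriv N Q x)))^2)
        = ennreal ((sqrt (p x / s x) - sqrt (q x / s x))^2)"
      using AE(1) AE(2) by eventually_elim (metis * enn2real_ennreal)
  qed
  also have "\<dots> = (\<integral>\<^sup>+ x. ennreal (s x) * ennreal ((sqrt (p x / s x) - sqrt (q x / s x))^2) \<partial>M)"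
    unfolding N_def by (rule nn_integral_density) auto
  also have "\<dots> = (\<integral>\<^sup>+ x. ennreal ((sqrt (p x) - sqrt (q x))^2) \<partial>M)"
  proof (rule nn_integral_cong)
    fix x
    show "ennreal (s x) * ennreal ((sqrt (p x / s x) - sqrt (q x / s x))^2) = ennreal ((sqrt (p x) - sqrt (q x))^2)"
    proof (cases "s x = 0")
      case True
      then have "p x = 0" "q x = 0" using nn[of x] by (auto simp: s_def)
      then show ?thesis by simp
    next
      case False
      then have "s x > 0" using s0[of x] by simp
      then have "s x * (sqrt (p x / s x) - sqrt (q x / s x))^2 = (sqrt (p x) - sqrt (q x))^2"
        by (simp add: real_sqrt_divide diff_divide_distrib[symmetric] power_divide)
      then show ?thesis by (metis ennreal_mult s0 zero_le_power2)
    qed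
  qed
  finally show ?thesis
    by (simp add: hellinger_def Let_def N integral_eq_nn_integral)
qed

lemma measure_density_real:
  fixes p :: "'a \<Rightarrow> real"
  assumes [measurable]: "p \<in> borel_measurable M" "A \<in> sets M" and "\<And>x. 0 \<le> p x"
  shows "measure (density M p) A = (\<integral>x. indicator A x * p x \<partial>M)"
proof -
  have "(\<integral>\<^sup>+ x. ennreal (p x) * indicator A x \<partial>M) = (\<integral>\<^sup>+ x. ennreal (indicator A x * p x) \<partial>M)"
    by (intro nn_integral_cong) (auto split: split_indicator)
  then show ?thesis
    using assms(3) by (simp add: measure_def emeasure_density integral_eq_nn_integral)
qed

lemma integrable_density_real:
  fixes p :: "'a \<Rightarrow> real"
  assumes [measurable]: "p \<in> borel_measurable M" and "\<And>x. 0 \<le> p x" "finite_measure (density M p)"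
  shows "integrable M p"
proof (rule integrableI_nonneg)
  have "(\<integral>\<^sup>+ x. ennreal (p x) \<partial>M) = emeasure (density M p) (space (density M p))"
    by (simp add: emeasure_density nn_integral_set_ennreal[symmetric])
  then show "(\<integral>\<^sup>+ x. ennreal (p x) \<partial>M) < \<infinity>"
    using finite_measure.emeasure_finite[OF assms(3), of "space M"] by (simp add: top.not_eq_extremum)
qed (use assms in auto)

lemma integrable_sqrt_diff_sq:
  fixes p q :: "'a \<Rightarrow> real"
  assumes "integrable M p" "integrable M q" "\<And>x. 0 \<le> p x" "\<And>x. 0 \<le> q x"
  shows "integrable M (\<lambda>x. (sqrt (p x) - sqrt (q x))\<^sup>2)"
proof (rule Bochner_Integration.integrable_bound)
  show "integrable M (\<lambda>x. p x + q x)" using assms by simp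
  have [measurable]: "p \<in> borel_measurable M" "q \<in> borel_measurable M" using assms by auto
  show "(\<lambda>x. (sqrt (p x) - sqrt (q x))\<^sup>2) \<in> borel_measurable M" by measurable
  show "AE x in M. norm ((sqrt (p x) - sqrt (q x))\<^sup>2) \<le> norm (p x + q x)"
  proof (rule AE_I2)
    fix x
    have "2 * sqrt (p x) * sqrt (q x) \<le> p x + q x"
      using sum_squares_bound[of "sqrt (p x)" "sqrt (q x)"] assms(3,4)[of x] by simp
    moreover have "0 \<le> sqrt (p x) * sqrt (q x)" using assms(3,4)[of x] by simp
    ultimately show "norm ((sqrt (p x) - sqrt (q x))\<^sup>2) \<le> norm (p x + q x)"
      using assms(3,4)[of x] by (simp add: power2_diff)
  qed
qed

lemma integral_le_sqrt_L2:
  fixes f g :: "'a \<Rightarrow> real"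
  assumes [measurable]: "f \<in> borel_measurable M" "g \<in> borel_measurable M"
    and "integrable M (\<lambda>x. (f x)\<^sup>2)" "integrable M (\<lambda>x. (g x)\<^sup>2)"
  shows "integrable M (\<lambda>x. f x * g x)"
    and "\<bar>\<integral>x. f x * g x \<partial>M\<bar> \<le> sqrt (\<integral>x. (f x)\<^sup>2 \<partial>M) * sqrt (\<integral>x. (g x)\<^sup>2 \<partial>M)"
proof -
  show i: "integrable M (\<lambda>x. f x * g x)"
  proof (rule Bochner_Integration.integrable_bound)
    show "integrable M (\<lambda>x. (f x)\<^sup>2 + (g x)\<^sup>2)" using assms by simp
    have "\<bar>a * b\<bar> \<le> a\<^sup>2 + b\<^sup>2" for a b :: real
      using sum_squares_bound[of "\<bar>a\<bar>" "\<bar>b\<bar>"] by (simp add: abs_mult mult.assoc) (smt (verit) mult_nonneg_nonneg)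
    then show "AE x in M. norm (f x * g x) \<le> norm ((f x)\<^sup>2 + (g x)\<^sup>2)" by (intro AE_I2) simp
  qed simp
  have "(\<integral>x. f x * g x \<partial>M)\<^sup>2 \<le> (\<integral>x. (f x)\<^sup>2 \<partial>M) * (\<integral>x. (g x)\<^sup>2 \<partial>M)"
  proof -
    define a b c where "a = (\<integral>x. (f x)\<^sup>2 \<partial>M)" and "b = (\<integral>x. f x * g x \<partial>M)" and "c = (\<integral>x. (g x)\<^sup>2 \<partial>M)"
    have q: "0 \<le> a * u\<^sup>2 + 2 * b * u * v + c * v\<^sup>2" for u v
    proof -
      have "0 \<le> (\<integral>x. (u * f x + v * g x)\<^sup>2 \<partial>M)" by simp
      also have "(\<lambda>x. (u * f x + v * g x)\<^sup>2) = (\<lambda>x. u\<^sup>2 * (f x)\<^sup>2 + 2 * u * v * (f x * g x) + v\<^sup>2 * (g x)\<^sup>2)"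
        by (auto simp: power2_eq_square algebra_simps)
      also have "(\<integral>x. u\<^sup>2 * (f x)\<^sup>2 + 2 * u * v * (f x * g x) + v\<^sup>2 * (g x)\<^sup>2 \<partial>M) = u\<^sup>2 * a + 2 * u * v * b + v\<^sup>2 * c"
        using i assms(3,4) by (simp add: a_def b_def c_def)
      finally show ?thesis by (simp add: algebra_simps)
    qed
    have "c \<ge> 0" "a \<ge> 0" by (auto simp: c_def a_def)
    have "b\<^sup>2 \<le> a * c"
    proof (cases "c = 0")
      case True
      have "b = 0"
      proof (rule ccontr)
        assume "b \<noteq> 0"
        \<comment> \<open>For \<open>c = 0\<close> the form is linear in \<open>v\<close>; this
          choice of \<open>v\<close> would give it the value -1.\<close>
        have "0 \<le> a * 1\<^sup>2 + 2 * b * 1 * (-(a+1)/(2*b)) + c * (-(a+1)/(2*b))\<^sup>2" by (rule q)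
        then show False using True \<open>b \<noteq> 0\<close> by (simp add: field_simps)
      qed
      then show ?thesis using True by simp
    next
      case False
      have "0 \<le> a * c\<^sup>2 + 2 * b * c * (-b) + c * (-b)\<^sup>2" by (rule q)
      then have "0 \<le> c * (a * c - b\<^sup>2)" by (simp add: power2_eq_square algebra_simps)
      then show ?thesis using False \<open>c \<ge> 0\<close> by (simp add: zero_le_mult_iff)
    qed
    then show ?thesis by (simp add: a_def b_def c_def)
  qed
  then show "\<bar>\<integral>x. f x * g x \<partial>M\<bar> \<le> sqrt (\<integral>x. (f x)\<^sup>2 \<partial>M) * sqrt (\<integral>x. (g x)\<^sup>2 \<partial>M)"
    by (simp add: real_sqrt_mult[symmetric] real_le_rsqrt)
qed

lemma L2_triangle:
  fixes f g :: "'a \<Rightarrow> real"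
  assumes [measurable]: "f \<in> borel_measurable M" "g \<in> borel_measurable M"
    and "integrable M (\<lambda>x. (f x)\<^sup>2)" "integrable M (\<lambda>x. (g x)\<^sup>2)"
  shows "sqrt (\<integral>x. (f x + g x)\<^sup>2 \<partial>M) \<le> sqrt (\<integral>x. (f x)\<^sup>2 \<partial>M) + sqrt (\<integral>x. (g x)\<^sup>2 \<partial>M)"
proof (rule real_le_lsqrt)
  note fg = integral_le_sqrt_L2[OF assms]
  have "(\<integral>x. (f x + g x)\<^sup>2 \<partial>M) = (\<integral>x. (f x)\<^sup>2 + 2 * (f x * g x) + (g x)\<^sup>2 \<partial>M)"
    by (rule Bochner_Integration.integral_cong) (auto simp: power2_eq_square algebra_simps)
  also have "\<dots> = (\<integral>x. (f x)\<^sup>2 \<partial>M) + 2 * (\<integral>x. f x * g x \<partial>M) + (\<integral>x. (g x)\<^sup>2 \<partial>M)"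
    using assms fg(1) by simp
  also have "\<dots> \<le> (sqrt (\<integral>x. (f x)\<^sup>2 \<partial>M) + sqrt (\<integral>x. (g x)\<^sup>2 \<partial>M))\<^sup>2"
    using fg(2) by (simp add: power2_sum)
  finally show "(\<integral>x. (f x + g x)\<^sup>2 \<partial>M) \<le> (sqrt (\<integral>x. (f x)\<^sup>2 \<partial>M) + sqrt (\<integral>x. (g x)\<^sup>2 \<partial>M))\<^sup>2" .
qed (auto intro!: add_nonneg_nonneg)

lemma hellinger_triangle_density:
  fixes p q r :: "'a \<Rightarrow> real"
  assumes "p \<in> borel_measurable M" "q \<in> borel_measurable M" "r \<in> borel_measurable M"
    and nn: "\<And>x. 0 \<le> p x" "\<And>x. 0 \<le> q x" "\<And>x. 0 \<le> r x"
    and fin: "finite_measure (density M p)" "finite_measure (density M q)" "finite_measure (density M r)"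
  shows "hellinger (density M p) (density M r) \<le> hellinger (density M p) (density M q) + hellinger (density M q) (density M r)"
proof -
  note [measurable] = assms(1-3)
  have i: "integrable M p" "integrable M q" "integrable M r"
    using assms by (auto intro: integrable_density_real)
  have "sqrt (\<integral>x. ((sqrt (p x) - sqrt (q x)) + (sqrt (q x) - sqrt (r x)))\<^sup>2 \<partial>M)
    \<le> sqrt (\<integral>x. (sqrt (p x) - sqrt (q x))\<^sup>2 \<partial>M) + sqrt (\<integral>x. (sqrt (q x) - sqrt (r x))\<^sup>2 \<partial>M)"
    by (rule L2_triangle) (use i nn in \<open>auto intro: integrable_sqrt_diff_sq\<close>)
  then show ?thesis
    by (simp add: hellinger_density[OF assms(1,2) nn(1,2) fin(1,2) refl refl]
      hellinger_density[OF assms(2,3) nn(2,3) fin(2,3) refl refl]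
      hellinger_density[OF assms(1,3) nn(1,3) fin(1,3) refl refl])
qed

text \<open>Factor p - q as (sqrt p - sqrt q)(sqrt p + sqrt q) and apply Cauchy-Schwarz. The
  measures are arbitrary because the lower bound applies this to the value of an unknown estimator;
  real densities come from Radon-Nikodym derivatives with respect to \<open>P + Q\<close>.\<close>

lemma total_variation_le_hellinger:
  fixes P Q :: "'a measure"
  assumes "prob_space P" "prob_space Q" and se: "sets Q = sets P" and A: "A \<in> sets P"
  shows "\<bar>measure P A - measure Q A\<bar> \<le> hellinger P Q"
proof -
  interpret P: prob_space P by fact
  interpret Q: prob_space Q by fact
  have fin: "finite_measure P" "finite_measure Q" by unfold_locales
  define N where "N = sum_meas P Q"
  have setsN: "sets N = sets P" "space N = space P"
    using sets_sum_meas[OF fin se] space_sum_meas[OF fin se] by (auto simp: N_def)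
  have [measurable_cong]: "sets N = sets P" by (rule setsN)
  have emN: "A \<in> sets P \<Longrightarrow> emeasure N A = emeasure P A + emeasure Q A" for A
    using emeasure_sum_meas[OF fin se] by (auto simp: N_def)
  interpret N: finite_measure N
    by standard (simp add: emN setsN)
  have acP: "absolutely_continuous N P" and acQ: "absolutely_continuous N Q"
    by (auto simp: absolutely_continuous_def null_sets_def emN setsN se)
  define p q where "p x = enn2real (RN_deriv N P x)" and "q x = enn2real (RN_deriv N Q x)" for x
  have [measurable]: "p \<in> borel_measurable N" "q \<in> borel_measurable N" by (simp_all add: p_def[abs_def] q_def[abs_def])
  have nn: "0 \<le> p x" "0 \<le> q x" for x by (auto simp: p_def q_def)
  have AE: "AE x in N. RN_deriv N P x \<noteq> \<infinity>" "AE x in N. RN_deriv N Q x \<noteq> \<infinity>"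
    using N.RN_deriv_finite[OF P.sigma_finite_measure_axioms acP] N.RN_deriv_finite[OF Q.sigma_finite_measure_axioms acQ] se setsN by auto
  have "density N p = density N (RN_deriv N P)"
    by (rule density_cong) (use AE(1) in \<open>auto simp: p_def top.not_eq_extremum\<close>)
  then have dP: "P = density N p" using N.density_RN_deriv[OF acP] setsN by simp
  have "density N q = density N (RN_deriv N Q)"
    by (rule density_cong) (use AE(2) in \<open>auto simp: q_def top.not_eq_extremum\<close>)
  then have dQ: "Q = density N q" using N.density_RN_deriv[OF acQ] setsN se by simp
  have fd: "finite_measure (density N p)" "finite_measure (density N q)"
    using fin dP dQ by auto
  have H: "hellinger P Q = sqrt (\<integral>x. (sqrt (p x) - sqrt (q x))\<^sup>2 \<partial>N)"
    using nn fd dP dQ by (intro hellinger_density) auto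
  have i: "integrable N p" "integrable N q" using fd nn by (auto intro: integrable_density_real)
  have mP: "measure P B = (\<integral>x. indicator B x * p x \<partial>N)" if "B \<in> sets P" for B
    using that nn(1) setsN by (subst dP) (rule measure_density_real, auto)
  have mQ: "measure Q B = (\<integral>x. indicator B x * q x \<partial>N)" if "B \<in> sets P" for B
    using that nn(2) setsN by (subst dQ) (rule measure_density_real, auto)
  have "integral\<^sup>L N p = measure P (space P)" "integral\<^sup>L N q = measure Q (space P)"
    by (auto simp: mP mQ setsN[symmetric] intro!: Bochner_Integration.integral_cong)
  then have tot: "integral\<^sup>L N p = 1" "integral\<^sup>L N q = 1"
    using P.prob_space Q.prob_space se sets_eq_imp_space_eq[OF se] by auto
  \<comment> \<open>Both total masses are 1, so subtracting 1/2 from the indicator changes nothing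
    in the integral of h (p - q), while it reduces the constant from 2 to 1.\<close>
  define h where "h x = indicator A x - (1/2::real)" for x
  have [measurable]: "h \<in> borel_measurable N" using A by (simp add: h_def[abs_def])
  have hb: "(h x)\<^sup>2 = 1/4" for x by (auto simp: h_def indicator_def power2_eq_square)
  have "measure P A - measure Q A = (\<integral>x. indicator A x * p x - indicator A x * q x \<partial>N)"
    using A setsN i by (simp add: mP mQ integrable_mult_indicator integrable_real_mult_indicator mult.commute[of "indicator A _"])
  also have "\<dots> = (\<integral>x. indicator A x * p x - indicator A x * q x \<partial>N) - 1/2 * ((\<integral>x. p x \<partial>N) - (\<integral>x. q x \<partial>N))"
    using tot by simp
  also have "\<dots> = (\<integral>x. (indicator A x * p x - indicator A x * q x) - 1/2 * (p x - q x) \<partial>N)"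
    using A setsN i by (simp add: integrable_real_mult_indicator mult.commute[of "indicator A _"])
  also have "\<dots> = (\<integral>x. (h x * (sqrt (p x) + sqrt (q x))) * (sqrt (p x) - sqrt (q x)) \<partial>N)"
  proof (rule Bochner_Integration.integral_cong)
    fix x
    have "(sqrt (p x) + sqrt (q x)) * (sqrt (p x) - sqrt (q x)) = p x - q x"
      using nn[of x] by (simp add: algebra_simps)
    then have "h x * (sqrt (p x) + sqrt (q x)) * (sqrt (p x) - sqrt (q x)) = h x * (p x - q x)"
      by (simp only: mult.assoc)
    then show "(indicator A x * p x - indicator A x * q x) - 1/2 * (p x - q x) = (h x * (sqrt (p x) + sqrt (q x))) * (sqrt (p x) - sqrt (q x))"
      by (simp add: h_def algebra_simps)
  qed simp
  finally have e: "measure P A - measure Q A = (\<integral>x. (h x * (sqrt (p x) + sqrt (q x))) * (sqrt (p x) - sqrt (q x)) \<partial>N)" .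
  have le: "(h x * (sqrt (p x) + sqrt (q x)))\<^sup>2 \<le> (p x + q x) / 2" for x
  proof -
    have "(sqrt (p x) + sqrt (q x))\<^sup>2 \<le> 2 * (p x + q x)"
      using nn[of x] sum_squares_bound[of "sqrt (p x)" "sqrt (q x)"] by (simp add: power2_sum)
    then show ?thesis by (simp add: power_mult_distrib hb)
  qed
  have i2: "integrable N (\<lambda>x. (h x * (sqrt (p x) + sqrt (q x)))\<^sup>2)"
    by (rule Bochner_Integration.integrable_bound[of N "\<lambda>x. (p x + q x)/2"]) (use i le nn in auto)
  have "(\<integral>x. (h x * (sqrt (p x) + sqrt (q x)))\<^sup>2 \<partial>N) \<le> (\<integral>x. (p x + q x)/2 \<partial>N)"
    using i i2 le by (intro integral_mono) auto
  also have "\<dots> = 1" using i tot by simp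
  finally have s1: "sqrt (\<integral>x. (h x * (sqrt (p x) + sqrt (q x)))\<^sup>2 \<partial>N) \<le> 1" by simp
  have "\<bar>measure P A - measure Q A\<bar> \<le> sqrt (\<integral>x. (h x * (sqrt (p x) + sqrt (q x)))\<^sup>2 \<partial>N) * hellinger P Q"
    unfolding e H by (rule integral_le_sqrt_L2) (use i i2 nn in \<open>auto intro: integrable_sqrt_diff_sq\<close>)
  also have "\<dots> \<le> 1 * hellinger P Q"
    by (rule mult_right_mono[OF s1]) (simp add: H)
  finally show ?thesis by simp
qed

section \<open>Gaussian densities\<close>

definition ip :: "nat \<Rightarrow> (nat \<Rightarrow> real) \<Rightarrow> (nat \<Rightarrow> real) \<Rightarrow> real" where
  "ip d u v = (\<Sum>i<d. u i * v i)"

definition gd :: "nat \<Rightarrow> (nat \<Rightarrow> real) \<Rightarrow> (nat \<Rightarrow> real) \<Rightarrow> real" where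
  "gd d m x = (\<Prod>i<d. normal_density (m i) 1 (x i))"

lemma ip_commute: "ip d u v = ip d v u"
  by (simp add: ip_def mult.commute)

lemma ip_add_left: "ip d (\<lambda>t. u t + v t) w = ip d u w + ip d v w"
  by (simp add: ip_def sum.distrib distrib_right)

lemma ip_add_right: "ip d w (\<lambda>t. u t + v t) = ip d w u + ip d w v"
  by (simp add: ip_def sum.distrib distrib_left)

lemma ip_diff_left: "ip d (\<lambda>t. u t - v t) w = ip d u w - ip d v w"
  by (simp add: ip_def sum_subtractf left_diff_distrib)

lemma ip_diff_right: "ip d w (\<lambda>t. u t - v t) = ip d w u - ip d w v"
  by (simp add: ip_def sum_subtractf right_diff_distrib)

lemma ip_scale_left: "ip d (\<lambda>t. c * u t) w = c * ip d u w"
  by (simp add: ip_def sum_distrib_left mult.assoc)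

lemma ip_scale_right: "ip d w (\<lambda>t. c * u t) = c * ip d w u"
  by (simp add: ip_def sum_distrib_left mult_ac)

lemma ip_sum_left: "ip d (\<lambda>t. \<Sum>a\<in>A. f a t) w = (\<Sum>a\<in>A. ip d (f a) w)"
  unfolding ip_def sum_distrib_right by (rule sum.swap)

lemma ip_self_nonneg: "0 \<le> ip d u u"
  by (simp add: ip_def sum_nonneg)

lemma ip_self_eq_0: "ip d u u = 0 \<longleftrightarrow> (\<forall>t<d. u t = 0)"
  by (auto simp: ip_def sum_nonneg_eq_0_iff)

lemma ip_self_minus_le: "ip d (\<lambda>t. u t - v t) (\<lambda>t. u t - v t) \<le> 2 * ip d u u + 2 * ip d v v"
proof -
  have "0 \<le> ip d (\<lambda>t. u t + v t) (\<lambda>t. u t + v t)" by (rule ip_self_nonneg)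
  then show ?thesis
    by (simp add: ip_add_left ip_add_right ip_diff_left ip_diff_right ip_commute[of d v u])
qed

lemma enorm_le_iff: "R \<ge> 0 \<Longrightarrow> enorm d v \<le> R \<longleftrightarrow> ip d v v \<le> R\<^sup>2"
  by (simp add: enorm_def ip_def power2_eq_square real_sqrt_le_iff' sqrt_le_D)
    (metis abs_of_nonneg power2_eq_square real_sqrt_abs real_sqrt_le_iff)

interpretation lborel_prod: product_sigma_finite "\<lambda>_::nat. lborel :: real measure"
  by standard

lemma gd_measurable [measurable]: "gd d m \<in> borel_measurable (Rd d)"
  unfolding gd_def[abs_def] Rd_def by measurable

lemma gd_pos: "gd d m x > 0"
  unfolding gd_def by (auto intro!: prod_pos normal_density_pos)

lemma gd_nonneg: "gd d m x \<ge> 0"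
  using gd_pos[of d m x] by simp

lemma integrable_gd: "integrable (Rd d) (gd d m)"
  unfolding gd_def[abs_def] Rd_def
  by (rule lborel_prod.product_integrable_prod) auto

lemma integral_gd: "(\<integral>x. gd d m x \<partial>Rd d) = 1"
  unfolding gd_def[abs_def] Rd_def
  by (subst lborel_prod.product_integral_prod) auto

text \<open>Completing the square: an exponential tilt in direction \<open>v\<close> translates the
  mean by \<open>v\<close>.\<close>

lemma gd_shift:
  "gd d m x * exp (\<Sum>i<d. (x i - m i) * v i) = exp (ip d v v / 2) * gd d (\<lambda>i. m i + v i) x"
proof -
  have "normal_density (m i) 1 (x i) * exp ((x i - m i) * v i)
      = exp (v i * v i / 2) * normal_density (m i + v i) 1 (x i)" for i
  proof -
    have "- (x i - m i)\<^sup>2 / 2 + (x i - m i) * v i = v i * v i / 2 + - (x i - (m i + v i))\<^sup>2 / 2"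
      by (simp add: power2_eq_square field_simps)
    then show ?thesis by (simp add: normal_density_def exp_add[symmetric])
  qed
  then show ?thesis
    unfolding gd_def ip_def sum_divide_distrib
    by (simp add: exp_sum prod.distrib[symmetric])
qed

lemma gd_ratio:
  "gd d m x / gd d u x = exp ((\<Sum>i<d. (x i - u i) * (m i - u i)) - ip d (\<lambda>i. m i - u i) (\<lambda>i. m i - u i) / 2)"
proof -
  define s where "s = (\<Sum>i<d. (x i - u i) * (m i - u i))"
  define t where "t = ip d (\<lambda>i. m i - u i) (\<lambda>i. m i - u i) / 2"
  have "gd d u x * exp s = exp t * gd d m x"
    using gd_shift[of d u x "\<lambda>i. m i - u i"] by (simp add: s_def t_def)
  then have "gd d m x / gd d u x = exp (s - t)"
    using gd_pos[of d u x] by (simp add: exp_diff divide_simps mult.commute)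
  then show ?thesis by (simp only: s_def t_def)
qed

text \<open>The quadratic terms of the three exponents combine to a single one, so the quotient is
  again a multiple of a Gaussian density. Its total mass is the kernel exp<a - u, b - u> on which
  the upper bound rests.\<close>

lemma gd_mult_divide:
  "gd d a x * gd d b x / gd d u x
    = exp (ip d (\<lambda>i. a i - u i) (\<lambda>i. b i - u i)) * gd d (\<lambda>i. a i + b i - u i) x"
proof -
  have "gd d a x * gd d b x / gd d u x
      = gd d a x * (exp (\<Sum>i<d. (x i - a i) * (b i - u i)) * exp (ip d (\<lambda>i. a i - u i) (\<lambda>i. b i - u i) - ip d (\<lambda>i. b i - u i) (\<lambda>i. b i - u i) / 2))"
  proof -
    have "(\<Sum>i<d. (x i - u i) * (b i - u i)) = (\<Sum>i<d. (x i - a i) * (b i - u i)) + ip d (\<lambda>i. a i - u i) (\<lambda>i. b i - u i)"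
      unfolding ip_def sum.distrib[symmetric] by (rule sum.cong) (auto simp: algebra_simps)
    then have "gd d b x / gd d u x = exp (\<Sum>i<d. (x i - a i) * (b i - u i)) * exp (ip d (\<lambda>i. a i - u i) (\<lambda>i. b i - u i) - ip d (\<lambda>i. b i - u i) (\<lambda>i. b i - u i) / 2)"
      unfolding gd_ratio exp_add[symmetric] by simp
    then show ?thesis by (metis times_divide_eq_right)
  qed
  also have "\<dots> = exp (ip d (\<lambda>i. b i - u i) (\<lambda>i. b i - u i) / 2) * gd d (\<lambda>i. a i + (b i - u i)) x * exp (ip d (\<lambda>i. a i - u i) (\<lambda>i. b i - u i) - ip d (\<lambda>i. b i - u i) (\<lambda>i. b i - u i) / 2)"
    using gd_shift[of d a x "\<lambda>i. b i - u i"] by (simp add: mult.assoc[symmetric])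
  also have "\<dots> = exp (ip d (\<lambda>i. a i - u i) (\<lambda>i. b i - u i)) * gd d (\<lambda>i. a i + (b i - u i)) x"
    by (simp add: exp_diff)
  finally show ?thesis by (simp add: algebra_simps)
qed

text \<open>Serves the test function (p - q) / \<phi>: its square integrated against the component
  with mean \<open>u\<close> becomes the integral of (p - q)^2 over the Gaussian density with mean
  \<open>- u\<close>, a centre of the same norm.\<close>

lemma gd_divide_sq:
  "gd d u x / (gd d (\<lambda>_. 0) x)\<^sup>2 = exp (- ip d u u) / gd d (\<lambda>i. - u i) x"
proof -
  have "gd d u x * gd d (\<lambda>i. - u i) x / gd d (\<lambda>_. 0) x = exp (- ip d u u) * gd d (\<lambda>_. 0) x"
    unfolding gd_mult_divide by (simp add: ip_def sum_negf)
  then show ?thesis using gd_pos[of d "\<lambda>i. - u i" x] gd_pos[of d "\<lambda>_. 0" x]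
    by (simp add: field_simps power2_eq_square)
qed


lemma
  fixes c :: "nat \<Rightarrow> real" and v :: "nat \<Rightarrow> nat \<Rightarrow> real"
  shows integrable_signed_mixture_sq:
      "integrable (Rd d) (\<lambda>x. (\<Sum>i<n. c i * gd d (v i) x)\<^sup>2 / gd d u x)" (is ?I)
    and integral_signed_mixture_sq:
      "(\<integral>x. (\<Sum>i<n. c i * gd d (v i) x)\<^sup>2 / gd d u x \<partial>Rd d)
        = (\<Sum>i<n. \<Sum>j<n. c i * c j * exp (ip d (\<lambda>t. v i t - u t) (\<lambda>t. v j t - u t)))" (is ?E)
proof -
  have *: "(\<Sum>i<n. c i * gd d (v i) x)\<^sup>2 / gd d u x
    = (\<Sum>i<n. \<Sum>j<n. c i * c j * exp (ip d (\<lambda>t. v i t - u t) (\<lambda>t. v j t - u t)) * gd d (\<lambda>t. v i t + v j t - u t) x)" for x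
    unfolding power2_eq_square sum_product sum_divide_distrib
  proof (intro sum.cong refl)
    fix i j
    show "c i * gd d (v i) x * (c j * gd d (v j) x) / gd d u x = c i * c j * exp (ip d (\<lambda>t. v i t - u t) (\<lambda>t. v j t - u t)) * gd d (\<lambda>t. v i t + v j t - u t) x"
      unfolding mult.assoc gd_mult_divide[symmetric] by simp
  qed
  show ?I unfolding * by (intro Bochner_Integration.integrable_sum integrable_mult_right integrable_gd)
  show ?E unfolding *
    by (subst Bochner_Integration.integral_sum Bochner_Integration.integral_mult_right_zero integral_gd
        | intro Bochner_Integration.integrable_sum integrable_mult_right integrable_gd sum.cong refl | simp add: integral_gd)+
qed

section \<open>Newton interpolation of moment tensors\<close>

definition qf :: "nat \<Rightarrow> (nat \<Rightarrow> real) \<Rightarrow> (nat \<Rightarrow> nat \<Rightarrow> real) \<Rightarrow> real" where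
  "qf n c K = (\<Sum>i<n. \<Sum>j<n. c i * c j * K i j)"

definition psd :: "nat \<Rightarrow> (nat \<Rightarrow> nat \<Rightarrow> real) \<Rightarrow> bool" where
  "psd n K \<longleftrightarrow> (\<forall>c. 0 \<le> qf n c K)"

lemma qf_nonneg: "psd n K \<Longrightarrow> 0 \<le> qf n c K"
  by (simp add: psd_def)

lemma qf_cong: "(\<And>i j. i < n \<Longrightarrow> j < n \<Longrightarrow> K i j = L i j) \<Longrightarrow> qf n c K = qf n c L"
  unfolding qf_def by (intro sum.cong) auto

text \<open>A Gram factor splits over coordinates, and each coordinate can be absorbed into the
  weights. Both the closure of \<open>psd\<close> under such factors and the shift inequality below
  follow from this.\<close>

lemma qf_mult_ip:
  "qf n c (\<lambda>i j. K i j * ip d (x i) (x j)) = (\<Sum>t<d. qf n (\<lambda>i. c i * x i t) K)"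
  unfolding qf_def ip_def sum_distrib_left
  by (subst (2) sum.swap, subst sum.swap) (intro sum.cong refl, simp add: mult_ac)+

lemma psd_one: "psd n (\<lambda>_ _. 1)"
  unfolding psd_def qf_def by (simp add: sum_product[symmetric])

lemma psd_mult_ip: "psd n K \<Longrightarrow> psd n (\<lambda>i j. K i j * ip d (x i) (x j))"
  unfolding psd_def qf_mult_ip by (auto intro: sum_nonneg)

lemma psd_mult_ip_power: "psd n K \<Longrightarrow> psd n (\<lambda>i j. K i j * ip d (x i) (x j) ^ m)"
proof (induction m)
  case (Suc m)
  then have "psd n (\<lambda>i j. (K i j * ip d (x i) (x j) ^ m) * ip d (x i) (x j))"
    by (intro psd_mult_ip) simp
  then show ?case by (simp add: mult_ac)
qed simp

lemma psd_prod_ip: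
  fixes k :: nat
  shows "psd n (\<lambda>i j. \<Prod>s<k. ip d (x s i) (x s j))"
proof (induction k)
  case (Suc k)
  then show ?case using psd_mult_ip[of n _ d "x k"] by simp
qed (simp add: psd_one)

lemma qf_parallelogram:
  assumes "psd n K" "\<And>i. i < n \<Longrightarrow> c i = a i + b i"
  shows "qf n c K \<le> 2 * qf n a K + 2 * qf n b K"
proof -
  have "qf n c K = qf n (\<lambda>i. a i + b i) K"
    unfolding qf_def using assms(2) by (intro sum.cong) auto
  moreover have "qf n (\<lambda>i. a i + b i) K + qf n (\<lambda>i. a i - b i) K = 2 * qf n a K + 2 * qf n b K"
    unfolding qf_def sum_distrib_left sum.distrib[symmetric]
    by (intro sum.cong refl) (simp add: algebra_simps)
  moreover have "0 \<le> qf n (\<lambda>i. a i - b i) K" using assms(1) by (rule qf_nonneg)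
  ultimately show ?thesis by linarith
qed

text \<open>The parallelogram inequality in each coordinate. It trades one Gram factor for a
  constant plus a Gram factor with another base point, the elementary move of Newton
  interpolation.\<close>

lemma qf_mult_ip_shift:
  assumes "psd n K" "\<And>i t. i < n \<Longrightarrow> t < d \<Longrightarrow> x i t = b t + e i t"
  shows "qf n c (\<lambda>i j. K i j * ip d (x i) (x j))
    \<le> 2 * ip d b b * qf n c K + 2 * qf n c (\<lambda>i j. K i j * ip d (e i) (e j))"
proof -
  have "qf n (\<lambda>i. c i * x i t) K \<le> 2 * qf n (\<lambda>i. c i * b t) K + 2 * qf n (\<lambda>i. c i * e i t) K"
    if "t < d" for t
    using that assms by (intro qf_parallelogram) (auto simp: algebra_simps)
  then have "(\<Sum>t<d. qf n (\<lambda>i. c i * x i t) K) \<le> (\<Sum>t<d. 2 * qf n (\<lambda>i. c i * b t) K + 2 * qf n (\<lambda>i. c i * e i t) K)"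
    by (intro sum_mono) auto
  also have "\<dots> = 2 * (\<Sum>t<d. qf n (\<lambda>i. c i * b t) K) + 2 * (\<Sum>t<d. qf n (\<lambda>i. c i * e i t) K)"
    by (simp add: sum.distrib sum_distrib_left)
  also have "(\<Sum>t<d. qf n (\<lambda>i. c i * b t) K) = ip d b b * qf n c K"
    unfolding qf_mult_ip[where x = "\<lambda>_. b", symmetric]
    unfolding qf_def sum_distrib_left by (intro sum.cong refl) (simp add: mult_ac)
  finally show ?thesis
    unfolding qf_mult_ip by simp
qed

text \<open>The squared norm of the tensor \<Sum> c_i v_i^(tensor l), written through inner
  products.\<close>

definition moment :: "nat \<Rightarrow> nat \<Rightarrow> (nat \<Rightarrow> real) \<Rightarrow> (nat \<Rightarrow> nat \<Rightarrow> real) \<Rightarrow> nat \<Rightarrow> real" where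
  "moment d n c v l = qf n c (\<lambda>i j. ip d (v i) (v j) ^ l)"

lemma moment_nonneg: "0 \<le> moment d n c v l"
  using psd_mult_ip_power[OF psd_one, of n d v l] by (simp add: moment_def qf_nonneg)

text \<open>The Gram kernel of the tensors with factors v_i - v_s for s < k, followed by m factors
  v_i - u: the Newton basis whose nodes are the atoms themselves.\<close>

definition newton_kernel :: "nat \<Rightarrow> (nat \<Rightarrow> nat \<Rightarrow> real) \<Rightarrow> (nat \<Rightarrow> real) \<Rightarrow> nat \<Rightarrow> nat \<Rightarrow> nat \<Rightarrow> nat \<Rightarrow> real" where
  "newton_kernel d v u k m i j =
    (\<Prod>s<k. ip d (\<lambda>t. v i t - v s t) (\<lambda>t. v j t - v s t)) * ip d (\<lambda>t. v i t - u t) (\<lambda>t. v j t - u t) ^ m"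

lemma psd_newton_kernel: "psd n (newton_kernel d v u k m)"
  unfolding newton_kernel_def[abs_def]
  by (intro psd_mult_ip_power psd_prod_ip[where x = "\<lambda>s i t. v i t - v s t"])

text \<open>Write v_i - u = (v_k - u) + (v_i - v_k): one factor at \<open>u\<close> is replaced by a
  constant or by the next node.\<close>

lemma newton_kernel_step_up:
  assumes "k < n"
  shows "qf n c (newton_kernel d v u k (Suc m))
    \<le> 2 * ip d (\<lambda>t. v k t - u t) (\<lambda>t. v k t - u t) * qf n c (newton_kernel d v u k m)
      + 2 * qf n c (newton_kernel d v u (Suc k) m)"
proof -
  have "qf n c (\<lambda>i j. newton_kernel d v u k m i j * ip d (\<lambda>t. v i t - u t) (\<lambda>t. v j t - u t))
    \<le> 2 * ip d (\<lambda>t. v k t - u t) (\<lambda>t. v k t - u t) * qf n c (newton_kernel d v u k m)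
      + 2 * qf n c (\<lambda>i j. newton_kernel d v u k m i j * ip d (\<lambda>t. v i t - v k t) (\<lambda>t. v j t - v k t))"
    by (rule qf_mult_ip_shift[OF psd_newton_kernel]) simp
  then show ?thesis by (simp add: newton_kernel_def[abs_def] mult_ac)
qed

text \<open>Write v_i - v_k = - v_k + v_i: the last node is exchanged for the origin, which leads
  back to plain moments.\<close>

lemma newton_kernel_step_down:
  shows "qf n c (newton_kernel d v (\<lambda>_. 0) (Suc k) m)
    \<le> 2 * ip d (v k) (v k) * qf n c (newton_kernel d v (\<lambda>_. 0) k m)
      + 2 * qf n c (newton_kernel d v (\<lambda>_. 0) k (Suc m))"
proof -
  have "qf n c (\<lambda>i j. newton_kernel d v (\<lambda>_. 0) k m i j * ip d (\<lambda>t. v i t - v k t) (\<lambda>t. v j t - v k t))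
    \<le> 2 * ip d (\<lambda>t. - v k t) (\<lambda>t. - v k t) * qf n c (newton_kernel d v (\<lambda>_. 0) k m)
      + 2 * qf n c (\<lambda>i j. newton_kernel d v (\<lambda>_. 0) k m i j * ip d (v i) (v j))"
    by (rule qf_mult_ip_shift[OF psd_newton_kernel]) simp
  moreover have "ip d (\<lambda>t. - v k t) (\<lambda>t. - v k t) = ip d (v k) (v k)" by (simp add: ip_def)
  ultimately show ?thesis by (simp add: newton_kernel_def[abs_def] mult_ac)
qed

text \<open>The factor with index \<open>s = i\<close> makes the kernel of order \<open>n\<close> vanish on the \<open>n\<close> atoms.\<close>
lemma newton_kernel_vanish: "qf n c (newton_kernel d v u n m) = 0"
proof -
  have "(\<Prod>s<n. ip d (\<lambda>t. v i t - v s t) (\<lambda>t. v j t - v s t)) = 0" if "i < n" for i j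
    using that by (intro prod_zero) (auto simp: ip_def intro!: bexI[of _ i])
  then show ?thesis unfolding qf_def newton_kernel_def by (intro sum.neutral ballI) (simp only: lessThan_iff mult_zero_left mult_zero_right)
qed

text \<open>Newton kernels of order below n reduce to moments of order below n; from there kernels
  with more factors at \<open>u\<close> grow only geometrically, since order n contributes zero. The
  factorials of the exponential series then sum this growth to exp(8 R^2 + 2).\<close>

lemma exp_kernel_le_moments:
  assumes v: "\<And>i. i < n \<Longrightarrow> ip d (v i) (v i) \<le> R\<^sup>2" and u: "ip d u u \<le> R\<^sup>2"
    and N: "\<And>l. l < n \<Longrightarrow> moment d n c v l \<le> N" and "0 \<le> N"
  shows "qf n c (\<lambda>i j. exp (ip d (\<lambda>t. v i t - u t) (\<lambda>t. v j t - u t)))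
    \<le> exp (8 * R\<^sup>2 + 2) * (2 + 2 * R\<^sup>2) ^ n * N"
proof -
  let ?z = "\<lambda>_::nat. 0 :: real"
  \<comment> \<open>\<open>\<beta>\<close> is the factor lost per step down, 2 |v_k|^2 + 2, and
    \<open>\<alpha>\<close> the factor lost per step up, 2 |v_k - u|^2 + 2 with |v_k - u|^2 \<le> 4
    R^2.\<close>
  define \<beta> where "\<beta> = 2 + 2 * R\<^sup>2"
  define \<alpha> where "\<alpha> = 8 * R\<^sup>2 + 2"
  have \<beta>: "1 \<le> \<beta>" and \<alpha>: "0 \<le> \<alpha>" by (auto simp: \<beta>_def \<alpha>_def)
  have low: "qf n c (newton_kernel d v ?z k m) \<le> \<beta> ^ k * N" if "k + m < n" for k m
    using that
  proof (induction k arbitrary: m)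
    case 0
    then show ?case using N[of m] by (simp add: newton_kernel_def[abs_def] moment_def)
  next
    case (Suc k)
    have "qf n c (newton_kernel d v ?z (Suc k) m) \<le> 2 * ip d (v k) (v k) * qf n c (newton_kernel d v ?z k m)
      + 2 * qf n c (newton_kernel d v ?z k (Suc m))" by (rule newton_kernel_step_down)
    also have "\<dots> \<le> 2 * R\<^sup>2 * (\<beta> ^ k * N) + 2 * (\<beta> ^ k * N)"
      using Suc v[of k]
      by (intro add_mono mult_mono mult_left_mono) (auto intro!: qf_nonneg psd_newton_kernel)
    also have "\<dots> = \<beta> ^ Suc k * N" by (simp add: \<beta>_def algebra_simps)
    finally show ?case .
  qed
  define B where "B = \<beta> ^ n * N"
  have B: "0 \<le> B" using \<beta> \<open>0 \<le> N\<close> by (simp add: B_def)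
  \<comment> \<open>For \<open>m = 0\<close> no factor involves \<open>u\<close>, so the kernel
    agrees with the one based at the origin.\<close>
  have low0: "qf n c (newton_kernel d v u k 0) \<le> B" if "k < n" for k
  proof -
    have "qf n c (newton_kernel d v u k 0) = qf n c (newton_kernel d v ?z k 0)"
      by (simp add: newton_kernel_def[abs_def])
    also have "\<dots> \<le> \<beta> ^ k * N" using low[of k 0] that by simp
    also have "\<dots> \<le> B" unfolding B_def
      using that \<beta> \<open>0 \<le> N\<close> by (intro mult_right_mono power_increasing) auto
    finally show ?thesis .
  qed
  \<comment> \<open>The induction on \<open>m\<close> is uniform in \<open>k\<close>, because a step
    up lowers \<open>m\<close> but may raise \<open>k\<close>; the chain ends at
    \<open>k = n\<close>, where the kernel vanishes.\<close>
  have up: "qf n c (newton_kernel d v u k m) \<le> \<alpha> ^ m * B" if "k \<le> n" for k m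
    using that
  proof (induction m arbitrary: k)
    case 0
    then show ?case using low0[of k] newton_kernel_vanish[of n c d v u] B by (cases "k = n") auto
  next
    case (Suc m)
    show ?case
    proof (cases "k = n")
      case True
      then show ?thesis using newton_kernel_vanish[of n c d v u] B \<alpha> by simp
    next
      case False
      then have k: "k < n" using Suc by simp
      have "ip d (\<lambda>t. v k t - u t) (\<lambda>t. v k t - u t) \<le> 4 * R\<^sup>2"
        using ip_self_minus_le[of d "v k" u] v[OF k] u by linarith
      then have "2 * ip d (\<lambda>t. v k t - u t) (\<lambda>t. v k t - u t) * qf n c (newton_kernel d v u k m)
          + 2 * qf n c (newton_kernel d v u (Suc k) m)
        \<le> 2 * (4 * R\<^sup>2) * (\<alpha> ^ m * B) + 2 * (\<alpha> ^ m * B)"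
        using Suc.IH[of k] Suc.IH[of "Suc k"] k
        by (intro add_mono mult_mono mult_left_mono) (auto intro!: qf_nonneg psd_newton_kernel)
      also have "\<dots> = \<alpha> ^ Suc m * B" by (simp add: \<alpha>_def algebra_simps)
      finally show ?thesis using newton_kernel_step_up[OF k, of c d v u m] by linarith
    qed
  qed
  have s1: "(\<lambda>m. qf n c (newton_kernel d v u 0 m) / fact m) sums
      qf n c (\<lambda>i j. exp (ip d (\<lambda>t. v i t - u t) (\<lambda>t. v j t - u t)))"
    unfolding qf_def newton_kernel_def sum_divide_distrib
  proof (intro sums_sum)
    fix i j
    have "(\<lambda>m. c i * c j * (ip d (\<lambda>t. v i t - u t) (\<lambda>t. v j t - u t) ^ m /\<^sub>R fact m)) sums
      (c i * c j * exp (ip d (\<lambda>t. v i t - u t) (\<lambda>t. v j t - u t)))"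
      by (intro sums_mult exp_converges)
    then show "(\<lambda>m. c i * c j * ((\<Prod>s<0. ip d (\<lambda>t. v i t - v s t) (\<lambda>t. v j t - v s t)) *
         ip d (\<lambda>t. v i t - u t) (\<lambda>t. v j t - u t) ^ m) / fact m) sums
      (c i * c j * exp (ip d (\<lambda>t. v i t - u t) (\<lambda>t. v j t - u t)))"
      by (simp add: divide_inverse mult_ac)
  qed
  have s2: "(\<lambda>m. \<alpha> ^ m /\<^sub>R fact m * B) sums (exp \<alpha> * B)"
    by (intro sums_mult2 exp_converges)
  have "qf n c (\<lambda>i j. exp (ip d (\<lambda>t. v i t - u t) (\<lambda>t. v j t - u t))) \<le> exp \<alpha> * B"
    by (rule sums_le[OF _ s1 s2]) (use up[of 0] in \<open>auto simp: field_simps\<close>)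
  then show ?thesis by (simp add: B_def \<alpha>_def \<beta>_def mult_ac)
qed

text \<open>All terms of the exponential series are nonnegative, so each of them is bounded by the
  sum.\<close>

lemma moment_le_exp_kernel:
  assumes "l < n"
  shows "moment d n c v l \<le> fact n * qf n c (\<lambda>i j. exp (ip d (v i) (v j)))"
proof -
  let ?S = "qf n c (\<lambda>i j. exp (ip d (v i) (v j)))"
  have s: "(\<lambda>m. moment d n c v m / fact m) sums ?S"
    unfolding qf_def moment_def sum_divide_distrib
  proof (intro sums_sum)
    fix i j
    have "(\<lambda>m. c i * c j * (ip d (v i) (v j) ^ m /\<^sub>R fact m)) sums (c i * c j * exp (ip d (v i) (v j)))"
      by (intro sums_mult exp_converges)
    then show "(\<lambda>m. c i * c j * ip d (v i) (v j) ^ m / fact m) sums (c i * c j * exp (ip d (v i) (v j)))"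
      by (simp add: divide_inverse mult_ac)
  qed
  have "(\<Sum>m\<in>{l}. moment d n c v m / fact m) \<le> ?S"
    using moment_nonneg by (intro sum_le_suminf[THEN order_trans, OF _ _ _ eq_refl[OF sums_unique[OF s, symmetric]]])
      (auto intro: sums_summable[OF s])
  then have "moment d n c v l \<le> fact l * ?S" by (simp add: field_simps)
  also have "\<dots> \<le> fact n * ?S"
  proof (rule mult_right_mono)
    show "fact l \<le> (fact n :: real)" using assms by (intro fact_mono) simp
    show "0 \<le> ?S" by (rule sums_le[OF _ sums_zero s]) (simp add: moment_nonneg)
  qed
  finally show ?thesis .
qed

section \<open>Moment tensors and the Hellinger distance\<close>

type_synonym mixing = "(nat \<Rightarrow> real) \<times> (nat \<Rightarrow> nat \<Rightarrow> real)"

definition mixd :: "nat \<Rightarrow> nat \<Rightarrow> mixing \<Rightarrow> (nat \<Rightarrow> real) \<Rightarrow> real" where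
  "mixd k d G x = (\<Sum>j<k. fst G j * gd d (snd G j) x)"

lemma mix_density_eq_mixd: "mix_density k d (fst G) (snd G) = mixd k d G"
  by (simp add: mix_density_def mixd_def gd_def fun_eq_iff)

lemma PGamma_eq: "PGamma k d G = density (Rd d) (mixd k d G)"
  by (simp add: PGamma_def mix_density_eq_mixd)

abbreviation hdist :: "nat \<Rightarrow> nat \<Rightarrow> mixing \<Rightarrow> mixing \<Rightarrow> real" where
  "hdist k d G G' \<equiv> hellinger (PGamma k d G) (PGamma k d G')"

lemma GkdD:
  assumes "G \<in> Gkd k d R"
  shows "\<And>j. j < k \<Longrightarrow> 0 \<le> fst G j" "(\<Sum>j<k. fst G j) = 1"
    and "\<And>j. j < k \<Longrightarrow> 0 \<le> R \<Longrightarrow> ip d (snd G j) (snd G j) \<le> R\<^sup>2"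
  using assms by (auto simp: Gkd_def enorm_le_iff[symmetric] split: prod.splits)

lemma mixd_measurable [measurable]: "mixd k d G \<in> borel_measurable (Rd d)"
  unfolding mixd_def[abs_def] by measurable

lemma mixd_nonneg: "G \<in> Gkd k d R \<Longrightarrow> 0 \<le> mixd k d G x"
  unfolding mixd_def by (intro sum_nonneg mult_nonneg_nonneg gd_nonneg GkdD(1)) auto

lemma mixd_pos:
  assumes "G \<in> Gkd k d R" shows "0 < mixd k d G x"
proof -
  have "\<exists>j<k. 0 < fst G j"
  proof (rule ccontr)
    assume "\<not> ?thesis"
    then have "\<forall>j<k. fst G j = 0" using GkdD(1)[OF assms] by force
    then show False using GkdD(2)[OF assms] by simp
  qed
  then obtain j where "j < k" "0 < fst G j" by auto
  then show ?thesis unfolding mixd_def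
    by (intro sum_pos2[of _ j] mult_nonneg_nonneg gd_nonneg mult_pos_pos gd_pos GkdD(1)[OF assms]) auto
qed

lemma integrable_mixd: "integrable (Rd d) (mixd k d G)"
  unfolding mixd_def[abs_def] by (intro Bochner_Integration.integrable_sum integrable_mult_right integrable_gd)

lemma integral_mixd: "G \<in> Gkd k d R \<Longrightarrow> (\<integral>x. mixd k d G x \<partial>Rd d) = 1"
  unfolding mixd_def[abs_def] using integrable_gd[of d]
  by (subst Bochner_Integration.integral_sum) (auto simp: integral_gd GkdD(2))

lemma prob_space_PGamma: "G \<in> Gkd k d R \<Longrightarrow> prob_space (PGamma k d G)"
  by (rule prob_spaceI)
    (simp add: PGamma_eq emeasure_density nn_integral_eq_integral integrable_mixd integral_mixd mixd_nonneg
      nn_integral_set_ennreal[symmetric])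

lemma finite_measure_mixd: "G \<in> Gkd k d R \<Longrightarrow> finite_measure (density (Rd d) (mixd k d G))"
  using prob_space_PGamma[of G k d R] by (simp add: PGamma_eq prob_space.finite_measure)

lemma hellinger_PGamma_sq:
  assumes "G \<in> Gkd k d R" "G' \<in> Gkd k' d R'"
  shows "(hellinger (PGamma k d G) (PGamma k' d G'))\<^sup>2 = (\<integral>x. (sqrt (mixd k d G x) - sqrt (mixd k' d G' x))\<^sup>2 \<partial>Rd d)"
  by (subst hellinger_density[OF _ _ _ _ _ _ PGamma_eq PGamma_eq])
    (use assms in \<open>auto intro: mixd_nonneg finite_measure_mixd\<close>)

lemma hellinger_PGamma_nonneg:
  assumes "G \<in> Gkd k d R" "G' \<in> Gkd k' d R'"
  shows "0 \<le> hellinger (PGamma k d G) (PGamma k' d G')"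
  by (subst hellinger_density[OF _ _ _ _ _ _ PGamma_eq PGamma_eq])
    (use assms in \<open>auto intro: mixd_nonneg finite_measure_mixd\<close>)

lemma hellinger_PGamma_triangle:
  assumes "G \<in> Gkd k d R" "G' \<in> Gkd k d R" "G'' \<in> Gkd k d R"
  shows "hdist k d G G''
    \<le> hdist k d G G' + hdist k d G' G''"
  unfolding PGamma_eq
  by (rule hellinger_triangle_density) (use assms in \<open>auto intro: mixd_nonneg finite_measure_mixd\<close>)

lemma hellinger_PGamma_commute:
  assumes "G \<in> Gkd k d R" "G' \<in> Gkd k d R"
  shows "hdist k d G G' = hdist k d G' G"
  by (rule power2_eq_imp_eq)
    (use assms in \<open>simp_all add: hellinger_PGamma_sq hellinger_PGamma_nonneg power2_commute\<close>)

section \<open>The difference of two mixtures as a signed measure with 2k atoms\<close>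

definition diff_weights :: "nat \<Rightarrow> mixing \<Rightarrow> mixing \<Rightarrow> nat \<Rightarrow> real" where
  "diff_weights k G G' i = (if i < k then fst G i else - fst G' (i - k))"

definition diff_atoms :: "nat \<Rightarrow> mixing \<Rightarrow> mixing \<Rightarrow> nat \<Rightarrow> nat \<Rightarrow> real" where
  "diff_atoms k G G' i = (if i < k then snd G i else snd G' (i - k))"

lemma sum_lessThan_add:
  fixes f :: "nat \<Rightarrow> 'a::comm_monoid_add"
  shows "(\<Sum>i<a + b. f i) = (\<Sum>i<a. f i) + (\<Sum>i<b. f (a + i))"
  by (induction b) (auto simp: add.assoc)

lemma sum_diff_weights:
  "(\<Sum>i<2 * k. diff_weights k G G' i * f (diff_atoms k G G' i)) = (\<Sum>j<k. fst G j * f (snd G j)) - (\<Sum>j<k. fst G' j * f (snd G' j))"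
  by (simp add: mult_2 sum_lessThan_add diff_weights_def diff_atoms_def sum_negf)

text \<open>A squared distance, summed over the tensors of orders 0 to 2k - 1; radii and separations
  compared with it therefore appear squared.\<close>

definition moment_dist :: "nat \<Rightarrow> nat \<Rightarrow> mixing \<Rightarrow> mixing \<Rightarrow> real" where
  "moment_dist k d G G' = (\<Sum>l<2 * k. moment d (2 * k) (diff_weights k G G') (diff_atoms k G G') l)"

definition cmp_const :: "nat \<Rightarrow> real \<Rightarrow> real" where
  "cmp_const k R = exp (8 * R\<^sup>2 + 2) * (2 + 2 * R\<^sup>2) ^ (2 * k)"

lemma cmp_const_ge_1: "1 \<le> cmp_const k R"
proof -
  have "1 \<le> (2 + 2 * R\<^sup>2) ^ (2 * k)" by (intro one_le_power) simp
  moreover have "1 \<le> exp (8 * R\<^sup>2 + 2)" by simp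
  ultimately show ?thesis unfolding cmp_const_def by (smt (verit) mult_le_cancel_left1)
qed

lemma moment_dist_nonneg: "0 \<le> moment_dist k d G G'"
  unfolding moment_dist_def by (intro sum_nonneg moment_nonneg)

lemma moment_le_moment_dist: "l < 2 * k \<Longrightarrow> moment d (2 * k) (diff_weights k G G') (diff_atoms k G G') l \<le> moment_dist k d G G'"
  unfolding moment_dist_def by (rule member_le_sum) (auto intro: moment_nonneg)

lemma diff_atoms_bound:
  assumes "G \<in> Gkd k d R" "G' \<in> Gkd k d R" "0 \<le> R" "i < 2 * k"
  shows "ip d (diff_atoms k G G' i) (diff_atoms k G G' i) \<le> R\<^sup>2"
  using GkdD(3)[OF assms(1), of i] GkdD(3)[OF assms(2), of "i - k"] assms(3,4) by (auto simp: diff_atoms_def)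

text \<open>The bound is uniform over centres \<open>u\<close> in the ball. This freedom is used
  twice: with the atoms of a mixture as centres, and with their negatives.\<close>

lemma
  assumes G: "G \<in> Gkd k d R" "G' \<in> Gkd k d R" and "0 \<le> R" and u: "ip d u u \<le> R\<^sup>2"
  shows integrable_diff_sq: "integrable (Rd d) (\<lambda>x. (mixd k d G x - mixd k d G' x)\<^sup>2 / gd d u x)"
    and integral_diff_sq_le: "(\<integral>x. (mixd k d G x - mixd k d G' x)\<^sup>2 / gd d u x \<partial>Rd d) \<le> cmp_const k R * moment_dist k d G G'"
    and integral_diff_sq: "(\<integral>x. (mixd k d G x - mixd k d G' x)\<^sup>2 / gd d u x \<partial>Rd d) =
      qf (2 * k) (diff_weights k G G')
       (\<lambda>i j. exp (ip d (\<lambda>t. diff_atoms k G G' i t - u t) (\<lambda>t. diff_atoms k G G' j t - u t)))"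
proof -
  have eq: "mixd k d G x - mixd k d G' x = (\<Sum>i<2 * k. diff_weights k G G' i * gd d (diff_atoms k G G' i) x)" for x
    unfolding mixd_def by (rule sum_diff_weights[symmetric])
  show "integrable (Rd d) (\<lambda>x. (mixd k d G x - mixd k d G' x)\<^sup>2 / gd d u x)"
    unfolding eq by (rule integrable_signed_mixture_sq)
  show e: "(\<integral>x. (mixd k d G x - mixd k d G' x)\<^sup>2 / gd d u x \<partial>Rd d) =
      qf (2 * k) (diff_weights k G G')
       (\<lambda>i j. exp (ip d (\<lambda>t. diff_atoms k G G' i t - u t) (\<lambda>t. diff_atoms k G G' j t - u t)))"
    unfolding eq integral_signed_mixture_sq by (simp add: qf_def)
  show "(\<integral>x. (mixd k d G x - mixd k d G' x)\<^sup>2 / gd d u x \<partial>Rd d) \<le> cmp_const k R * moment_dist k d G G'"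
    unfolding e cmp_const_def
    by (rule exp_kernel_le_moments) (use assms in \<open>auto intro: diff_atoms_bound moment_le_moment_dist moment_dist_nonneg\<close>)
qed

lemma integral_sum_mult:
  fixes f :: "nat \<Rightarrow> 'a \<Rightarrow> real"
  assumes "\<And>j. j < k \<Longrightarrow> integrable M (f j)"
  shows "(\<integral>x. (\<Sum>j<k. c j * f j x) \<partial>M) = (\<Sum>j<k. c j * (\<integral>x. f j x \<partial>M))"
  using assms by (subst Bochner_Integration.integral_sum) auto

text \<open>Jensen's inequality for 1/x; it replaces a mixture in a denominator by its single
  Gaussian components.\<close>

lemma inverse_weighted_le:
  fixes w g :: "nat \<Rightarrow> real"
  assumes "\<And>j. j < k \<Longrightarrow> 0 \<le> w j" "(\<Sum>j<k. w j) = 1" "\<And>j. j < k \<Longrightarrow> 0 < g j"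
  shows "1 / (\<Sum>j<k. w j * g j) \<le> (\<Sum>j<k. w j / g j)"
proof -
  have "inverse (\<Sum>j<k. w j *\<^sub>R g j) \<le> (\<Sum>j<k. w j * inverse (g j))"
  proof (rule convex_on_sum)
    show "convex_on {0<..} (inverse :: real \<Rightarrow> real)" by (rule convex_on_inverse) (auto simp: convex_real_interval)
    show "{..<k} \<noteq> {}" using assms(2) by auto
  qed (use assms in auto)
  then show ?thesis by (simp add: divide_inverse)
qed

text \<open>After Jensen every denominator is a Gaussian centred at an atom of \<open>G'\<close>, to
  which the uniform bound applies. The weights then average to 1, so no lower bound on a weight
  enters.\<close>

lemma
  assumes G: "G \<in> Gkd k d R" "G' \<in> Gkd k d R" and "0 \<le> R"
  shows integrable_chi2: "integrable (Rd d) (\<lambda>x. (mixd k d G x - mixd k d G' x)\<^sup>2 / mixd k d G' x)"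
    and chi2_le_moment_dist: "(\<integral>x. (mixd k d G x - mixd k d G' x)\<^sup>2 / mixd k d G' x \<partial>Rd d) \<le> cmp_const k R * moment_dist k d G G'"
proof -
  let ?s = "\<lambda>x. (mixd k d G x - mixd k d G' x)\<^sup>2"
  let ?b = "\<lambda>x. \<Sum>j<k. fst G' j * (?s x / gd d (snd G' j) x)"
  have le: "?s x / mixd k d G' x \<le> ?b x" for x
  proof -
    have "?s x * (1 / mixd k d G' x) \<le> ?s x * (\<Sum>j<k. fst G' j / gd d (snd G' j) x)"
      unfolding mixd_def[of k d G']
      by (intro mult_left_mono inverse_weighted_le gd_pos GkdD[OF G(2)]) auto
    also have "?s x * (\<Sum>j<k. fst G' j / gd d (snd G' j) x) = ?b x"
      unfolding sum_distrib_left by (intro sum.cong refl) simp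
    finally show ?thesis by simp
  qed
  have ib: "integrable (Rd d) ?b"
    using G \<open>0 \<le> R\<close> by (intro Bochner_Integration.integrable_sum integrable_mult_right integrable_diff_sq[OF G \<open>0 \<le> R\<close>] GkdD(3)) auto
  show i: "integrable (Rd d) (\<lambda>x. ?s x / mixd k d G' x)"
  proof (rule Bochner_Integration.integrable_bound[OF ib])
    show "AE x in Rd d. norm (?s x / mixd k d G' x) \<le> norm (?b x)"
      using le mixd_nonneg[OF G(2)] by (intro AE_I2) (smt (verit) real_norm_def divide_nonneg_nonneg zero_le_power2)
  qed measurable
  have "(\<integral>x. ?s x / mixd k d G' x \<partial>Rd d) \<le> (\<integral>x. ?b x \<partial>Rd d)"
    using i ib le by (rule integral_mono)
  also have "\<dots> = (\<Sum>j<k. fst G' j * (\<integral>x. ?s x / gd d (snd G' j) x \<partial>Rd d))"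
    using G \<open>0 \<le> R\<close> by (intro integral_sum_mult integrable_diff_sq[OF G \<open>0 \<le> R\<close>] GkdD(3))
  also have "\<dots> \<le> (\<Sum>j<k. fst G' j * (cmp_const k R * moment_dist k d G G'))"
    using G \<open>0 \<le> R\<close> by (intro sum_mono mult_left_mono integral_diff_sq_le GkdD(3)) (auto intro: GkdD(1))
  also have "\<dots> = cmp_const k R * moment_dist k d G G'"
    by (simp add: sum_distrib_right[symmetric] GkdD(2)[OF G(2)])
  finally show "(\<integral>x. ?s x / mixd k d G' x \<partial>Rd d) \<le> cmp_const k R * moment_dist k d G G'" .
qed

lemma sqrt_diff_sq_le_chi2:
  fixes p q :: real
  assumes "0 \<le> p" "0 < q"
  shows "(sqrt p - sqrt q)\<^sup>2 \<le> (p - q)\<^sup>2 / q"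
proof -
  have "q \<le> (sqrt p + sqrt q)\<^sup>2" using assms by (simp add: power2_sum)
  then have "(sqrt p - sqrt q)\<^sup>2 * q \<le> (sqrt p - sqrt q)\<^sup>2 * (sqrt p + sqrt q)\<^sup>2"
    by (rule mult_left_mono) simp
  also have "\<dots> = (p - q)\<^sup>2"
    using assms unfolding power_mult_distrib[symmetric] by (simp add: algebra_simps)
  finally show ?thesis using assms by (simp add: field_simps)
qed

lemma hellinger_le_moment_dist:
  assumes G: "G \<in> Gkd k d R" "G' \<in> Gkd k d R" and "0 \<le> R"
  shows "(hdist k d G G')\<^sup>2 \<le> cmp_const k R * moment_dist k d G G'"
proof -
  have "(hdist k d G G')\<^sup>2
      \<le> (\<integral>x. (mixd k d G x - mixd k d G' x)\<^sup>2 / mixd k d G' x \<partial>Rd d)"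
    unfolding hellinger_PGamma_sq[OF G]
    by (intro integral_mono integrable_sqrt_diff_sq integrable_mixd mixd_nonneg[OF G(1)] mixd_nonneg[OF G(2)]
        sqrt_diff_sq_le_chi2 mixd_pos[OF G(2)] integrable_chi2[OF assms])
  also have "\<dots> \<le> cmp_const k R * moment_dist k d G G'" by (rule chi2_le_moment_dist[OF assms])
  finally show ?thesis .
qed

text \<open>Each component of \<open>F\<close> turns the squared test function into (p - q)^2 over a
  Gaussian centred at the negated atom, and the extra factor exp(- |atom|^2) is at most 1. It is
  applied with \<open>F\<close> equal to either of the two mixtures.\<close>

lemma integral_mixd_test_sq_le:
  assumes G: "G \<in> Gkd k d R" "G' \<in> Gkd k d R" and F: "F \<in> Gkd k d R" and "0 \<le> R"
  shows "integrable (Rd d) (\<lambda>x. mixd k d F x * ((mixd k d G x - mixd k d G' x) / gd d (\<lambda>_. 0) x)\<^sup>2)" (is ?I)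
    and "(\<integral>x. mixd k d F x * ((mixd k d G x - mixd k d G' x) / gd d (\<lambda>_. 0) x)\<^sup>2 \<partial>Rd d) \<le> cmp_const k R * moment_dist k d G G'" (is ?L)
proof -
  let ?s = "\<lambda>x. (mixd k d G x - mixd k d G' x)\<^sup>2"
  let ?m = "\<lambda>j i. - snd F j i"
  have eq: "mixd k d F x * ((mixd k d G x - mixd k d G' x) / gd d (\<lambda>_. 0) x)\<^sup>2
    = (\<Sum>j<k. fst F j * exp (- ip d (snd F j) (snd F j)) * (?s x / gd d (?m j) x))" for x
  proof -
    have "gd d (snd F j) x * ((mixd k d G x - mixd k d G' x) / gd d (\<lambda>_. 0) x)\<^sup>2
      = exp (- ip d (snd F j) (snd F j)) * (?s x / gd d (?m j) x)" for j
    proof -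
      have "gd d (snd F j) x * ((mixd k d G x - mixd k d G' x) / gd d (\<lambda>_. 0) x)\<^sup>2
        = (gd d (snd F j) x / (gd d (\<lambda>_. 0) x)\<^sup>2) * ?s x" by (simp add: power_divide)
      then show ?thesis unfolding gd_divide_sq by simp
    qed
    then show ?thesis unfolding mixd_def[of k d F] sum_distrib_right by (simp add: mult.assoc)
  qed
  have b: "ip d (?m j) (?m j) \<le> R\<^sup>2" if "j < k" for j
    using GkdD(3)[OF F that] \<open>0 \<le> R\<close> by (simp add: ip_def)
  show ?I unfolding eq
    using b by (intro Bochner_Integration.integrable_sum integrable_mult_right integrable_diff_sq[OF G \<open>0 \<le> R\<close>]) auto
  have "(\<integral>x. mixd k d F x * ((mixd k d G x - mixd k d G' x) / gd d (\<lambda>_. 0) x)\<^sup>2 \<partial>Rd d)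
    = (\<Sum>j<k. fst F j * exp (- ip d (snd F j) (snd F j)) * (\<integral>x. ?s x / gd d (?m j) x \<partial>Rd d))"
    unfolding eq using b by (intro integral_sum_mult integrable_diff_sq[OF G \<open>0 \<le> R\<close>])
  also have "\<dots> \<le> (\<Sum>j<k. fst F j * 1 * (cmp_const k R * moment_dist k d G G'))"
  proof (intro sum_mono mult_mono)
    fix j assume "j \<in> {..<k}"
    then show "(\<integral>x. ?s x / gd d (?m j) x \<partial>Rd d) \<le> cmp_const k R * moment_dist k d G G'"
      using b by (intro integral_diff_sq_le[OF G \<open>0 \<le> R\<close>]) auto
    show "0 \<le> (\<integral>x. ?s x / gd d (?m j) x \<partial>Rd d)"
      by (intro Bochner_Integration.integral_nonneg divide_nonneg_nonneg gd_nonneg) auto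
  qed (use GkdD(1)[OF F] ip_self_nonneg in auto)
  also have "\<dots> = cmp_const k R * moment_dist k d G G'"
    by (simp add: sum_distrib_right[symmetric] GkdD(2)[OF F])
  finally show ?L .
qed

text \<open>The witness is the test function \<open>(p - p') / \<phi>\<close> with \<open>\<phi>\<close> the standard normal density.\<close>
lemma moment_dist_le_hellinger:
  assumes G: "G \<in> Gkd k d R" "G' \<in> Gkd k d R" and "0 \<le> R" "0 < k"
  shows "moment_dist k d G G' \<le> 4 * cmp_const k R * (2 * k * fact (2 * k))\<^sup>2 * (hdist k d G G')\<^sup>2"
proof -
  let ?p = "mixd k d G" and ?q = "mixd k d G'" and ?z = "\<lambda>_::nat. 0::real"
  define f where "f x = (?p x - ?q x) / gd d ?z x" for x
  define S where "S = (\<integral>x. (?p x - ?q x)\<^sup>2 / gd d ?z x \<partial>Rd d)"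
  define H where "H = hdist k d G G'"
  define F where "F = 2 * k * (fact (2 * k) :: real)"
  define A where "A = cmp_const k R"
  have z: "ip d ?z ?z \<le> R\<^sup>2" by (simp add: ip_def)
  have A: "1 \<le> A" by (simp add: A_def cmp_const_ge_1)
  have F: "1 \<le> F"
  proof -
    have "1 * 1 \<le> real (2 * k) * fact (2 * k)" using \<open>0 < k\<close> by (intro mult_mono) auto
    then show ?thesis by (simp add: F_def)
  qed
  have [measurable]: "f \<in> borel_measurable (Rd d)" unfolding f_def[abs_def] by measurable
  have N: "moment_dist k d G G' \<le> F * S"
  proof -
    have "moment_dist k d G G' \<le> (\<Sum>l<2 * k. fact (2 * k) * S)"
      unfolding moment_dist_def S_def integral_diff_sq[OF G \<open>0 \<le> R\<close> z]
      by (intro sum_mono order_trans[OF moment_le_exp_kernel]) auto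
    then show ?thesis by (simp add: F_def)
  qed
  note I = integral_mixd_test_sq_le[OF G G(1) \<open>0 \<le> R\<close>, folded f_def A_def]
    integral_mixd_test_sq_le[OF G G(2) \<open>0 \<le> R\<close>, folded f_def A_def]
  note iH = integrable_sqrt_diff_sq[OF integrable_mixd[of d k G] integrable_mixd[of d k G'] mixd_nonneg[OF G(1)] mixd_nonneg[OF G(2)]]
  \<comment> \<open>The parameter of the inequality a b \<le> a^2 / (2 l) + l b^2 / 2, chosen so
    that the second term integrates to at most S / 2 and is absorbed into the left side.\<close>
  define l where "l = 1 / (4 * A * F)"
  have l: "0 < l" using A F by (simp add: l_def)
  have pt: "(?p x - ?q x)\<^sup>2 / gd d ?z x \<le> (sqrt (?p x) - sqrt (?q x))\<^sup>2 / (2 * l) + l * (?p x * (f x)\<^sup>2 + ?q x * (f x)\<^sup>2)" for x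
  proof -
    define a b where "a = sqrt (?p x) - sqrt (?q x)" and "b = (sqrt (?p x) + sqrt (?q x)) * f x"
    have p: "0 \<le> ?p x" "0 \<le> ?q x" using mixd_nonneg G by auto
    have pq: "?p x - ?q x = (sqrt (?p x) - sqrt (?q x)) * (sqrt (?p x) + sqrt (?q x))"
      using p by (simp add: algebra_simps)
    have "(?p x - ?q x)\<^sup>2 / gd d ?z x = (?p x - ?q x) * f x"
      by (simp add: f_def power2_eq_square)
    also have "\<dots> = a * b" unfolding pq a_def b_def by simp
    also have "a * b \<le> a\<^sup>2 / (2 * l) + l * b\<^sup>2 / 2"
    proof -
      have "0 \<le> (a - l * b)\<^sup>2 / (2 * l)" using l by simp
      also have "\<dots> = a\<^sup>2 / (2 * l) + l * b\<^sup>2 / 2 - a * b"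
        using l by (simp add: power2_eq_square field_simps)
      finally show ?thesis by simp
    qed
    also have "\<dots> \<le> a\<^sup>2 / (2 * l) + l * (2 * (?p x + ?q x) * (f x)\<^sup>2) / 2"
    proof -
      have "(sqrt (?p x) + sqrt (?q x))\<^sup>2 \<le> 2 * (?p x + ?q x)"
        using p sum_squares_bound[of "sqrt (?p x)" "sqrt (?q x)"] by (simp add: power2_sum)
      then have "b\<^sup>2 \<le> 2 * (?p x + ?q x) * (f x)\<^sup>2"
        unfolding b_def power_mult_distrib by (rule mult_right_mono) simp
      then show ?thesis using l by simp
    qed
    also have "\<dots> = a\<^sup>2 / (2 * l) + l * (?p x * (f x)\<^sup>2 + ?q x * (f x)\<^sup>2)"
      by (simp add: algebra_simps)
    finally show ?thesis by (simp add: a_def)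
  qed
  have "S \<le> (\<integral>x. (sqrt (?p x) - sqrt (?q x))\<^sup>2 / (2 * l) + l * (?p x * (f x)\<^sup>2 + ?q x * (f x)\<^sup>2) \<partial>Rd d)"
    unfolding S_def using I(1,3) iH pt
    by (intro integral_mono integrable_diff_sq[OF G \<open>0 \<le> R\<close> z]) auto
  also have "\<dots> = H\<^sup>2 / (2 * l) + l * ((\<integral>x. ?p x * (f x)\<^sup>2 \<partial>Rd d) + (\<integral>x. ?q x * (f x)\<^sup>2 \<partial>Rd d))"
    using I(1,3) iH by (simp add: H_def hellinger_PGamma_sq[OF G])
  also have "\<dots> \<le> H\<^sup>2 / (2 * l) + l * (A * moment_dist k d G G' + A * moment_dist k d G G')"
    using I(2,4) l by (intro add_mono mult_left_mono) auto
  also have "\<dots> \<le> H\<^sup>2 / (2 * l) + l * (A * (F * S) + A * (F * S))"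
    using N l A by (intro add_mono mult_left_mono) auto
  also have "\<dots> = 2 * A * F * H\<^sup>2 + S / 2"
    using A F by (simp add: l_def field_simps)
  finally have "S \<le> 4 * A * F * H\<^sup>2" by simp
  then have "F * S \<le> F * (4 * A * F * H\<^sup>2)" using F by (intro mult_left_mono) auto
  then show ?thesis using N by (simp add: A_def F_def H_def power2_eq_square mult_ac)
qed

section \<open>Lattice points, orthonormal frames and tensors\<close>

text \<open>The term with exp(- b / S) makes the induction on \<open>b\<close> close: by e^x \<ge> 1
  + x the two new summands are dominated by the increment of the right side.\<close>

lemma sum_exp_abs_le:
  fixes S :: real assumes "0 < S"
  shows "(\<Sum>t\<in>{- int b..int b}. exp (- \<bar>real_of_int t\<bar> / S)) \<le> 1 + 2 * S * (1 - exp (- real b / S))"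
proof (induction b)
  case (Suc b)
  let ?f = "\<lambda>t. exp (- \<bar>real_of_int t\<bar> / S)"
  have "{- int (Suc b)..int (Suc b)} = insert (- int (Suc b)) (insert (int (Suc b)) {- int b..int b})"
    by auto
  then have "(\<Sum>t\<in>{- int (Suc b)..int (Suc b)}. f t) = f (- int (Suc b)) + (f (int (Suc b)) + (\<Sum>t\<in>{- int b..int b}. f t))"
    for f :: "int \<Rightarrow> real"
    by simp
  from this[of ?f] have "(\<Sum>t\<in>{- int (Suc b)..int (Suc b)}. ?f t) = ?f (- int (Suc b)) + (?f (int (Suc b)) + (\<Sum>t\<in>{- int b..int b}. ?f t))" .
  moreover have "?f (- int (Suc b)) = exp (- real (Suc b) / S)" "?f (int (Suc b)) = exp (- real (Suc b) / S)"
    by auto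
  ultimately have "(\<Sum>t\<in>{- int (Suc b)..int (Suc b)}. ?f t) = 2 * exp (- real (Suc b) / S) + (\<Sum>t\<in>{- int b..int b}. ?f t)"
    by simp
  moreover have "exp (- real (Suc b) / S) \<le> S * (exp (- real b / S) - exp (- real (Suc b) / S))"
  proof -
    define r where "r = exp (- real (Suc b) / S)"
    have e: "exp (- real b / S) = exp (1 / S) * r"
      unfolding r_def exp_add[symmetric] using assms by (simp add: field_simps)
    have "r * 1 \<le> r * (S * (exp (1 / S) - 1))"
    proof (rule mult_left_mono)
      have "1 + 1 / S \<le> exp (1 / S)" by (rule exp_ge_add_one_self)
      then show "1 \<le> S * (exp (1 / S) - 1)" using assms by (simp add: field_simps)
    qed (simp add: r_def)
    then show ?thesis unfolding e unfolding r_def[symmetric] by (simp add: algebra_simps)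
  qed
  ultimately show ?case using Suc by (simp add: algebra_simps)
qed simp

text \<open>Exponential weights \<open>exp (card I - \<Sum>\<bar>z i\<bar> / S)\<close> dominate the indicator of the set and sum over a product.\<close>
lemma
  fixes S :: real and I :: "'a set"
  assumes I: "finite I" and "0 < S"
  defines "A \<equiv> {z \<in> PiE I (\<lambda>_. UNIV :: int set). (\<Sum>i\<in>I. \<bar>real_of_int (z i)\<bar>) \<le> card I * S}"
  shows finite_lattice_points: "finite A"
    and card_lattice_points_le: "card A \<le> (exp 1 * (1 + 2 * S)) ^ card I"
proof -
  \<comment> \<open>A box containing the set, which keeps the product sum finite; the final bound
    does not depend on its size.\<close>
  define b where "b = nat \<lceil>card I * S\<rceil>"
  let ?P = "PiE I (\<lambda>_. {- int b..int b})"
  have sub: "A \<subseteq> ?P"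
  proof
    fix z assume z: "z \<in> A"
    have "z i \<in> {- int b..int b}" if "i \<in> I" for i
    proof -
      have "\<bar>real_of_int (z i)\<bar> \<le> (\<Sum>i\<in>I. \<bar>real_of_int (z i)\<bar>)"
        using I that by (intro member_le_sum) auto
      also have "\<dots> \<le> card I * S" using z by (simp add: A_def)
      also have "\<dots> \<le> real b" unfolding b_def by linarith
      finally have "real_of_int \<bar>z i\<bar> \<le> real_of_int (int b)" by simp
      then have "\<bar>z i\<bar> \<le> int b" by (simp only: of_int_le_iff)
      then show ?thesis by (auto simp: abs_le_iff)
    qed
    then show "z \<in> ?P" using z by (auto simp: A_def PiE_iff)
  qed
  have fP: "finite ?P" using I by (intro finite_PiE) auto
  then show "finite A" using sub by (rule finite_subset[rotated])
  let ?w = "\<lambda>z. exp (real (card I)) * (\<Prod>i\<in>I. exp (- \<bar>real_of_int (z i)\<bar> / S))"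
  have "real (card A) = (\<Sum>z\<in>A. 1)" by simp
  also have "\<dots> \<le> (\<Sum>z\<in>A. ?w z)"
  proof (rule sum_mono)
    fix z assume "z \<in> A"
    then have "(\<Sum>i\<in>I. \<bar>real_of_int (z i)\<bar>) / S \<le> card I"
      using \<open>0 < S\<close> by (simp add: A_def divide_simps)
    then have "1 \<le> exp (card I - (\<Sum>i\<in>I. \<bar>real_of_int (z i)\<bar>) / S)" by simp
    also have "\<dots> = ?w z"
    proof -
      have "(\<Prod>i\<in>I. exp (- \<bar>real_of_int (z i)\<bar> / S)) = exp (- ((\<Sum>i\<in>I. \<bar>real_of_int (z i)\<bar>) / S))"
        unfolding exp_sum[OF I, symmetric] by (simp add: sum_divide_distrib sum_negf)
      then show ?thesis by (simp only: exp_add[symmetric]) simp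
    qed
    finally show "1 \<le> ?w z" .
  qed
  also have "\<dots> \<le> (\<Sum>z\<in>?P. ?w z)"
    using sub fP by (intro sum_mono2) (auto intro!: mult_nonneg_nonneg prod_nonneg)
  also have "\<dots> = exp (real (card I)) * (\<Prod>i\<in>I. \<Sum>t\<in>{- int b..int b}. exp (- \<bar>real_of_int t\<bar> / S))"
    unfolding sum_distrib_left[symmetric] using I by (subst prod_sum_PiE) auto
  also have "\<dots> \<le> exp (real (card I)) * (\<Prod>i\<in>I. 1 + 2 * S)"
  proof (intro mult_left_mono prod_mono conjI)
    have "0 \<le> 2 * S * exp (- real b / S)" using \<open>0 < S\<close> by simp
    then show "(\<Sum>t\<in>{- int b..int b}. exp (- \<bar>real_of_int t\<bar> / S)) \<le> 1 + 2 * S"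
      using sum_exp_abs_le[OF \<open>0 < S\<close>, of b] by (simp add: algebra_simps)
  qed (auto intro: sum_nonneg)
  also have "\<dots> = (exp 1 * (1 + 2 * S)) ^ card I"
    by (simp add: power_mult_distrib exp_of_nat_mult[symmetric])
  finally show "card A \<le> (exp 1 * (1 + 2 * S)) ^ card I" .
qed

lemma sum_abs_le_sqrt_card:
  fixes f :: "'a \<Rightarrow> real"
  assumes "finite I" "(\<Sum>i\<in>I. (f i)\<^sup>2) \<le> s\<^sup>2" "0 \<le> s"
  shows "(\<Sum>i\<in>I. \<bar>f i\<bar>) \<le> sqrt (card I) * s"
proof (rule power2_le_imp_le)
  have "(\<Sum>i\<in>I. 1 * \<bar>f i\<bar>)\<^sup>2 \<le> (\<Sum>i\<in>I. 1\<^sup>2) * (\<Sum>i\<in>I. \<bar>f i\<bar>\<^sup>2)"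
    by (rule Cauchy_Schwarz_ineq_sum)
  also have "\<dots> \<le> card I * s\<^sup>2" using assms(2) by (simp add: mult_left_mono)
  finally show "(\<Sum>i\<in>I. \<bar>f i\<bar>)\<^sup>2 \<le> (sqrt (card I) * s)\<^sup>2" by (simp add: power_mult_distrib)
qed (use assms in auto)

text \<open>Rounding down with mesh h / sqrt(card I). The sum of absolute values of a code is then
  at most a multiple of \<open>card I\<close> with factor \<open>s / h + 1\<close>, precisely the
  form counted by the lattice bound; the base of that count is thus independent of the number of
  coordinates.\<close>

lemma rounding:
  fixes s h :: real and I :: "'a set"
  assumes I: "finite I" "I \<noteq> {}" and "0 \<le> s" "0 < h"
  obtains r :: "('a \<Rightarrow> real) \<Rightarrow> ('a \<Rightarrow> int)"
  where "\<And>f. (\<Sum>i\<in>I. (f i)\<^sup>2) \<le> s\<^sup>2 \<Longrightarrow>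
      r f \<in> {z \<in> PiE I (\<lambda>_. UNIV). (\<Sum>i\<in>I. \<bar>real_of_int (z i)\<bar>) \<le> card I * (s / h + 1)}"
    and "\<And>f g. r f = r g \<Longrightarrow> (\<Sum>i\<in>I. (f i - g i)\<^sup>2) \<le> h\<^sup>2"
proof
  define M where "M = real (card I)"
  have M: "0 < M" using I by (simp add: M_def card_gt_0_iff)
  define \<delta> where "\<delta> = h / sqrt M"
  have \<delta>: "0 < \<delta>" using \<open>0 < h\<close> M by (simp add: \<delta>_def)
  let ?r = "\<lambda>f. restrict (\<lambda>i. \<lfloor>f i / \<delta>\<rfloor>) I"
  fix f :: "'a \<Rightarrow> real"
  {
    assume f: "(\<Sum>i\<in>I. (f i)\<^sup>2) \<le> s\<^sup>2"
    have "(\<Sum>i\<in>I. \<bar>real_of_int (?r f i)\<bar>) \<le> (\<Sum>i\<in>I. \<bar>f i\<bar> / \<delta> + 1)"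
    proof (rule sum_mono)
      fix i assume "i \<in> I"
      have "\<bar>real_of_int \<lfloor>f i / \<delta>\<rfloor>\<bar> \<le> \<bar>f i / \<delta>\<bar> + 1" by linarith
      then show "\<bar>real_of_int (?r f i)\<bar> \<le> \<bar>f i\<bar> / \<delta> + 1" using \<open>i \<in> I\<close> \<delta> by simp
    qed
    also have "\<dots> = (\<Sum>i\<in>I. \<bar>f i\<bar>) / \<delta> + M" by (simp add: sum.distrib sum_divide_distrib M_def)
    also have "\<dots> \<le> sqrt M * s / \<delta> + M"
      using sum_abs_le_sqrt_card[OF I(1) f \<open>0 \<le> s\<close>] \<delta> by (simp add: M_def divide_right_mono)
    also have "\<dots> = M * (s / h + 1)"
    proof -
      have "sqrt M * s / \<delta> = (sqrt M * sqrt M) * s / h" using \<open>0 < h\<close> M by (simp add: \<delta>_def field_simps)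
      then show ?thesis using M by (simp add: algebra_simps)
    qed
    finally show "?r f \<in> {z \<in> PiE I (\<lambda>_. UNIV). (\<Sum>i\<in>I. \<bar>real_of_int (z i)\<bar>) \<le> card I * (s / h + 1)}"
      by (simp add: M_def)
  next
    fix g assume eq: "?r f = ?r g"
    have "(\<Sum>i\<in>I. (f i - g i)\<^sup>2) \<le> (\<Sum>i\<in>I. \<delta>\<^sup>2)"
    proof (rule sum_mono)
      fix i assume "i \<in> I"
      then have "\<lfloor>f i / \<delta>\<rfloor> = \<lfloor>g i / \<delta>\<rfloor>" using fun_cong[OF eq, of i] by simp
      then have "\<bar>f i / \<delta> - g i / \<delta>\<bar> \<le> 1" by linarith
      then have "\<bar>f i - g i\<bar> \<le> \<delta>" using \<delta> by (simp add: diff_divide_distrib[symmetric] divide_simps)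
      then show "(f i - g i)\<^sup>2 \<le> \<delta>\<^sup>2" by (metis abs_ge_zero power2_abs power_mono)
    qed
    also have "\<dots> = h\<^sup>2" using M by (simp add: \<delta>_def power_divide M_def)
    finally show "(\<Sum>i\<in>I. (f i - g i)\<^sup>2) \<le> h\<^sup>2" .
  }
qed

section \<open>Tensor entries, indexed by words over the coordinates\<close>

definition words :: "nat \<Rightarrow> nat \<Rightarrow> nat list set" where
  "words d l = {xs. set xs \<subseteq> {..<d} \<and> length xs = l}"

lemma finite_words [simp]: "finite (words d l)"
  unfolding words_def by (rule finite_lists_length_eq) simp

lemma card_words: "card (words d l) = d ^ l"
  unfolding words_def by (simp add: card_lists_length_eq)

lemma words_0: "words d 0 = {[]}"
  by (auto simp: words_def)

lemma sum_words_Suc: "(\<Sum>xs\<in>words d (Suc l). f xs) = (\<Sum>t<d. \<Sum>xs\<in>words d l. f (t # xs))"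
proof -
  have w: "words d (Suc l) = (\<lambda>(t, xs). t # xs) ` ({..<d} \<times> words d l)"
    by (force simp: words_def length_Suc_conv)
  show ?thesis unfolding w
    by (subst sum.reindex) (auto simp: inj_on_def sum.cartesian_product case_prod_beta)
qed

lemma sum_words_ip_power:
  "(\<Sum>xs\<in>words d l. prod_list (map u xs) * prod_list (map v xs)) = ip d u v ^ l"
proof (induction l)
  case (Suc l)
  have "(\<Sum>xs\<in>words d (Suc l). prod_list (map u xs) * prod_list (map v xs))
    = (\<Sum>t<d. u t * v t * (\<Sum>xs\<in>words d l. prod_list (map u xs) * prod_list (map v xs)))"
    unfolding sum_words_Suc sum_distrib_left by (simp add: mult_ac)
  then show ?case by (simp add: Suc ip_def sum_distrib_right)
qed (simp add: words_0)

lemma moment_eq_sum_words: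
  "moment d n c v l = (\<Sum>xs\<in>words d l. (\<Sum>i<n. c i * prod_list (map (v i) xs))\<^sup>2)"
proof -
  have "(\<Sum>xs\<in>words d l. (\<Sum>i<n. c i * prod_list (map (v i) xs))\<^sup>2)
    = (\<Sum>xs\<in>words d l. \<Sum>i<n. \<Sum>j<n. c i * c j * (prod_list (map (v i) xs) * prod_list (map (v j) xs)))"
    by (simp add: power2_eq_square sum_product mult_ac)
  also have "\<dots> = (\<Sum>i<n. \<Sum>j<n. \<Sum>xs\<in>words d l. c i * c j * (prod_list (map (v i) xs) * prod_list (map (v j) xs)))"
    by (subst sum.swap, subst (2) sum.swap) simp
  finally show ?thesis
    by (simp add: moment_def qf_def sum_distrib_left[symmetric] sum_words_ip_power)
qed

text \<open>The entry at \<open>xs\<close> of the moment tensor of \<open>G\<close> of order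
  \<open>length xs\<close>. As it depends on one mixture only, differences of two mixtures can be
  compared through a common third one.\<close>

definition feature :: "nat \<Rightarrow> mixing \<Rightarrow> nat list \<Rightarrow> real" where
  "feature k G xs = (\<Sum>j<k. fst G j * prod_list (map (snd G j) xs))"

lemma sum_diff_feature:
  "(\<Sum>i<2 * k. diff_weights k G G' i * prod_list (map (diff_atoms k G G' i) xs)) = feature k G xs - feature k G' xs"
  unfolding feature_def by (rule sum_diff_weights)

lemma moment_dist_eq_features:
  "moment_dist k d G G' = (\<Sum>l<2 * k. \<Sum>xs\<in>words d l. (feature k G xs - feature k G' xs)\<^sup>2)"
  unfolding moment_dist_def moment_eq_sum_words sum_diff_feature ..

lemma moment_dist_commute: "moment_dist k d G G' = moment_dist k d G' G"
  by (simp add: moment_dist_eq_features power2_commute)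

lemma moment_dist_self: "moment_dist k d G G = 0"
  by (simp add: moment_dist_eq_features)

text \<open>Gram--Schmidt; directions with zero residual are represented by the zero vector.\<close>
lemma orthonormal_frame:
  obtains e :: "nat \<Rightarrow> nat \<Rightarrow> real"
  where "\<And>a. a < n \<Longrightarrow> ip d (e a) (e a) \<le> 1"
    and "\<And>i t. i < n \<Longrightarrow> t < d \<Longrightarrow> v i t = (\<Sum>a<n. ip d (v i) (e a) * e a t)"
proof -
  \<comment> \<open>Orthogonality is carried through the induction so that the residual of each new
    vector is orthogonal to all earlier directions.\<close>
  have "\<exists>e. (\<forall>a<n. ip d (e a) (e a) = 1 \<or> e a = (\<lambda>_. 0)) \<and> (\<forall>a<n. \<forall>b<n. a \<noteq> b \<longrightarrow> ip d (e a) (e b) = 0)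
     \<and> (\<forall>i<n. \<forall>t<d. v i t = (\<Sum>a<n. ip d (v i) (e a) * e a t))"
  proof (induction n)
    case (Suc n)
    then obtain e where e1': "\<forall>a<n. ip d (e a) (e a) = 1 \<or> e a = (\<lambda>_. 0)"
      and eo': "\<forall>a<n. \<forall>b<n. a \<noteq> b \<longrightarrow> ip d (e a) (e b) = 0"
      and sp': "\<forall>i<n. \<forall>t<d. v i t = (\<Sum>a<n. ip d (v i) (e a) * e a t)"
      by (elim exE conjE) (rule that; assumption)
    note e1 = e1'[rule_format] and eo = eo'[rule_format] and sp = sp'[rule_format]
    define p where "p t = (\<Sum>a<n. ip d (v n) (e a) * e a t)" for t
    define r where "r t = v n t - p t" for t
    have re: "ip d r (e b) = 0" if b: "b < n" for b
    proof -
      have "ip d p (e b) = (\<Sum>a<n. ip d (v n) (e a) * ip d (e a) (e b))"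
        unfolding p_def by (simp add: ip_sum_left ip_scale_left)
      also have "\<dots> = (\<Sum>a<n. if a = b then ip d (v n) (e b) * ip d (e b) (e b) else 0)"
        using eo b by (intro sum.cong) auto
      also have "\<dots> = ip d (v n) (e b) * ip d (e b) (e b)" using b by simp
      also have "\<dots> = ip d (v n) (e b)" using e1[OF b] by (auto simp: ip_def)
      finally show ?thesis unfolding r_def ip_diff_left by simp
    qed
    define \<rho> where "\<rho> = sqrt (ip d r r)"
    define w where "w = (if \<rho> = 0 then (\<lambda>_. 0) else (\<lambda>t. (1 / \<rho>) * r t))"
    have rr: "ip d r r = \<rho>\<^sup>2" by (simp add: \<rho>_def ip_self_nonneg)
    have w1: "ip d w w = 1 \<or> w = (\<lambda>_. 0)"
    proof (cases "\<rho> = 0")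
      case False
      then have "ip d w w = (1 / \<rho>) * ((1 / \<rho>) * ip d r r)"
        unfolding w_def by (simp only: if_False ip_scale_left ip_scale_right)
      then show ?thesis using False rr by (simp add: power2_eq_square)
    qed (simp add: w_def)
    have we: "ip d w (e b) = 0" if "b < n" for b
      using re[OF that] ip_scale_left[of d "1 / \<rho>" r "e b"] by (cases "\<rho> = 0") (simp_all add: w_def ip_def[of d "\<lambda>_. 0"])
    have ew: "ip d (e b) w = 0" if "b < n" for b
      using we[OF that] by (simp only: ip_commute[of d "e b" w])
    have rw: "r t = ip d r w * w t" if "t < d" for t
    proof (cases "\<rho> = 0")
      case True
      then have "ip d r r = 0" using rr by simp
      then have "r t = 0" using that by (simp only: ip_self_eq_0)
      then show ?thesis using True by (simp add: w_def)
    next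
      case False
      then have "ip d r w = (1 / \<rho>) * ip d r r"
        unfolding w_def by (simp only: if_False ip_scale_right)
      then show ?thesis using False by (simp add: w_def rr power2_eq_square)
    qed
    define e' where "e' = e(n := w)"
    have e'[simp]: "e' n = w" "\<And>a. a < n \<Longrightarrow> e' a = e a" by (auto simp: e'_def)
    have "v i t = (\<Sum>a<Suc n. ip d (v i) (e' a) * e' a t)" if "i < Suc n" "t < d" for i t
    proof (cases "i = n")
      case True
      have pw: "ip d p w = 0"
        unfolding p_def using ew by (simp add: ip_sum_left ip_scale_left)
      have "ip d r w = ip d (v n) w - ip d p w" unfolding r_def ip_diff_left ..
      then have "ip d (v n) w = ip d r w" using pw by simp
      then have "(\<Sum>a<Suc n. ip d (v n) (e' a) * e' a t) = p t + r t"
        using rw[OF that(2)] by (simp add: p_def)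
      then show ?thesis using True by (simp add: r_def)
    next
      case False
      then have i: "i < n" using that by simp
      have "ip d (v i) w = ip d (\<lambda>t. \<Sum>a<n. ip d (v i) (e a) * e a t) w"
        unfolding ip_def[of d _ w] using sp[OF i] by (intro sum.cong) auto
      also have "\<dots> = 0" using ew by (simp add: ip_sum_left ip_scale_left)
      finally show ?thesis using sp[OF i that(2)] by simp
    qed
    moreover have "\<forall>a<Suc n. ip d (e' a) (e' a) = 1 \<or> e' a = (\<lambda>_. 0)"
      using e1 w1 by (auto simp: less_Suc_eq)
    moreover have "\<forall>a<Suc n. \<forall>b<Suc n. a \<noteq> b \<longrightarrow> ip d (e' a) (e' b) = 0"
      using eo we ew by (auto simp: less_Suc_eq)
    ultimately show ?case by blast
  qed simp
  then show thesis
  proof (elim exE conjE)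
    fix e :: "nat \<Rightarrow> nat \<Rightarrow> real"
    assume e: "\<forall>a<n. ip d (e a) (e a) = 1 \<or> e a = (\<lambda>_. 0)"
      and sp: "\<forall>i<n. \<forall>t<d. v i t = (\<Sum>a<n. ip d (v i) (e a) * e a t)"
    show thesis
    proof (rule that[of e])
      show "ip d (e a) (e a) \<le> 1" if "a < n" for a
        using e[rule_format, OF that] by (auto simp: ip_def)
      show "v i t = (\<Sum>a<n. ip d (v i) (e a) * e a t)" if "i < n" "t < d" for i t
        using sp that by (simp only:)
    qed
  qed
qed

text \<open>The entry at \<open>xs\<close> of the product tensor of the vectors e_a, for a in
  \<open>as\<close>: the coefficients of the change from frame to standard coordinates. The sums
  pair lists of equal length, so the value 1 is that of the empty product.\<close>

fun tprod :: "(nat \<Rightarrow> nat \<Rightarrow> real) \<Rightarrow> nat list \<Rightarrow> nat list \<Rightarrow> real" where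
  "tprod e (a # as) (x # xs) = e a x * tprod e as xs"
| "tprod e _ _ = 1"

lemma prod_list_expand:
  assumes "\<And>t. t < d \<Longrightarrow> v t = (\<Sum>a<n. \<alpha> a * e a t)" "set xs \<subseteq> {..<d}"
  shows "prod_list (map v xs) = (\<Sum>as\<in>words n (length xs). prod_list (map \<alpha> as) * tprod e as xs)"
  using assms(2)
proof (induction xs)
  case (Cons x xs)
  then show ?case
    by (simp add: sum_words_Suc assms(1) sum_product mult_ac)
qed (simp add: words_0)

lemma sum_tprod_sq:
  "(\<Sum>xs\<in>words d l. \<Sum>as\<in>words n l. (tprod e as xs)\<^sup>2) = (\<Sum>t<d. \<Sum>a<n. (e a t)\<^sup>2) ^ l"
proof (induction l)
  case (Suc l)
  have "(\<Sum>xs\<in>words d (Suc l). \<Sum>as\<in>words n (Suc l). (tprod e as xs)\<^sup>2)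
    = (\<Sum>t<d. \<Sum>xs\<in>words d l. \<Sum>a<n. \<Sum>as\<in>words n l. (e a t)\<^sup>2 * (tprod e as xs)\<^sup>2)"
    by (simp add: sum_words_Suc power_mult_distrib)
  also have "\<dots> = (\<Sum>t<d. \<Sum>a<n. (e a t)\<^sup>2 * (\<Sum>xs\<in>words d l. \<Sum>as\<in>words n l. (tprod e as xs)\<^sup>2))"
    unfolding sum_distrib_left by (subst (2) sum.swap) simp
  finally show ?case by (simp add: Suc sum_distrib_right)
qed (simp add: words_0)

text \<open>Induction on the order with e T - e' T' = (e - e') T + e' (T - T'). The two squared
  parts contribute 2 h (2F + 2)^l and 2F h (2F + 2)^l, whence the base 2F + 2.\<close>

lemma sum_tprod_diff_sq_le:
  fixes F :: real
  assumes e: "(\<Sum>t<d. \<Sum>a<n. (e a t)\<^sup>2) \<le> F" and e': "(\<Sum>t<d. \<Sum>a<n. (e' a t)\<^sup>2) \<le> F"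
    and diff: "(\<Sum>t<d. \<Sum>a<n. (e a t - e' a t)\<^sup>2) \<le> h" and "0 \<le> h"
  shows "(\<Sum>xs\<in>words d l. \<Sum>as\<in>words n l. (tprod e as xs - tprod e' as xs)\<^sup>2) \<le> h * (2 * F + 2) ^ l"
proof (induction l)
  case (Suc l)
  have F: "0 \<le> F" using e by (rule order_trans[rotated]) (intro sum_nonneg, simp)
  let ?D = "\<lambda>xs as. (tprod e as xs - tprod e' as xs)\<^sup>2"
  have "(\<Sum>xs\<in>words d (Suc l). \<Sum>as\<in>words n (Suc l). ?D xs as)
    \<le> (\<Sum>t<d. \<Sum>xs\<in>words d l. \<Sum>a<n. \<Sum>as\<in>words n l. 2 * (e a t - e' a t)\<^sup>2 * (tprod e as xs)\<^sup>2 + 2 * (e' a t)\<^sup>2 * ?D xs as)"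
    unfolding sum_words_Suc
  proof (intro sum_mono)
    fix t a xs as
    have "(x + y)\<^sup>2 \<le> 2 * x\<^sup>2 + 2 * y\<^sup>2" for x y :: real
      using sum_squares_bound[of x y] by (simp add: power2_sum)
    from this[of "(e a t - e' a t) * tprod e as xs" "e' a t * (tprod e as xs - tprod e' as xs)"]
    have "((e a t - e' a t) * tprod e as xs + e' a t * (tprod e as xs - tprod e' as xs))\<^sup>2
      \<le> 2 * (e a t - e' a t)\<^sup>2 * (tprod e as xs)\<^sup>2 + 2 * (e' a t)\<^sup>2 * ?D xs as"
      by (simp only: power_mult_distrib mult.assoc)
    moreover have "(e a t - e' a t) * tprod e as xs + e' a t * (tprod e as xs - tprod e' as xs)
      = tprod e (a # as) (t # xs) - tprod e' (a # as) (t # xs)" by (simp add: algebra_simps)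
    ultimately show "?D (t # xs) (a # as) \<le> 2 * (e a t - e' a t)\<^sup>2 * (tprod e as xs)\<^sup>2 + 2 * (e' a t)\<^sup>2 * ?D xs as"
      by simp
  qed
  also have "\<dots> = (\<Sum>t<d. \<Sum>a<n. 2 * (e a t - e' a t)\<^sup>2 * (\<Sum>xs\<in>words d l. \<Sum>as\<in>words n l. (tprod e as xs)\<^sup>2)
      + 2 * (e' a t)\<^sup>2 * (\<Sum>xs\<in>words d l. \<Sum>as\<in>words n l. ?D xs as))"
    unfolding sum_distrib_left sum.distrib[symmetric] by (subst (2) sum.swap) simp
  also have "\<dots> = 2 * (\<Sum>t<d. \<Sum>a<n. (e a t - e' a t)\<^sup>2) * (\<Sum>t<d. \<Sum>a<n. (e a t)\<^sup>2) ^ l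
      + 2 * (\<Sum>t<d. \<Sum>a<n. (e' a t)\<^sup>2) * (\<Sum>xs\<in>words d l. \<Sum>as\<in>words n l. ?D xs as)"
    (is "_ = 2 * _ * _ + 2 * _ * ?Y")
  proof -
    have "(\<Sum>t<d. \<Sum>a<n. 2 * f t a * X + 2 * g t a * Y) = 2 * (\<Sum>t<d. \<Sum>a<n. f t a) * X + 2 * (\<Sum>t<d. \<Sum>a<n. g t a) * Y"
      for f g :: "nat \<Rightarrow> nat \<Rightarrow> real" and X Y :: real
      by (simp add: sum.distrib sum_distrib_left sum_distrib_right)
    then show ?thesis unfolding sum_tprod_sq .
  qed
  also have "\<dots> \<le> 2 * h * (2 * F + 2) ^ l + 2 * F * (h * (2 * F + 2) ^ l)"
  proof (intro add_mono mult_mono)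
    have "(\<Sum>t<d. \<Sum>a<n. (e a t)\<^sup>2) ^ l \<le> F ^ l" using e by (intro power_mono sum_nonneg) auto
    also have "\<dots> \<le> (2 * F + 2) ^ l" using F by (intro power_mono) auto
    finally show "(\<Sum>t<d. \<Sum>a<n. (e a t)\<^sup>2) ^ l \<le> (2 * F + 2) ^ l" .
    show "0 \<le> (\<Sum>t<d. \<Sum>a<n. (e a t)\<^sup>2) ^ l" by (rule zero_le_power) (simp add: sum_nonneg)
  qed (use diff e' F \<open>0 \<le> h\<close> Suc in \<open>auto intro!: sum_nonneg\<close>)
  also have "\<dots> = h * (2 * F + 2) ^ Suc l" by (simp add: algebra_simps)
  finally show ?case .
qed (use \<open>0 \<le> h\<close> in \<open>simp add: words_0\<close>)

section \<open>Packing numbers\<close>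

text \<open>A change of the core and a change of the frame are separated and bounded by
  Cauchy-Schwarz. The frame error is multiplied by the size of the core, so a small core tolerates a
  coarse frame.\<close>

lemma sum_tensor_diff_sq_le:
  fixes F h :: real
  assumes e: "(\<Sum>t<d. \<Sum>a<n. (e a t)\<^sup>2) \<le> F" and e': "(\<Sum>t<d. \<Sum>a<n. (e' a t)\<^sup>2) \<le> F"
    and diff: "(\<Sum>t<d. \<Sum>a<n. (e a t - e' a t)\<^sup>2) \<le> h" and "0 \<le> h"
  shows "(\<Sum>xs\<in>words d l. ((\<Sum>as\<in>words n l. C as * tprod e as xs) - (\<Sum>as\<in>words n l. C' as * tprod e' as xs))\<^sup>2)
    \<le> 2 * (2 * F + 2) ^ l * ((\<Sum>as\<in>words n l. (C as - C' as)\<^sup>2) + h * (\<Sum>as\<in>words n l. (C' as)\<^sup>2))"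
proof -
  have F: "0 \<le> F" using e by (rule order_trans[rotated]) (intro sum_nonneg, simp)
  let ?W = "words n l"
  let ?D = "\<Sum>as\<in>?W. (C as - C' as)\<^sup>2" and ?C = "\<Sum>as\<in>?W. (C' as)\<^sup>2"
  let ?X = "\<lambda>xs. (\<Sum>as\<in>?W. C as * tprod e as xs) - (\<Sum>as\<in>?W. C' as * tprod e' as xs)"
  let ?A = "\<lambda>xs. \<Sum>as\<in>?W. (tprod e as xs)\<^sup>2" and ?B = "\<lambda>xs. \<Sum>as\<in>?W. (tprod e as xs - tprod e' as xs)\<^sup>2"
  have D0: "0 \<le> ?D" and C0: "0 \<le> ?C" by (auto intro: sum_nonneg)
  have "(?X xs)\<^sup>2
      \<le> 2 * (?D * ?A xs) + 2 * (?C * ?B xs)" for xs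
  proof -
    have "?X xs
      = (\<Sum>as\<in>?W. (C as - C' as) * tprod e as xs) + (\<Sum>as\<in>?W. C' as * (tprod e as xs - tprod e' as xs))"
      unfolding sum_subtractf[symmetric] sum.distrib[symmetric] by (intro sum.cong) (auto simp: algebra_simps)
    moreover have "(x + y)\<^sup>2 \<le> 2 * x\<^sup>2 + 2 * y\<^sup>2" for x y :: real
      using sum_squares_bound[of x y] by (simp add: power2_sum)
    ultimately have "(?X xs)\<^sup>2
      \<le> 2 * (\<Sum>as\<in>?W. (C as - C' as) * tprod e as xs)\<^sup>2 + 2 * (\<Sum>as\<in>?W. C' as * (tprod e as xs - tprod e' as xs))\<^sup>2"
      by (simp only:)
    also have "\<dots> \<le> 2 * (?D * ?A xs) + 2 * (?C * ?B xs)"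
      by (intro add_mono mult_left_mono Cauchy_Schwarz_ineq_sum) auto
    finally show ?thesis .
  qed
  then have "(\<Sum>xs\<in>words d l. (?X xs)\<^sup>2)
    \<le> (\<Sum>xs\<in>words d l. 2 * (?D * ?A xs) + 2 * (?C * ?B xs))"
    by (rule sum_mono)
  also have "\<dots> = 2 * (?D * (\<Sum>xs\<in>words d l. ?A xs))
     + 2 * (?C * (\<Sum>xs\<in>words d l. ?B xs))"
    by (simp only: sum.distrib sum_distrib_left[symmetric])
  also have "\<dots> \<le> 2 * (?D * (2 * F + 2) ^ l) + 2 * (?C * (h * (2 * F + 2) ^ l))"
  proof (intro add_mono mult_left_mono)
    show "(\<Sum>xs\<in>words d l. ?A xs) \<le> (2 * F + 2) ^ l"
      unfolding sum_tprod_sq using e F by (intro power_mono sum_nonneg) auto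
    show "(\<Sum>xs\<in>words d l. ?B xs) \<le> h * (2 * F + 2) ^ l"
      using assms by (rule sum_tprod_diff_sq_le)
  qed (use D0 C0 in auto)
  also have "\<dots> = 2 * (2 * F + 2) ^ l * (?D + h * ?C)" by (simp add: algebra_simps)
  finally show ?thesis .
qed

text \<open>The atoms of both mixtures span at most 2k directions. The frame coordinates preserve
  their inner products, and moments are functions of inner products, so the core has exactly the
  norm of the original tensors.\<close>

lemma low_rank_representation:
  obtains e :: "nat \<Rightarrow> nat \<Rightarrow> real" and C :: "nat list \<Rightarrow> real"
  where "\<And>a. a < 2 * k \<Longrightarrow> ip d (e a) (e a) \<le> 1"
    and "\<And>l xs. xs \<in> words d l \<Longrightarrow> feature k G xs - feature k G' xs = (\<Sum>as\<in>words (2 * k) l. C as * tprod e as xs)"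
    and "(\<Sum>l<2 * k. \<Sum>as\<in>words (2 * k) l. (C as)\<^sup>2) = moment_dist k d G G'"
proof -
  let ?n = "2 * k" and ?v = "diff_atoms k G G'" and ?c = "diff_weights k G G'"
  obtain e where e1: "\<And>a. a < ?n \<Longrightarrow> ip d (e a) (e a) \<le> 1"
    and sp: "\<And>i t. i < ?n \<Longrightarrow> t < d \<Longrightarrow> ?v i t = (\<Sum>a<?n. ip d (?v i) (e a) * e a t)"
    by (rule orthonormal_frame[of ?n d ?v]) (rule that; assumption)
  define \<alpha> where "\<alpha> i a = ip d (?v i) (e a)" for i a
  define C where "C as = (\<Sum>i<?n. ?c i * prod_list (map (\<alpha> i) as))" for as
  have \<alpha>: "ip ?n (\<alpha> i) (\<alpha> j) = ip d (?v i) (?v j)" if "i < ?n" for i j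
  proof -
    have "ip d (?v i) (?v j) = ip d (\<lambda>t. \<Sum>a<?n. \<alpha> i a * e a t) (?v j)"
      unfolding ip_def[of d _ "?v j"] using sp[OF that] by (intro sum.cong) (auto simp: \<alpha>_def)
    also have "\<dots> = ip ?n (\<alpha> i) (\<alpha> j)"
      unfolding ip_sum_left ip_scale_left by (simp add: ip_def[of ?n] \<alpha>_def ip_commute[of d "?v j"])
    finally show ?thesis ..
  qed
  show thesis
  proof (rule that[OF e1])
    fix l xs assume xs: "xs \<in> words d l"
    have "feature k G xs - feature k G' xs = (\<Sum>i<?n. ?c i * prod_list (map (?v i) xs))"
      by (rule sum_diff_feature[symmetric])
    also have "\<dots> = (\<Sum>i<?n. ?c i * (\<Sum>as\<in>words ?n l. prod_list (map (\<alpha> i) as) * tprod e as xs))"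
    proof (intro sum.cong refl)
      fix i assume "i \<in> {..<?n}"
      then have "prod_list (map (?v i) xs) = (\<Sum>as\<in>words ?n (length xs). prod_list (map (\<alpha> i) as) * tprod e as xs)"
        using xs sp by (intro prod_list_expand[of d]) (auto simp: \<alpha>_def words_def)
      then show "?c i * prod_list (map (?v i) xs) = ?c i * (\<Sum>as\<in>words ?n l. prod_list (map (\<alpha> i) as) * tprod e as xs)"
        using xs by (simp add: words_def)
    qed
    also have "\<dots> = (\<Sum>as\<in>words ?n l. C as * tprod e as xs)"
      unfolding sum_distrib_left C_def sum_distrib_right by (subst sum.swap) (simp add: mult.assoc)
    finally show "feature k G xs - feature k G' xs = (\<Sum>as\<in>words ?n l. C as * tprod e as xs)" .
  next
    have "moment ?n ?n ?c \<alpha> l = moment d ?n ?c ?v l" for l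
      unfolding moment_def by (rule qf_cong) (simp add: \<alpha>)
    then show "(\<Sum>l<?n. \<Sum>as\<in>words ?n l. (C as)\<^sup>2) = moment_dist k d G G'"
      unfolding moment_dist_def moment_eq_sum_words[of ?n] C_def by simp
  qed
qed

lemma sum_power_le_power:
  fixes n :: nat assumes "2 \<le> n"
  shows "(\<Sum>l<m. n ^ l) \<le> n ^ m"
proof (induction m)
  case (Suc m)
  then have "(\<Sum>l<Suc m. n ^ l) \<le> 2 * n ^ m" by simp
  also have "\<dots> \<le> n * n ^ m" using assms by (rule mult_right_mono) simp
  finally show ?case by simp
qed simp

text \<open>This is 15 n * 2 W with n = 2k and W = (2n + 2)^n: the factor 15 n comes from the
  lattice count, 2 W from the mesh needed for separation.\<close>

definition pack_const :: "nat \<Rightarrow> real" where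
  "pack_const k = 60 * real k * (4 * real k + 2) ^ (2 * k)"

text \<open>Each member is encoded by the rounded frame and core of its difference to
  \<open>G0\<close>. Separation makes the code injective. The core has norm at most
  \<open>s\<close>, so both meshes depend on \<open>s / \<tau>\<close> alone; this locality is what
  keeps log n out of the rate.\<close>

lemma separated_card_le:
  assumes "finite X" and k: "1 \<le> k" and d: "1 \<le> d" and \<tau>: "0 < \<tau>" "\<tau> \<le> s"
    and near: "\<And>G. G \<in> X \<Longrightarrow> moment_dist k d G G0 \<le> s\<^sup>2"
    and sep: "\<And>G G'. G \<in> X \<Longrightarrow> G' \<in> X \<Longrightarrow> G \<noteq> G' \<Longrightarrow> \<tau>\<^sup>2 < moment_dist k d G G'"
  shows "card X \<le> (pack_const k * s / \<tau>) ^ (2 * k * d + (2 * k) ^ (2 * k))"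
proof -
  define n where "n = 2 * k"
  have n: "2 \<le> n" using k by (simp add: n_def)
  have s: "0 < s" using \<tau> by simp
  define W where "W = (2 * real n + 2) ^ n"
  have W: "1 \<le> W" unfolding W_def by (rule one_le_power) simp
  \<comment> \<open>The core mesh. Core and frame errors will each contribute \<zeta>^2 times 2 W, a
    total of \<tau>^2 / W.\<close>
  define \<zeta> where "\<zeta> = \<tau> / (2 * W)"
  have \<zeta>: "0 < \<zeta>" using \<tau> W by (simp add: \<zeta>_def)
  \<comment> \<open>The frame mesh is 1 / q: multiplied by the core size \<open>s\<close> it equals
    the core mesh.\<close>
  define q where "q = s / \<zeta>"
  have q: "1 \<le> q"
  proof -
    have "\<tau> * 1 \<le> s * (2 * W)" using \<tau> W by (intro mult_mono) auto
    then show ?thesis using \<tau> by (simp add: q_def \<zeta>_def)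
  qed
  \<comment> \<open>One index set for the cores of all orders; it has \<Sum> n^l \<le> n^n
    elements.\<close>
  define J where "J = (\<Union>l<n. words n l)"
  have finJ: "finite J" by (simp add: J_def)
  have sumJ: "(\<Sum>as\<in>J. f as) = (\<Sum>l<n. \<Sum>as\<in>words n l. f as)" for f :: "nat list \<Rightarrow> real"
    unfolding J_def by (rule sum.UNION_disjoint) (simp, simp, auto simp: words_def)
  have "card J = (\<Sum>l<n. n ^ l)"
    unfolding J_def by (subst card_UN_disjoint) (simp_all add: card_words, auto simp: words_def)
  then have cardJ: "card J \<le> n ^ n" using sum_power_le_power[OF n, of n] by simp
  have "[] \<in> J" using n by (auto simp: J_def words_def)
  then have J0: "J \<noteq> {}" by auto
  let ?I = "{..<n} \<times> {..<d}"
  have I: "finite ?I" "?I \<noteq> {}" "card ?I = n * d" using n d by (auto simp: lessThan_empty_iff)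
  obtain e :: "_ \<Rightarrow> nat \<Rightarrow> nat \<Rightarrow> real" and C :: "_ \<Rightarrow> nat list \<Rightarrow> real"
    where e1: "\<And>G a. a < n \<Longrightarrow> ip d (e G a) (e G a) \<le> 1"
    and rep: "\<And>G l xs. xs \<in> words d l \<Longrightarrow> feature k G xs - feature k G0 xs = (\<Sum>as\<in>words n l. C G as * tprod (e G) as xs)"
    and nrm: "\<And>G. (\<Sum>l<n. \<Sum>as\<in>words n l. (C G as)\<^sup>2) = moment_dist k d G G0"
  proof -
    define good where "good G p \<longleftrightarrow> (\<forall>a<n. ip d (fst p a) (fst p a) \<le> 1)
      \<and> (\<forall>l. \<forall>xs\<in>words d l. feature k G xs - feature k G0 xs = (\<Sum>as\<in>words n l. snd p as * tprod (fst p) as xs))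
      \<and> (\<Sum>l<n. \<Sum>as\<in>words n l. (snd p as)\<^sup>2) = moment_dist k d G G0" for G p
    have "\<exists>p. good G p" for G
    proof (rule low_rank_representation[of k d G G0, folded n_def])
      fix e C assume *: "\<And>a. a < n \<Longrightarrow> ip d (e a) (e a) \<le> 1"
        "\<And>l xs. xs \<in> words d l \<Longrightarrow> feature k G xs - feature k G0 xs = (\<Sum>as\<in>words n l. C as * tprod e as xs)"
        "(\<Sum>l<n. \<Sum>as\<in>words n l. (C as)\<^sup>2) = moment_dist k d G G0"
      show ?thesis by (rule exI[of _ "(e, C)"]) (use * in \<open>simp add: good_def\<close>)
    qed
    then obtain p where "\<And>G. good G (p G)" by metis
    then show thesis by (intro that[of "\<lambda>G. fst (p G)" "\<lambda>G. snd (p G)"]) (auto simp: good_def)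
  qed
  obtain r1 :: "(nat \<times> nat \<Rightarrow> real) \<Rightarrow> nat \<times> nat \<Rightarrow> int"
    where r1: "\<And>f. (\<Sum>i\<in>?I. (f i)\<^sup>2) \<le> (real n)\<^sup>2 \<Longrightarrow>
        r1 f \<in> {z \<in> PiE ?I (\<lambda>_. UNIV). (\<Sum>i\<in>?I. \<bar>real_of_int (z i)\<bar>) \<le> card ?I * (real n / (1 / q) + 1)}"
      and r1': "\<And>f g. r1 f = r1 g \<Longrightarrow> (\<Sum>i\<in>?I. (f i - g i)\<^sup>2) \<le> (1 / q)\<^sup>2"
    using rounding[of ?I "real n" "1 / q"] I q by auto
  obtain r2 :: "(nat list \<Rightarrow> real) \<Rightarrow> nat list \<Rightarrow> int"
    where r2: "\<And>f. (\<Sum>i\<in>J. (f i)\<^sup>2) \<le> s\<^sup>2 \<Longrightarrow>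
        r2 f \<in> {z \<in> PiE J (\<lambda>_. UNIV). (\<Sum>i\<in>J. \<bar>real_of_int (z i)\<bar>) \<le> card J * (s / \<zeta> + 1)}"
      and r2': "\<And>f g. r2 f = r2 g \<Longrightarrow> (\<Sum>i\<in>J. (f i - g i)\<^sup>2) \<le> \<zeta>\<^sup>2"
    using rounding[of J s \<zeta>] finJ J0 s \<zeta> by auto
  let ?A1 = "{z \<in> PiE ?I (\<lambda>_. UNIV :: int set). (\<Sum>i\<in>?I. \<bar>real_of_int (z i)\<bar>) \<le> card ?I * (real n / (1 / q) + 1)}"
  let ?A2 = "{z \<in> PiE J (\<lambda>_. UNIV :: int set). (\<Sum>i\<in>J. \<bar>real_of_int (z i)\<bar>) \<le> card J * (s / \<zeta> + 1)}"
  define \<phi> where "\<phi> G = (r1 (\<lambda>(a, t). e G a t), r2 (C G))" for G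
  have sumI: "(\<Sum>i\<in>?I. (case i of (a, t) \<Rightarrow> f a t)) = (\<Sum>t<d. \<Sum>a<n. f a t)" for f :: "nat \<Rightarrow> nat \<Rightarrow> real"
    by (subst sum.swap) (rule sum.cartesian_product[symmetric])
  have frame: "(\<Sum>t<d. \<Sum>a<n. (e G a t)\<^sup>2) \<le> real n" for G
  proof -
    have "(\<Sum>t<d. \<Sum>a<n. (e G a t)\<^sup>2) = (\<Sum>a<n. ip d (e G a) (e G a))"
      by (subst sum.swap) (simp add: ip_def power2_eq_square)
    also have "\<dots> \<le> (\<Sum>a<n. 1)" by (intro sum_mono e1) simp
    finally show ?thesis by simp
  qed
  have img: "\<phi> ` X \<subseteq> ?A1 \<times> ?A2"
  proof -
    have "\<phi> G \<in> ?A1 \<times> ?A2" if "G \<in> X" for G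
    proof -
      have "(\<Sum>i\<in>?I. (case i of (a, t) \<Rightarrow> e G a t)\<^sup>2) = (\<Sum>t<d. \<Sum>a<n. (e G a t)\<^sup>2)"
        using sumI[of "\<lambda>a t. (e G a t)\<^sup>2"] by (simp add: case_prod_beta)
      also have "\<dots> \<le> (real n)\<^sup>2"
        using frame[of G] n by (simp add: power2_eq_square) (smt (verit) mult_le_cancel_left1 of_nat_1 of_nat_mono le_trans one_le_numeral)
      finally have a1: "r1 (\<lambda>(a, t). e G a t) \<in> ?A1" by (rule r1)
      have "(\<Sum>i\<in>J. (C G i)\<^sup>2) \<le> s\<^sup>2" unfolding sumJ nrm using near[OF that] .
      then have "r2 (C G) \<in> ?A2" by (rule r2)
      with a1 show ?thesis unfolding \<phi>_def by (rule SigmaI)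
    qed
    then show ?thesis by blast
  qed
  have inj: "inj_on \<phi> X"
  proof (rule inj_onI, rule ccontr)
    fix G G' assume G: "G \<in> X" "G' \<in> X" and eq: "\<phi> G = \<phi> G'" and ne: "G \<noteq> G'"
    let ?T = "\<lambda>l. \<Sum>xs\<in>words d l. ((\<Sum>as\<in>words n l. C G as * tprod (e G) as xs) - (\<Sum>as\<in>words n l. C G' as * tprod (e G') as xs))\<^sup>2"
    let ?U = "\<lambda>l. (\<Sum>as\<in>words n l. (C G as - C G' as)\<^sup>2) + (1 / q)\<^sup>2 * (\<Sum>as\<in>words n l. (C G' as)\<^sup>2)"
    have h: "(\<Sum>t<d. \<Sum>a<n. (e G a t - e G' a t)\<^sup>2) \<le> (1 / q)\<^sup>2"
      using r1'[of "\<lambda>(a, t). e G a t" "\<lambda>(a, t). e G' a t"] eq sumI[of "\<lambda>a t. (e G a t - e G' a t)\<^sup>2"]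
      by (simp add: \<phi>_def case_prod_beta)
    have CC: "(\<Sum>l<n. \<Sum>as\<in>words n l. (C G as - C G' as)\<^sup>2) \<le> \<zeta>\<^sup>2"
      using r2'[of "C G" "C G'"] eq unfolding sumJ by (simp add: \<phi>_def)
    have "moment_dist k d G G' = (\<Sum>l<n. ?T l)"
      unfolding moment_dist_eq_features n_def[symmetric]
      by (intro sum.cong refl) (simp add: rep[symmetric])
    also have "\<dots> \<le> (\<Sum>l<n. 2 * W * ?U l)"
    proof (rule sum_mono)
      fix l assume l: "l \<in> {..<n}"
      have "?T l
        \<le> 2 * (2 * real n + 2) ^ l * ?U l"
        by (rule sum_tensor_diff_sq_le) (use frame h in auto)
      also have "\<dots> \<le> 2 * W * ?U l"
        unfolding W_def using l
        by (intro mult_right_mono mult_left_mono power_increasing add_nonneg_nonneg mult_nonneg_nonneg sum_nonneg) auto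
      finally show "?T l \<le> \<dots>" .
    qed
    also have "\<dots> = 2 * W * ((\<Sum>l<n. \<Sum>as\<in>words n l. (C G as - C G' as)\<^sup>2) + (1 / q)\<^sup>2 * moment_dist k d G' G0)"
      unfolding nrm[symmetric] by (simp only: sum_distrib_left sum.distrib distrib_left)
    also have "\<dots> \<le> 2 * W * (\<zeta>\<^sup>2 + (1 / q)\<^sup>2 * s\<^sup>2)"
      using W CC near[OF G(2)] by (intro mult_left_mono add_mono) auto
    also have "(1 / q)\<^sup>2 * s\<^sup>2 = \<zeta>\<^sup>2" using s \<zeta> by (simp add: q_def power_divide)
    also have "2 * W * (\<zeta>\<^sup>2 + \<zeta>\<^sup>2) = \<tau>\<^sup>2 / W"
      using W by (simp add: \<zeta>_def power2_eq_square field_simps)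
    also have "\<dots> \<le> \<tau>\<^sup>2" using W by (simp add: divide_le_eq mult_le_cancel_left1)
    finally show False using sep[OF G ne] by simp
  qed
  \<comment> \<open>Here 15 = 3 * 5, from e \<le> 3 and 1 + 2 S \<le> 5 n q whenever S \<le> 2 n
    q.\<close>
  define Q where "Q = 15 * real n * q"
  have nq: "1 \<le> real n * q" using mult_mono[of 1 "real n" 1 q] n q by simp
  have e3: "exp 1 * (1 + 2 * S) \<le> Q" if "0 \<le> S" "S \<le> 2 * (real n * q)" for S
  proof -
    have "exp 1 * (1 + 2 * S) \<le> 3 * (5 * (real n * q))"
      using that nq exp_le by (intro mult_mono) auto
    then show ?thesis by (simp add: Q_def)
  qed
  have Q: "1 \<le> Q" unfolding Q_def using nq by simp
  have S1: "0 < real n / (1 / q) + 1" "real n / (1 / q) + 1 \<le> 2 * (real n * q)" using nq q by (auto simp: mult.commute intro: add_nonneg_pos)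
  have "q \<le> real n * q" using n q by simp
  then have S2: "0 < s / \<zeta> + 1" "s / \<zeta> + 1 \<le> 2 * (real n * q)" using nq q unfolding q_def[symmetric] by linarith+
  have c1: "card ?A1 \<le> Q ^ (n * d)"
  proof -
    have "card ?A1 \<le> (exp 1 * (1 + 2 * (real n / (1 / q) + 1))) ^ card ?I" by (rule card_lattice_points_le[OF I(1) S1(1)])
    also have "\<dots> \<le> Q ^ card ?I" using S1 by (intro power_mono e3) auto
    finally show ?thesis using I(3) by simp
  qed
  have c2: "card ?A2 \<le> Q ^ (n ^ n)"
  proof -
    have "card ?A2 \<le> (exp 1 * (1 + 2 * (s / \<zeta> + 1))) ^ card J" by (rule card_lattice_points_le[OF finJ S2(1)])
    also have "\<dots> \<le> Q ^ card J" using S2 by (intro power_mono e3) auto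
    also have "\<dots> \<le> Q ^ (n ^ n)" using cardJ Q by (rule power_increasing)
    finally show ?thesis .
  qed
  have fin: "finite (?A1 \<times> ?A2)"
    by (intro finite_cartesian_product finite_lattice_points I(1) finJ S1 S2)
  have "card X = card (\<phi> ` X)" using inj by (rule card_image[symmetric])
  also have "\<dots> \<le> card (?A1 \<times> ?A2)" by (rule card_mono[OF fin img])
  also have "\<dots> = card ?A1 * card ?A2" by (rule card_cartesian_product)
  finally have "real (card X) \<le> real (card ?A1) * real (card ?A2)" by (simp only: of_nat_mult[symmetric] of_nat_le_iff)
  also have "\<dots> \<le> Q ^ (n * d) * Q ^ (n ^ n)" using c1 c2 Q by (intro mult_mono) auto
  also have "\<dots> = Q ^ (n * d + n ^ n)" by (simp add: power_add)
  also have "Q = pack_const k * s / \<tau>"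
    using \<tau> W by (simp add: Q_def q_def \<zeta>_def W_def n_def pack_const_def add.commute)
  finally show ?thesis by (simp add: n_def add.commute)
qed

section \<open>Likelihood ratio tests on a finite net\<close>

text \<open>Ties are broken by the least index in a fixed enumeration, which makes the selection
  measurable.\<close>

lemma measurable_argmin:
  fixes g :: "'b \<Rightarrow> 'a \<Rightarrow> real"
  assumes "finite A" "A \<noteq> {}" and [measurable]: "\<And>s. s \<in> A \<Longrightarrow> g s \<in> borel_measurable M"
  obtains sel where "sel \<in> measurable M (count_space A)" "\<And>x. sel x \<in> A" "\<And>x s. s \<in> A \<Longrightarrow> g (sel x) x \<le> g s x"
proof -
  obtain f where f: "bij_betw f {0..<card A} A" using ex_bij_betw_nat_finite[OF assms(1)] by blast
  define m where "m = card A"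
  have m: "0 < m" using assms by (simp add: m_def card_gt_0_iff)
  have fA: "f j \<in> A" if "j < m" for j using f that by (auto simp: bij_betw_def m_def)
  define P where "P x j \<longleftrightarrow> j < m \<and> (\<forall>i<m. g (f j) x \<le> g (f i) x)" for x j
  have ex: "\<exists>j. P x j" for x
  proof -
    obtain j where "j \<in> {..<m}" "\<forall>i\<in>{..<m}. g (f j) x \<le> g (f i) x"
      using ex_min_if_finite[of "(\<lambda>i. g (f i) x) ` {..<m}"] m by (force simp: not_less)
    then show ?thesis by (auto simp: P_def)
  qed
  define J where "J x = (LEAST j. P x j)" for x
  have J: "P x (J x)" for x unfolding J_def using ex by (rule LeastI_ex)
  have Jm: "J \<in> measurable M (count_space UNIV)"
    unfolding J_def[abs_def]
  proof (rule measurable_Least)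
    fix j show "Measurable.pred M (\<lambda>x. P x j)"
    proof (cases "j < m")
      case True
      have [measurable]: "g (f i) \<in> borel_measurable M" if "i < m" for i using fA[OF that] assms(3) by simp
      have "{x \<in> space M. \<forall>i\<in>{..<m}. g (f j) x \<le> g (f i) x} \<in> sets M"
        by (rule sets.sets_Collect_finite_All) (use True in auto)
      then show ?thesis using True by (simp add: P_def Ball_def pred_def)
    qed (simp add: P_def)
  qed
  define f' where "f' j = (if j < m then f j else f 0)" for j
  have "f' \<in> measurable (count_space UNIV) (count_space A)"
    using fA m by (auto simp: f'_def)
  with Jm have "(\<lambda>x. f' (J x)) \<in> measurable M (count_space A)"
    by (rule measurable_compose)
  moreover have "f' (J x) \<in> A" for x using fA m by (auto simp: f'_def)
  moreover have "g (f' (J x)) x \<le> g s x" if "s \<in> A" for x s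
  proof -
    have "s \<in> f ` {0..<m}" using f that by (simp add: bij_betw_def m_def)
    then obtain i where "i < m" "s = f i" by auto
    then show ?thesis using J[of x] by (auto simp: P_def f'_def)
  qed
  ultimately show thesis by (rule that)
qed

section \<open>Samples and likelihood ratios under a third mixture\<close>

lemma sets_PGamma [simp, measurable_cong]: "sets (PGamma k d G) = sets (Rd d)"
  by (simp add: PGamma_def)

lemma space_PGamma [simp]: "space (PGamma k d G) = space (Rd d)"
  by (simp add: PGamma_def)

lemma sets_sample_PGamma [measurable_cong]: "sets (sample n (PGamma k d G)) = sets (PiM {..<n} (\<lambda>_. Rd d))"
  unfolding sample_def by (rule sets_PiM_cong) auto

lemma space_sample_PGamma: "space (sample n (PGamma k d G)) = space (PiM {..<n} (\<lambda>_. Rd d))"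
  by (rule sets_eq_imp_space_eq[OF sets_sample_PGamma])

lemma prob_space_sample: "prob_space P \<Longrightarrow> prob_space (sample n P)"
  unfolding sample_def by (rule prob_space_PiM)

lemma nn_integral_sample_prod:
  assumes "prob_space P" "f \<in> borel_measurable P"
  shows "(\<integral>\<^sup>+X. (\<Prod>s<n. f (X s)) \<partial>sample n P) = (\<integral>\<^sup>+x. f x \<partial>P) ^ n"
proof -
  interpret prob_space P by fact
  interpret product_sigma_finite "\<lambda>_::nat. P" by standard
  show ?thesis unfolding sample_def using assms(2) by (subst product_nn_integral_prod) auto
qed

text \<open>If the truth were \<open>G0\<close> this would be the Hellinger affinity 1 - H^2 / 2.
  The deviation p - q enters through a cross term, which is split so that it costs half of the gain
  H^2 / 2 and one chi^2-divergence.\<close>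

lemma sqrt_likelihood_ratio_integral_le:
  assumes G: "G \<in> Gkd k d R" "G0 \<in> Gkd k d R" "G1 \<in> Gkd k d R" and "0 \<le> R"
  shows "(\<integral>\<^sup>+x. ennreal (sqrt (mixd k d G1 x / mixd k d G0 x)) \<partial>PGamma k d G)
    \<le> ennreal (1 - (hdist k d G0 G1)\<^sup>2 / 4 + cmp_const k R * moment_dist k d G G0)"
proof -
  let ?p = "mixd k d G" and ?q = "mixd k d G0" and ?r = "mixd k d G1"
  have pos: "0 < ?p x" "0 < ?q x" "0 < ?r x" for x using mixd_pos G by auto
  note iH = integrable_sqrt_diff_sq[OF integrable_mixd[of d k G0] integrable_mixd[of d k G1] mixd_nonneg[OF G(2)] mixd_nonneg[OF G(3)]]
  note iC = integrable_chi2[OF G(1,2) \<open>0 \<le> R\<close>]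
  let ?U = "\<lambda>x. (?q x + ?r x) / 2 - (sqrt (?q x) - sqrt (?r x))\<^sup>2 / 4 + (?p x - ?q x) + (?p x - ?q x)\<^sup>2 / ?q x"
  have pt: "?p x * sqrt (?r x / ?q x) \<le> ?U x" for x
  proof -
    define a b u where "a = sqrt (?q x)" and "b = sqrt (?r x)" and "u = ?p x - ?q x"
    have a: "0 < a" "?q x = a\<^sup>2" and b: "?r x = b\<^sup>2" using pos[of x] by (auto simp: a_def b_def)
    have "?p x * sqrt (?r x / ?q x) = (u + a\<^sup>2) * (b / a)"
      using pos[of x] by (simp add: real_sqrt_divide a_def b_def u_def)
    also have "\<dots> = a * b + u + (u / a) * (b - a)" using a(1) by (simp add: field_simps power2_eq_square)
    also have "(u / a) * (b - a) \<le> (u / a)\<^sup>2 + (b - a)\<^sup>2 / 4"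
    proof -
      have "0 \<le> (u / a - (b - a) / 2)\<^sup>2" by simp
      then show ?thesis by (simp add: power2_diff power_divide)
    qed
    finally have "?p x * sqrt (?r x / ?q x) \<le> a * b + u + ((u / a)\<^sup>2 + (b - a)\<^sup>2 / 4)" by simp
    also have "\<dots> = (a\<^sup>2 + b\<^sup>2) / 2 - (a - b)\<^sup>2 / 4 + u + u\<^sup>2 / a\<^sup>2"
      by (simp add: power2_eq_square field_simps)
    finally show ?thesis unfolding a(2)[symmetric] b[symmetric] unfolding a_def b_def u_def .
  qed
  have U: "integrable (Rd d) ?U"
    using iH iC by (intro Bochner_Integration.integrable_add Bochner_Integration.integrable_diff integrable_divide integrable_mixd) auto
  have "(\<integral>\<^sup>+x. ennreal (sqrt (?r x / ?q x)) \<partial>PGamma k d G) = (\<integral>\<^sup>+x. ennreal (?p x) * ennreal (sqrt (?r x / ?q x)) \<partial>Rd d)"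
    unfolding PGamma_eq by (rule nn_integral_density) auto
  also have "\<dots> \<le> (\<integral>\<^sup>+x. ennreal (?U x) \<partial>Rd d)"
    using pt pos by (intro nn_integral_mono) (simp add: ennreal_mult[symmetric] less_imp_le ennreal_leI)
  also have "\<dots> = ennreal (\<integral>x. ?U x \<partial>Rd d)"
  proof (rule nn_integral_eq_integral[OF U], rule AE_I2)
    fix x
    have "0 \<le> ?p x * sqrt (?r x / ?q x)" using pos[of x] by simp
    then show "0 \<le> ?U x" using pt[of x] by linarith
  qed
  also have "(\<integral>x. ?U x \<partial>Rd d) = 1 - (hdist k d G0 G1)\<^sup>2 / 4 + (\<integral>x. (?p x - ?q x)\<^sup>2 / ?q x \<partial>Rd d)"
    using iH iC G by (simp add: integrable_mixd integral_mixd hellinger_PGamma_sq)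
  also have "ennreal \<dots> \<le> ennreal (1 - (hdist k d G0 G1)\<^sup>2 / 4 + cmp_const k R * moment_dist k d G G0)"
    using chi2_le_moment_dist[OF G(1,2) \<open>0 \<le> R\<close>] by (intro ennreal_leI) simp
  finally show ?thesis .
qed

lemma sqrt_prod: "sqrt (\<Prod>i\<in>A. f i) = (\<Prod>i\<in>A. sqrt (f i))"
  by (induction A rule: infinite_finite_induct) (auto simp: real_sqrt_mult)

text \<open>On the event the square root of the likelihood ratio is at least 1, so its expectation
  bounds the probability; independence gives an n-th power. By \<open>near\<close>, half of the
  exponent H^2 / 4 survives.\<close>

lemma likelihood_ratio_test_error:
  assumes G: "G \<in> Gkd k d R" "G0 \<in> Gkd k d R" "G1 \<in> Gkd k d R" and "0 \<le> R"
    and near: "cmp_const k R * moment_dist k d G G0 \<le> (hdist k d G0 G1)\<^sup>2 / 8"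
  shows "measure (sample n (PGamma k d G)) {X \<in> space (PiM {..<n} (\<lambda>_. Rd d)).
      (\<Prod>s<n. mixd k d G0 (X s)) \<le> (\<Prod>s<n. mixd k d G1 (X s))}
    \<le> exp (- real n * (hdist k d G0 G1)\<^sup>2 / 8)"
proof -
  let ?S = "sample n (PGamma k d G)" and ?q = "mixd k d G0" and ?r = "mixd k d G1"
  let ?H = "hdist k d G0 G1"
  interpret P: prob_space "PGamma k d G" using G(1) by (rule prob_space_PGamma)
  interpret S: prob_space ?S by (rule prob_space_sample) (rule P.prob_space_axioms)
  have pos: "0 < ?q x" "0 < ?r x" for x using mixd_pos G by auto
  let ?A = "{X \<in> space (PiM {..<n} (\<lambda>_. Rd d)). (\<Prod>s<n. ?q (X s)) \<le> (\<Prod>s<n. ?r (X s))}"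
  have A[measurable]: "?A \<in> sets ?S" unfolding sets_sample_PGamma by measurable
  have "emeasure ?S ?A = (\<integral>\<^sup>+X. indicator ?A X \<partial>?S)" by simp
  also have "\<dots> \<le> (\<integral>\<^sup>+X. (\<Prod>s<n. ennreal (sqrt (?r (X s) / ?q (X s)))) \<partial>?S)"
  proof (rule nn_integral_mono)
    fix X
    show "indicator ?A X \<le> (\<Prod>s<n. ennreal (sqrt (?r (X s) / ?q (X s))))"
    proof (cases "X \<in> ?A")
      case True
      have "0 < (\<Prod>s<n. ?q (X s))" using pos by (intro prod_pos) auto
      then have "1 \<le> sqrt ((\<Prod>s<n. ?r (X s)) / (\<Prod>s<n. ?q (X s)))" using True by simp
      also have "\<dots> = (\<Prod>s<n. sqrt (?r (X s) / ?q (X s)))"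
        by (simp add: prod_dividef real_sqrt_divide sqrt_prod)
      finally have "ennreal 1 \<le> ennreal (\<Prod>s<n. sqrt (?r (X s) / ?q (X s)))" by (rule ennreal_leI)
      also have "\<dots> = (\<Prod>s<n. ennreal (sqrt (?r (X s) / ?q (X s))))"
        using pos by (intro prod_ennreal[symmetric]) (auto simp: less_imp_le)
      finally show ?thesis using True by simp
    qed simp
  qed
  also have "\<dots> = (\<integral>\<^sup>+x. ennreal (sqrt (?r x / ?q x)) \<partial>PGamma k d G) ^ n"
    by (rule nn_integral_sample_prod[OF P.prob_space_axioms]) measurable
  also have "\<dots> \<le> ennreal (1 - ?H\<^sup>2 / 4 + cmp_const k R * moment_dist k d G G0) ^ n"
    by (intro power_mono sqrt_likelihood_ratio_integral_le[OF G \<open>0 \<le> R\<close>]) simp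
  also have "\<dots> \<le> ennreal (exp (- ?H\<^sup>2 / 8)) ^ n"
  proof (intro power_mono ennreal_leI)
    have "1 + (- ?H\<^sup>2 / 8) \<le> exp (- ?H\<^sup>2 / 8)" by (rule exp_ge_add_one_self)
    then show "1 - ?H\<^sup>2 / 4 + cmp_const k R * moment_dist k d G G0 \<le> exp (- ?H\<^sup>2 / 8)" using near by simp
  qed simp
  also have "\<dots> = ennreal (exp (- real n * ?H\<^sup>2 / 8))"
    by (simp add: ennreal_power exp_of_nat_mult[symmetric])
  finally show ?thesis by (simp add: S.emeasure_eq_measure)
qed

lemma hellinger_sq_le_2:
  assumes "G \<in> Gkd k d R" "G' \<in> Gkd k d R"
  shows "(hdist k d G G')\<^sup>2 \<le> 2"
proof -
  have "(\<integral>x. (sqrt (mixd k d G x) - sqrt (mixd k d G' x))\<^sup>2 \<partial>Rd d) \<le> (\<integral>x. mixd k d G x + mixd k d G' x \<partial>Rd d)"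
  proof (intro integral_mono integrable_sqrt_diff_sq integrable_mixd mixd_nonneg[OF assms(1)] mixd_nonneg[OF assms(2)] Bochner_Integration.integrable_add)
    fix x
    have "0 \<le> sqrt (mixd k d G x) * sqrt (mixd k d G' x)"
      using mixd_nonneg[OF assms(1)] mixd_nonneg[OF assms(2)] by simp
    then show "(sqrt (mixd k d G x) - sqrt (mixd k d G' x))\<^sup>2 \<le> mixd k d G x + mixd k d G' x"
      using mixd_nonneg[OF assms(1), of x] mixd_nonneg[OF assms(2), of x] by (simp add: power2_diff)
  qed
  also have "\<dots> = 2" using assms by (simp add: integrable_mixd integral_mixd)
  finally show ?thesis using assms by (simp add: hellinger_PGamma_sq)
qed

lemma moment_dist_bounded:
  assumes "G \<in> Gkd k d R" "G' \<in> Gkd k d R" "0 \<le> R" "0 < k"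
  shows "moment_dist k d G G' \<le> 8 * cmp_const k R * (2 * k * fact (2 * k))\<^sup>2"
proof -
  have "moment_dist k d G G' \<le> 4 * cmp_const k R * (2 * k * fact (2 * k))\<^sup>2 * (hdist k d G G')\<^sup>2"
    by (rule moment_dist_le_hellinger) fact+
  also have "\<dots> \<le> 4 * cmp_const k R * (2 * k * fact (2 * k))\<^sup>2 * 2"
    using hellinger_sq_le_2[OF assms(1,2)] cmp_const_ge_1[of k R] by (intro mult_left_mono) auto
  finally show ?thesis by simp
qed

text \<open>Separated sets have bounded cardinality, so one of largest cardinality exists; a member
  far from all of it could be added.\<close>

lemma finite_net:
  assumes R: "0 \<le> R" and k: "1 \<le> k" and d: "1 \<le> d" and \<tau>: "0 < \<tau>"
  obtains X where "finite X" "X \<subseteq> Gkd k d R"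
    and "\<And>G G'. G \<in> X \<Longrightarrow> G' \<in> X \<Longrightarrow> G \<noteq> G' \<Longrightarrow> \<tau>\<^sup>2 < moment_dist k d G G'"
    and "\<And>G. G \<in> Gkd k d R \<Longrightarrow> \<exists>G0\<in>X. moment_dist k d G G0 \<le> \<tau>\<^sup>2"
proof -
  define sep where "sep X \<longleftrightarrow> finite X \<and> X \<subseteq> Gkd k d R \<and> (\<forall>G\<in>X. \<forall>G'\<in>X. G \<noteq> G' \<longrightarrow> \<tau>\<^sup>2 < moment_dist k d G G')" for X
  \<comment> \<open>At least the moment-distance diameter of the class, so the local packing bound
    applies to the whole class; the maximum with \<open>\<tau>\<close> meets its other
    hypothesis.\<close>
  define s where "s = max \<tau> (sqrt (8 * cmp_const k R * (2 * k * fact (2 * k))\<^sup>2))"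
  define B where "B = nat \<lceil>(pack_const k * s / \<tau>) ^ (2 * k * d + (2 * k) ^ (2 * k))\<rceil>"
  have bound: "card X < Suc B" if "sep X" for X
  proof (cases "X = {}")
    case False
    then obtain G0 where G0: "G0 \<in> X" by blast
    have "moment_dist k d G G0 \<le> s\<^sup>2" if "G \<in> X" for G
    proof -
      have "moment_dist k d G G0 \<le> (sqrt (8 * cmp_const k R * (2 * k * fact (2 * k))\<^sup>2))\<^sup>2"
      proof -
        have "G \<in> Gkd k d R" "G0 \<in> Gkd k d R" using that G0 \<open>sep X\<close> by (auto simp: sep_def)
        then have "moment_dist k d G G0 \<le> 8 * cmp_const k R * (2 * k * fact (2 * k))\<^sup>2"
          using R k by (intro moment_dist_bounded) auto
        also have "\<dots> = (sqrt (8 * cmp_const k R * (2 * k * fact (2 * k))\<^sup>2))\<^sup>2"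
          using cmp_const_ge_1[of k R] by (intro real_sqrt_pow2[symmetric] mult_nonneg_nonneg) auto
        finally show ?thesis .
      qed
      also have "\<dots> \<le> s\<^sup>2" using cmp_const_ge_1[of k R] unfolding s_def by (intro power_mono) auto
      finally show ?thesis .
    qed
    note near = this
    have "card X \<le> (pack_const k * s / \<tau>) ^ (2 * k * d + (2 * k) ^ (2 * k))"
      by (rule separated_card_le[OF _ k d \<tau> _ near]) (use \<open>sep X\<close> in \<open>auto simp: sep_def s_def\<close>)
    then have "card X \<le> B" unfolding B_def by linarith
    then show ?thesis by simp
  qed simp
  have "sep {}" by (simp add: sep_def)
  then obtain X where X: "sep X" "\<And>Y. sep Y \<Longrightarrow> card Y \<le> card X"
    using ex_has_greatest_nat[of sep "{}" card "Suc B"] bound by (metis less_imp_le)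
  show thesis
  proof (rule that[of X])
    fix G assume G: "G \<in> Gkd k d R"
    show "\<exists>G0\<in>X. moment_dist k d G G0 \<le> \<tau>\<^sup>2"
    proof (rule ccontr)
      assume "\<not> ?thesis"
      then have far: "\<And>G0. G0 \<in> X \<Longrightarrow> \<tau>\<^sup>2 < moment_dist k d G G0" by force
      then have far': "\<And>G0. G0 \<in> X \<Longrightarrow> \<tau>\<^sup>2 < moment_dist k d G0 G"
        by (simp only: moment_dist_commute[of k d G])
      have "G \<notin> X" using far[of G] \<tau> by (auto simp: moment_dist_self)
      moreover have "sep (insert G X)"
        using X(1) far far' G unfolding sep_def by auto
      ultimately show False using X(2)[of "insert G X"] X(1) by (simp add: sep_def)
    qed
  qed (use X in \<open>auto simp: sep_def\<close>)
qed

section \<open>Maximum likelihood on the net\<close>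

text \<open>With A^2 = \<open>cmp_const k R\<close> and F = 2k (2k)!, the additional factor is 2 A F
  from turning a Hellinger radius into a moment radius, times A from the separation \<epsilon> /
  A.\<close>

definition net_const :: "nat \<Rightarrow> real \<Rightarrow> real" where
  "net_const k R = pack_const k * (2 * cmp_const k R * (2 * k * fact (2 * k)))"

definition net_dim :: "nat \<Rightarrow> nat \<Rightarrow> nat" where
  "net_dim k d = 2 * k * d + (2 * k) ^ (2 * k)"

lemma pack_const_ge_1: 
  assumes "1 \<le> k" shows "1 \<le> pack_const k"
proof -
  have "1 \<le> (4 * real k + 2) ^ (2 * k)" by (rule one_le_power) simp
  then show ?thesis unfolding pack_const_def
    using mult_mono[of 1 "60 * real k" 1 "(4 * real k + 2) ^ (2 * k)"] assms by simp
qed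

lemma net_const_ge_1: "1 \<le> k \<Longrightarrow> 1 \<le> net_const k R"
proof -
  assume k: "1 \<le> k"
  have f: "1 \<le> real (2 * k) * fact (2 * k)"
    using mult_mono[of 1 "real (2 * k)" 1 "fact (2 * k)"] k by simp
  have "1 * (1 * 1) \<le> pack_const k * (2 * cmp_const k R * (2 * k * fact (2 * k)))"
    using k pack_const_ge_1[OF k] cmp_const_ge_1[of k R] f by (intro mult_mono) auto
  then show ?thesis by (simp add: net_const_def)
qed

lemma ln_fact_le: "ln (fact n) \<le> real n * real n"
proof (cases "n = 0")
  case False
  have "fact n \<le> (real n) ^ n" using fact_le_power[of n, where 'a = real] by simp
  then have "ln (fact n) \<le> ln (real n ^ n)" using False by (subst ln_le_cancel_iff) auto
  also have "\<dots> = real n * ln (real n)" using False by (simp add: ln_realpow)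
  also have "\<dots> \<le> real n * real n" using False ln_le_minus_one[of "real n"] by (intro mult_left_mono) auto
  finally show ?thesis .
qed simp

text \<open>The logarithm of the net constant is at most a multiple of k^2, dominated by ln (2k)!
  and 2k ln(4k + 2) under the crude bounds used. Times the dimension this is of order k^3 d +
  (2k)^(2k) k^2, which fits the rate.\<close>

lemma net_dim_bound:
  assumes k: "1 \<le> k"
  shows "net_dim k d * (1 + ln (net_const k R))
    \<le> (164 + 24 * R\<^sup>2) * (real k ^ 4 * d + (2 * real k) ^ (2 * k + 2))"
proof -
  have kr: "1 \<le> real k" using k by simp
  have k1: "real k \<le> real k ^ 2" "1 \<le> real k ^ 2"
    using kr by (auto simp: power2_eq_square mult_le_cancel_left1 intro: one_le_power mult_mono[of 1 "real k" 1 "real k", simplified])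
  have c0: "0 < cmp_const k R" using cmp_const_ge_1[of k R] by linarith
  have "ln (cmp_const k R) = 8 * R\<^sup>2 + 2 + 2 * k * ln (2 + 2 * R\<^sup>2)"
    unfolding cmp_const_def using add_pos_nonneg[of 2 "2 * R\<^sup>2"] by (simp add: ln_mult ln_realpow)
  also have "\<dots> \<le> 8 * R\<^sup>2 + 2 + 2 * k * (1 + 2 * R\<^sup>2)"
    using ln_le_minus_one[of "2 + 2 * R\<^sup>2"] add_pos_nonneg[of 2 "2 * R\<^sup>2"] by (intro add_left_mono mult_left_mono) auto
  finally have lnc: "ln (cmp_const k R) \<le> 8 * R\<^sup>2 + 2 + 2 * k * (1 + 2 * R\<^sup>2)" .
  have "ln (net_const k R) = ln 60 + ln k + 2 * k * ln (4 * real k + 2) + ln 2 + ln (cmp_const k R) + ln (2 * real k) + ln (fact (2 * k))"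
    unfolding net_const_def pack_const_def using k c0
    using ln_mult[of "2^2" "60::real"] ln_realpow[of 2 2] by (simp add: ln_mult ln_realpow)
  also have "\<dots> \<le> 59 + real k + 2 * k * (4 * real k + 1) + 1 + (8 * R\<^sup>2 + 2 + 2 * k * (1 + 2 * R\<^sup>2)) + 2 * real k + (2 * real k) * (2 * real k)"
  proof (intro add_mono)
    show "ln (60::real) \<le> 59" using ln_le_minus_one[of "60::real"] by simp
    show "ln (real k) \<le> real k" using ln_le_minus_one[of "real k"] k by simp
    show "2 * k * ln (4 * real k + 2) \<le> 2 * k * (4 * real k + 1)"
      using ln_le_minus_one[of "4 * real k + 2"] by (intro mult_left_mono) auto
    show "ln 2 \<le> (1::real)" using ln_le_minus_one[of "2::real"] by simp
    show "ln (cmp_const k R) \<le> 8 * R\<^sup>2 + 2 + 2 * k * (1 + 2 * R\<^sup>2)" by (rule lnc)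
    show "ln (2 * real k) \<le> 2 * real k" using ln_le_minus_one[of "2 * real k"] k by simp
    show "ln (fact (2 * k)) \<le> 2 * real k * (2 * real k)" using ln_fact_le[of "2 * k"] by simp
  qed
  finally have "1 + ln (net_const k R) \<le> 63 + 8 * R\<^sup>2 + 7 * real k + 12 * real k ^ 2 + 4 * (real k * R\<^sup>2)"
    by (simp add: power2_eq_square algebra_simps)
  also have "\<dots> \<le> 63 * real k ^ 2 + 8 * (real k ^ 2 * R\<^sup>2) + 7 * real k ^ 2 + 12 * real k ^ 2 + 4 * (real k ^ 2 * R\<^sup>2)"
    using k1 mult_right_mono[OF k1(1) zero_le_power2[of R]] mult_right_mono[OF k1(2) zero_le_power2[of R]] by linarith
  also have "\<dots> = (82 + 12 * R\<^sup>2) * real k ^ 2" by (simp add: algebra_simps)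
  finally have ln: "1 + ln (net_const k R) \<le> (82 + 12 * R\<^sup>2) * real k ^ 2" .
  have "net_dim k d * (1 + ln (net_const k R)) \<le> net_dim k d * ((82 + 12 * R\<^sup>2) * real k ^ 2)"
    using ln by (intro mult_left_mono) auto
  also have "\<dots> = (82 + 12 * R\<^sup>2) * (2 * (real k * real k ^ 2) * d + (2 * real k) ^ (2 * k) * real k ^ 2)"
    by (simp add: net_dim_def algebra_simps)
  also have "\<dots> \<le> (82 + 12 * R\<^sup>2) * (2 * real k ^ 4 * d + 2 * (2 * real k) ^ (2 * k + 2))"
  proof (intro mult_left_mono add_mono mult_right_mono)
    have "real k * real k ^ 2 = real k ^ 3" by (simp add: power3_eq_cube power2_eq_square)
    also have "\<dots> \<le> real k ^ 4" using kr by (intro power_increasing) auto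
    finally show "real k * real k ^ 2 \<le> real k ^ 4" .
    have "(2 * real k) ^ (2 * k) * real k ^ 2 \<le> (2 * real k) ^ (2 * k) * (2 * (2 * real k) ^ 2)"
      by (intro mult_left_mono) (auto simp: power_mult_distrib)
    then show "(2 * real k) ^ (2 * k) * real k ^ 2 \<le> 2 * (2 * real k) ^ (2 * k + 2)"
      by (simp add: power_add power2_eq_square)
  qed auto
  also have "\<dots> = (164 + 24 * R\<^sup>2) * (real k ^ 4 * d + (2 * real k) ^ (2 * k + 2))" by (simp add: algebra_simps)
  finally show ?thesis .
qed

text \<open>A geometric series starting at m = 1 with ratio x^2, where x = exp(- L) \<le> 1/2. The
  factor 2 in the exponent leaves room to absorb the series: x^2 / (1 - x^2) \<le> x.\<close>

lemma sum_exp_shells_le: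
  fixes L :: real
  assumes L: "ln 2 \<le> L" and "finite S" "0 \<notin> S"
  shows "(\<Sum>m\<in>S. exp (- (2 * L) * real m)) \<le> exp (- L)"
proof -
  define x where "x = exp (- L)"
  have "x \<le> exp (- ln 2)" using L by (simp add: x_def)
  also have "exp (- ln 2) = (1/2 :: real)" by (simp add: exp_minus)
  finally have x: "0 < x" "x \<le> 1 / 2" by (auto simp: x_def)
  have x2: "0 < x\<^sup>2" "x\<^sup>2 \<le> 1 / 4" using x power_mono[of x "1/2" 2] by (auto simp: power2_eq_square)
  have e: "exp (- (2 * L) * real m) = (x\<^sup>2) ^ m" for m
    by (simp add: x_def exp_of_nat_mult[symmetric] power2_eq_square exp_add[symmetric] mult_ac)
  have "(\<Sum>m\<in>S. exp (- (2 * L) * real m)) = (\<Sum>m\<in>S. x\<^sup>2 * (x\<^sup>2) ^ (m - 1))"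
    unfolding e using assms(3) by (intro sum.cong refl) (metis power_eq_if)
  also have "\<dots> = (\<Sum>m\<in>(\<lambda>m. m - 1) ` S. x\<^sup>2 * (x\<^sup>2) ^ m)"
    using assms(3) by (subst sum.reindex) (auto simp: inj_on_def, metis Suc_pred neq0_conv)
  also have "\<dots> \<le> (\<Sum>m. x\<^sup>2 * (x\<^sup>2) ^ m)"
    using assms(2) x2 by (intro sum_le_suminf summable_mult summable_geometric) auto
  also have "\<dots> = x\<^sup>2 * (1 / (1 - x\<^sup>2))"
    using x2 by (subst suminf_mult) (auto intro: summable_geometric simp: suminf_geometric)
  also have "\<dots> \<le> x"
  proof -
    have "x\<^sup>2 \<le> x * (1 - x\<^sup>2)"
    proof -
      have "x * x \<le> x * (1 / 2)" using x by (intro mult_left_mono) auto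
      also have "\<dots> \<le> x * (1 - x\<^sup>2)" using x x2 by (intro mult_left_mono) auto
      finally show ?thesis by (simp add: power2_eq_square)
    qed
    then show ?thesis using x2 by (simp add: divide_le_eq)
  qed
  finally show ?thesis by (simp add: x_def)
qed

text \<open>Peeling: within a shell all terms are bounded at its inner radius, their number by the
  ball of its outer radius. Shells start at index 1, since only points beyond \<open>t\<close>
  occur.\<close>

lemma sum_over_shells_le:
  fixes h :: "'a \<Rightarrow> real" and L t N :: real and B :: "nat \<Rightarrow> real"
  assumes X: "finite X" and t: "0 < t" and L: "ln 2 \<le> L"
    and count: "\<And>m::nat. 1 \<le> m \<Longrightarrow> card {q \<in> X. h q \<le> (m + 1) * t} \<le> B m"
    and decay: "\<And>m::nat. 1 \<le> m \<Longrightarrow> B m * exp (- N * (m * t)\<^sup>2) \<le> exp (- (2 * L) * m)"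
    and N: "0 \<le> N"
  shows "(\<Sum>q | q \<in> X \<and> t < h q. exp (- N * (h q)\<^sup>2)) \<le> exp (- L)"
proof -
  let ?S = "{q \<in> X. t < h q}"
  define \<mu> where "\<mu> q = nat \<lfloor>h q / t\<rfloor>" for q
  have \<mu>: "1 \<le> \<mu> q" "\<mu> q * t \<le> h q" "h q \<le> (\<mu> q + 1) * t" if "q \<in> ?S" for q
  proof -
    have "1 < h q / t" using that t by simp
    then have f: "1 \<le> \<lfloor>h q / t\<rfloor>" by linarith
    then show "1 \<le> \<mu> q" unfolding \<mu>_def by linarith
    have r: "real (\<mu> q) = of_int \<lfloor>h q / t\<rfloor>" using f by (simp add: \<mu>_def)
    have "real (\<mu> q) \<le> h q / t" "h q / t \<le> real (\<mu> q) + 1" unfolding r by linarith+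
    then show "\<mu> q * t \<le> h q" "h q \<le> (\<mu> q + 1) * t" using t by (simp_all add: field_simps)
  qed
  have "(\<Sum>q\<in>?S. exp (- N * (h q)\<^sup>2)) = (\<Sum>m\<in>\<mu> ` ?S. \<Sum>q | q \<in> ?S \<and> \<mu> q = m. exp (- N * (h q)\<^sup>2))"
    using X by (intro sum.image_gen) auto
  also have "\<dots> \<le> (\<Sum>m\<in>\<mu> ` ?S. exp (- (2 * L) * real m))"
  proof (rule sum_mono)
    fix m assume "m \<in> \<mu> ` ?S"
    then have m: "1 \<le> m" using \<mu>(1) by auto
    have "(\<Sum>q | q \<in> ?S \<and> \<mu> q = m. exp (- N * (h q)\<^sup>2)) \<le> (\<Sum>q | q \<in> ?S \<and> \<mu> q = m. exp (- N * (m * t)\<^sup>2))"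
    proof (rule sum_mono)
      fix q assume q: "q \<in> {q \<in> ?S. \<mu> q = m}"
      then have "(m * t)\<^sup>2 \<le> (h q)\<^sup>2" using \<mu>(2)[of q] t by (intro power_mono) auto
      then show "exp (- N * (h q)\<^sup>2) \<le> exp (- N * (m * t)\<^sup>2)" using N by (simp add: mult_left_mono)
    qed
    also have "\<dots> = card {q \<in> ?S. \<mu> q = m} * exp (- N * (m * t)\<^sup>2)" by simp
    also have "\<dots> \<le> B m * exp (- N * (m * t)\<^sup>2)"
    proof (rule mult_right_mono)
      have "card {q \<in> ?S. \<mu> q = m} \<le> card {q \<in> X. h q \<le> (m + 1) * t}"
        using X \<mu>(3) by (intro card_mono) auto
      then show "card {q \<in> ?S. \<mu> q = m} \<le> B m" using count[OF m] by linarith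
    qed simp
    also have "\<dots> \<le> exp (- (2 * L) * m)" by (rule decay[OF m])
    finally show "(\<Sum>q | q \<in> ?S \<and> \<mu> q = m. exp (- N * (h q)\<^sup>2)) \<le> exp (- (2 * L) * real m)" .
  qed
  also have "\<dots> \<le> exp (- L)"
    using X \<mu>(1) by (intro sum_exp_shells_le L) fastforce+
  finally show ?thesis by simp
qed

text \<open>The log of the count is at most linear in \<open>m\<close> up to constants, while the
  exponent is quadratic in \<open>m\<close> and in the radius factor \<open>100 * c\<close>. That
  factor is large enough: about 205 units are needed, and 100^2 / 8 = 1250 are available.\<close>

lemma shell_decay:
  fixes K c L \<Lambda> :: real and D m :: nat
  assumes K: "1 \<le> K" and c: "1 \<le> c" and \<Lambda>: "1 \<le> \<Lambda>" and L: "1 / 2 \<le> L" and m: "1 \<le> m"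
    and D: "D * (1 + ln K) \<le> c * \<Lambda>"
  shows "(K * ((real m + 1) * (100 * c * sqrt L))) ^ D * exp (- (\<Lambda> * (100 * c)\<^sup>2 * L * (real m)\<^sup>2 / 8)) \<le> exp (- (2 * L) * m)"
proof -
  define b where "b = K * ((real m + 1) * (100 * c * sqrt L))"
  \<comment> \<open>Collects the logarithms of m + 1, 100 c and sqrt L, each bounded by ln y \<le> y
    - 1.\<close>
  define x where "x = m + 100 * c + L"
  have b: "0 < b" using K c L by (simp add: b_def)
  have "ln b = ln K + ln (real m + 1) + ln (100 * c) + ln (sqrt L)"
    unfolding b_def using K c L by (simp add: ln_mult)
  also have "\<dots> \<le> ln K + real m + 100 * c + L"
  proof (intro add_mono)
    show "ln (real m + 1) \<le> real m" using ln_le_minus_one[of "real m + 1"] by simp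
    show "ln (100 * c) \<le> 100 * c" using ln_le_minus_one[of "100 * c"] c by simp
    show "ln (sqrt L) \<le> L" using ln_le_minus_one[of L] L by (simp add: ln_sqrt)
  qed simp
  finally have 1: "ln b \<le> ln K + x" by (simp add: x_def)
  have x: "1 \<le> x" using m c L by (simp add: x_def)
  have lm: "1 / 2 \<le> L * m" "L \<le> L * m" using m L mult_mono[of "1/2" L 1 "real m"] by auto
  have "1 * ln K \<le> x * ln K" using x K by (intro mult_right_mono) auto
  then have "ln K + x \<le> (1 + ln K) * x" by (simp add: algebra_simps)
  with 1 have "D * ln b \<le> D * ((1 + ln K) * x)" by (intro mult_left_mono) auto
  also have "\<dots> \<le> c * \<Lambda> * x" using D x by (simp add: mult.assoc[symmetric] mult_right_mono)
  \<comment> \<open>Since L \<ge> 1/2 and m \<ge> 1, the three summands of \<open>x\<close> cost at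
    most 2, 200 and 1 multiples of c L m.\<close>
  also have "\<dots> \<le> c * \<Lambda> * (203 * c * (L * m))"
  proof (rule mult_left_mono)
    have "real m \<le> 2 * (L * m)" using L m by simp
    moreover have "100 * c * 1 \<le> 100 * c * (2 * (L * m))" using lm c by (intro mult_left_mono) auto
    moreover have "1 * (L * m) \<le> c * (L * m)" using c L by (intro mult_right_mono) auto
    ultimately show "x \<le> 203 * c * (L * m)" using lm unfolding x_def by linarith
  qed (use c \<Lambda> in simp)
  finally have 2: "D * ln b \<le> 203 * (c\<^sup>2 * \<Lambda> * L * m)" by (simp add: power2_eq_square mult_ac)
  have 3: "1 * (L * m) \<le> (c\<^sup>2 * \<Lambda>) * (L * m)"
    using c \<Lambda> L mult_mono[of 1 "c\<^sup>2" 1 \<Lambda>] by (intro mult_right_mono) (auto simp: one_le_power)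
  define V where "V = c\<^sup>2 * \<Lambda> * L * (real m)\<^sup>2"
  have 4: "c\<^sup>2 * \<Lambda> * L * real m \<le> V"
    unfolding V_def using c \<Lambda> L m by (intro mult_left_mono) (auto simp: power2_eq_square)
  have "0 \<le> V" unfolding V_def using c \<Lambda> L by simp
  moreover have "L * real m \<le> c\<^sup>2 * \<Lambda> * L * real m" using 3 by (simp add: mult.assoc)
  ultimately have "D * ln b + 2 * (L * m) \<le> 1250 * V" using 2 4 by linarith
  also have "1250 * V = \<Lambda> * (100 * c)\<^sup>2 * L * (real m)\<^sup>2 / 8"
    by (simp add: V_def power_mult_distrib)
  finally have "exp (D * ln b + - (\<Lambda> * (100 * c)\<^sup>2 * L * (real m)\<^sup>2 / 8)) \<le> exp (- (2 * L) * m)" by simp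
  also have "exp (D * ln b + - (\<Lambda> * (100 * c)\<^sup>2 * L * (real m)\<^sup>2 / 8)) = b ^ D * exp (- (\<Lambda> * (100 * c)\<^sup>2 * L * (real m)\<^sup>2 / 8))"
    unfolding exp_add exp_of_nat_mult using b by simp
  finally show ?thesis by (simp only: b_def)
qed

text \<open>A Hellinger ball of radius \<open>r\<close> lies in a moment ball whose radius is
  proportional to \<open>r\<close>, so the local packing bound applies to it.\<close>

lemma hellinger_ball_card_le:
  assumes X: "finite X" "X \<subseteq> Gkd k d R" and G0: "G0 \<in> Gkd k d R"
    and R: "0 \<le> R" and k: "1 \<le> k" and d: "1 \<le> d" and \<epsilon>: "0 < \<epsilon>" "\<epsilon> \<le> r"
    and sep: "\<And>G G'. G \<in> X \<Longrightarrow> G' \<in> X \<Longrightarrow> G \<noteq> G' \<Longrightarrow> (\<epsilon> / sqrt (cmp_const k R))\<^sup>2 < moment_dist k d G G'"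
  shows "card {G \<in> X. hdist k d G0 G \<le> r} \<le> (net_const k R * r / \<epsilon>) ^ net_dim k d"
proof -
  define A where "A = sqrt (cmp_const k R)"
  define F where "F = 2 * real k * fact (2 * k)"
  have A: "1 \<le> A" "A\<^sup>2 = cmp_const k R" using cmp_const_ge_1[of k R] by (auto simp: A_def)
  have F: "1 \<le> F"
    using mult_mono[of 1 "2 * real k" 1 "fact (2 * k)"] k by (simp add: F_def)
  define s where "s = 2 * A * F * r"
  have r: "0 < r" using \<epsilon> by simp
  have \<tau>s: "\<epsilon> / A \<le> s"
  proof -
    have "\<epsilon> / A \<le> \<epsilon>" using A \<epsilon> by (simp add: divide_le_eq mult_le_cancel_left1)
    also have "\<epsilon> \<le> 1 * r" using \<epsilon> by simp
    also have "\<dots> \<le> 2 * A * F * r"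
      using A F r mult_mono[of 1 A 1 F] by (intro mult_right_mono) auto
    finally show ?thesis by (simp add: s_def)
  qed
  have near: "moment_dist k d G G0 \<le> s\<^sup>2" if "G \<in> {G \<in> X. hdist k d G0 G \<le> r}" for G
  proof -
    have G: "G \<in> Gkd k d R" using that X by auto
    have "moment_dist k d G0 G \<le> 4 * cmp_const k R * (2 * k * fact (2 * k))\<^sup>2 * (hdist k d G0 G)\<^sup>2"
      using R k by (intro moment_dist_le_hellinger[OF G0 G]) auto
    also have "\<dots> \<le> 4 * cmp_const k R * (2 * k * fact (2 * k))\<^sup>2 * r\<^sup>2"
      using that cmp_const_ge_1[of k R] hellinger_PGamma_nonneg[OF G0 G] by (intro mult_left_mono power_mono) auto
    also have "\<dots> = s\<^sup>2" by (simp add: s_def F_def power_mult_distrib A(2)[symmetric])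
    finally show ?thesis by (simp add: moment_dist_commute)
  qed
  have "card {G \<in> X. hdist k d G0 G \<le> r} \<le> (pack_const k * s / (\<epsilon> / A)) ^ (2 * k * d + (2 * k) ^ (2 * k))"
    by (rule separated_card_le[OF _ k d _ \<tau>s near]) (use X \<epsilon> A sep in \<open>auto simp: A_def[symmetric]\<close>)
  also have "pack_const k * s / (\<epsilon> / A) = net_const k R * r / \<epsilon>"
    by (simp add: s_def net_const_def A(2)[symmetric] F_def power2_eq_square)
  finally show ?thesis by (simp add: net_dim_def)
qed

text \<open>The factor 164 + 24 R^2 is that of \<open>net_dim_bound\<close>, and 100 is the radius
  factor of \<open>shell_decay\<close>. The summand 2 pays for the step from the nearest net point
  to the truth: \<epsilon> \<le> 2 \<epsilon> sqrt L.\<close>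

definition est_const :: "real \<Rightarrow> real" where
  "est_const R = 100 * (164 + 24 * R\<^sup>2) + 2"

definition rate :: "nat \<Rightarrow> nat \<Rightarrow> real" where
  "rate k d = real k ^ 4 * real d + (2 * real k) ^ (2 * k + 2)"

lemma rate_ge_1: "1 \<le> k \<Longrightarrow> 1 \<le> rate k d"
proof -
  assume "1 \<le> k"
  then have "1 \<le> (2 * real k) ^ (2 * k + 2)" by (intro one_le_power) simp
  moreover have "0 \<le> real k ^ 4 * real d" by simp
  ultimately show ?thesis unfolding rate_def by linarith
qed

text \<open>Maximum likelihood over a finite separated net: the net is fine enough in \<open>\<chi>\<^sup>2\<close>-divergence for
  likelihood ratios of net points to be informative, and its Hellinger balls contain few points.\<close>
lemma net_mle:
  assumes R: "0 < R" and k: "1 \<le> k" and d: "1 \<le> d" and n: "1 \<le> n"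
  obtains X sel where "finite X" "X \<subseteq> Gkd k d R" "sel \<in> measurable (PiM {..<n} (\<lambda>_. Rd d)) (count_space X)"
    and "\<And>Y. sel Y \<in> X"
    and "\<And>G L. G \<in> Gkd k d R \<Longrightarrow> ln 2 \<le> L \<Longrightarrow>
      measure (sample n (PGamma k d G)) {Y \<in> space (PiM {..<n} (\<lambda>_. Rd d)).
        est_const R * sqrt (rate k d / real n * L) < hdist k d (sel Y) G} \<le> exp (- L)"
proof -
  let ?M = "PiM {..<n} (\<lambda>_. Rd d)"
  \<comment> \<open>The scale at which n \<epsilon>^2 equals the rate, balancing the exponent of a
    test against the log-cardinality of a shell.\<close>
  define \<epsilon> where "\<epsilon> = sqrt (rate k d / real n)"
  have \<Lambda>: "1 \<le> rate k d" using rate_ge_1[OF k] .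
  have \<epsilon>: "0 < \<epsilon>" "real n * \<epsilon>\<^sup>2 = rate k d" using \<Lambda> n by (auto simp: \<epsilon>_def)
  define A where "A = sqrt (cmp_const k R)"
  have A: "1 \<le> A" "A\<^sup>2 = cmp_const k R" using cmp_const_ge_1[of k R] by (auto simp: A_def)
  have "0 < \<epsilon> / A" using \<epsilon> A by simp
  then obtain X where X: "finite X" "X \<subseteq> Gkd k d R"
    and sep: "\<And>G G'. G \<in> X \<Longrightarrow> G' \<in> X \<Longrightarrow> G \<noteq> G' \<Longrightarrow> (\<epsilon> / A)\<^sup>2 < moment_dist k d G G'"
    and net: "\<And>G. G \<in> Gkd k d R \<Longrightarrow> \<exists>G0\<in>X. moment_dist k d G G0 \<le> (\<epsilon> / A)\<^sup>2"
    using finite_net[OF less_imp_le[OF R] k d] by metis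
  have "(\<lambda>j. if j = 0 then 1 else 0, \<lambda>_ _. 0) \<in> Gkd k d R"
    using R k by (auto simp: Gkd_def enorm_def sum.delta)
  then have Xne: "X \<noteq> {}" using net by blast
  obtain sel where sel: "sel \<in> measurable ?M (count_space X)" "\<And>Y. sel Y \<in> X"
    and mle: "\<And>Y G. G \<in> X \<Longrightarrow> - (\<Prod>s<n. mixd k d (sel Y) (Y s)) \<le> - (\<Prod>s<n. mixd k d G (Y s))"
  proof (rule measurable_argmin[OF X(1) Xne, of "\<lambda>G Y. - (\<Prod>s<n. mixd k d G (Y s))" ?M])
    show "(\<lambda>Y. - (\<Prod>s<n. mixd k d G (Y s))) \<in> borel_measurable ?M" for G by measurable
  qed auto
  show thesis
  proof (rule that[OF X sel])
    fix G L assume G: "G \<in> Gkd k d R" and L: "ln 2 \<le> (L :: real)"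
    have Lh: "1 / 2 \<le> L" using L ln2_ge_two_thirds by linarith
    obtain G0 where G0: "G0 \<in> X" "moment_dist k d G G0 \<le> (\<epsilon> / A)\<^sup>2" using net[OF G] by blast
    then have G0': "G0 \<in> Gkd k d R" using X by blast
    have chi: "cmp_const k R * moment_dist k d G G0 \<le> \<epsilon>\<^sup>2"
    proof -
      have "A\<^sup>2 * moment_dist k d G G0 \<le> A\<^sup>2 * (\<epsilon> / A)\<^sup>2" using G0(2) by (intro mult_left_mono) auto
      then show ?thesis using A(1) by (simp add: power_divide A(2)[symmetric])
    qed
    let ?S = "sample n (PGamma k d G)"
    let ?bad = "{Y \<in> space ?M. est_const R * sqrt (rate k d / real n * L) < hdist k d (sel Y) G}"
    define h where "h G1 = hdist k d G0 G1" for G1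
    define c where "c = 164 + 24 * R\<^sup>2"
    \<comment> \<open>Radius of the innermost shell. It is at least 4 \<epsilon>, so for a net point
      beyond it the chi^2 cost \<epsilon>^2 is below h^2 / 8, as the test requires.\<close>
    define t where "t = 100 * c * (\<epsilon> * sqrt L)"
    have c: "1 \<le> c" by (simp add: c_def)
    have sL: "1 / 2 \<le> sqrt L" by (rule real_le_rsqrt) (use Lh in \<open>simp add: power2_eq_square\<close>)
    have cL: "1 * (1 / 2) \<le> c * sqrt L" using c sL by (intro mult_mono) auto
    have "\<epsilon> * 4 \<le> \<epsilon> * (100 * (c * sqrt L))" using \<epsilon> cL by (intro mult_left_mono) auto
    then have t4: "4 * \<epsilon> \<le> t" by (simp add: t_def mult_ac)
    then have t: "0 < t" using \<epsilon> by simp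
    interpret S: prob_space ?S
      by (intro prob_space_sample prob_space_PGamma[OF G])
    define E where "E G1 = {Y \<in> space ?M. (\<Prod>s<n. mixd k d G0 (Y s)) \<le> (\<Prod>s<n. mixd k d G1 (Y s))}" for G1
    have Em: "E G1 \<in> sets ?M" for G1 unfolding E_def by measurable
    \<comment> \<open>The maximizer is at least as likely as \<open>G0\<close>. If it is far from
      the truth it is far from \<open>G0\<close>, so some test of \<open>G0\<close> against a far
      net point fails.\<close>
    have sub: "?bad
      \<subseteq> (\<Union>G1\<in>{G1 \<in> X. t < h G1}. E G1)"
    proof
      fix Y assume Y: "Y \<in> ?bad"
      have sX: "sel Y \<in> X" "sel Y \<in> Gkd k d R" using sel(2)[of Y] X by auto
      have "hdist k d (sel Y) G \<le> h (sel Y) + hdist k d G G0"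
        using hellinger_PGamma_triangle[OF G G0' sX(2)] hellinger_PGamma_commute[OF G sX(2)] by (simp add: h_def)
      moreover have "hdist k d G G0 \<le> \<epsilon>"
        by (rule power2_le_imp_le[OF order_trans[OF hellinger_le_moment_dist[OF G G0' less_imp_le[OF R]] chi] less_imp_le[OF \<epsilon>(1)]])
      moreover have "\<epsilon> \<le> 2 * (\<epsilon> * sqrt L)" using sL \<epsilon> by simp
      moreover have "est_const R * sqrt (rate k d / real n * L) = t + 2 * (\<epsilon> * sqrt L)"
        unfolding est_const_def t_def \<epsilon>_def c_def real_sqrt_mult by (simp add: algebra_simps)
      ultimately have "t < h (sel Y)" using Y by auto
      moreover have "Y \<in> E (sel Y)" using mle[OF G0(1), of Y] Y by (simp add: E_def)
      ultimately show "Y \<in> (\<Union>G1\<in>{G1 \<in> X. t < h G1}. E G1)" using sX by blast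
    qed
    have "measure ?S ?bad
      \<le> measure ?S (\<Union>G1\<in>{G1 \<in> X. t < h G1}. E G1)"
      using X(1) Em by (intro S.finite_measure_mono[OF sub]) (auto simp: sets_sample_PGamma)
    also have "\<dots> \<le> (\<Sum>G1\<in>{G1 \<in> X. t < h G1}. measure ?S (E G1))"
      using X(1) Em by (intro S.finite_measure_subadditive_finite) (auto simp: sets_sample_PGamma)
    also have "\<dots> \<le> (\<Sum>G1\<in>{G1 \<in> X. t < h G1}. exp (- (real n / 8) * (h G1)\<^sup>2))"
    proof (rule sum_mono)
      fix G1 assume G1: "G1 \<in> {G1 \<in> X. t < h G1}"
      then have G1': "G1 \<in> Gkd k d R" using X by blast
      have "(4 * \<epsilon>)\<^sup>2 \<le> (h G1)\<^sup>2" using G1 t4 \<epsilon> by (intro power_mono) auto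
      then have "16 * \<epsilon>\<^sup>2 \<le> (h G1)\<^sup>2" by (simp add: power_mult_distrib)
      then have "cmp_const k R * moment_dist k d G G0 \<le> (h G1)\<^sup>2 / 8" using chi zero_le_power2[of \<epsilon>] by linarith
      from likelihood_ratio_test_error[OF G G0' G1' less_imp_le[OF R] this[unfolded h_def]]
      show "measure ?S (E G1) \<le> exp (- (real n / 8) * (h G1)\<^sup>2)"
        by (simp add: E_def h_def)
    qed
    also have "\<dots> \<le> exp (- L)"
    proof (rule sum_over_shells_le[OF X(1) t L])
      fix m :: nat assume m: "1 \<le> m"
      have "1 * \<epsilon> \<le> (real m + 1) * (4 * \<epsilon>)" using \<epsilon> by (intro mult_mono) auto
      also have "\<dots> \<le> (real m + 1) * t" using t4 by (intro mult_left_mono) auto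
      finally have er: "\<epsilon> \<le> real (m + 1) * t" by (simp add: add.commute)
      show "card {G1 \<in> X. h G1 \<le> real (m + 1) * t} \<le> (net_const k R * (real (m + 1) * t) / \<epsilon>) ^ net_dim k d"
        unfolding h_def
        by (rule hellinger_ball_card_le[OF X G0' less_imp_le[OF R] k d \<epsilon>(1) er sep[unfolded A_def]])
      \<comment> \<open>The scale \<epsilon> cancels between radius and separation, so the count in
        each shell does not grow with \<open>n\<close>.\<close>
      have e1: "net_const k R * (real (m + 1) * t) / \<epsilon> = net_const k R * ((real m + 1) * (100 * c * sqrt L))"
        using \<epsilon> by (simp add: t_def field_simps)
      have e2: "- (real n / 8) * (m * t)\<^sup>2 = - (rate k d * (100 * c)\<^sup>2 * L * (real m)\<^sup>2 / 8)"
        using Lh by (simp add: t_def power_mult_distrib \<epsilon>(2)[symmetric])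
      show "(net_const k R * (real (m + 1) * t) / \<epsilon>) ^ net_dim k d * exp (- (real n / 8) * (m * t)\<^sup>2) \<le> exp (- (2 * L) * m)"
        unfolding e1 e2
        by (rule shell_decay[OF net_const_ge_1[OF k] c \<Lambda> Lh m])
          (use net_dim_bound[OF k, of d R] in \<open>simp add: c_def rate_def\<close>)
    qed simp
    finally show "measure ?S ?bad \<le> exp (- L)" .
  qed
qed

text \<open>A discrete layer-cake formula on multiples of \<open>b\<close>: the first layer costs b,
  the others at most b / 2 in total. The bound \<open>B\<close> makes the number of layers
  finite.\<close>

lemma nn_integral_le_of_tails:
  fixes f :: "'a \<Rightarrow> real"
  assumes "prob_space M" and f[measurable]: "f \<in> borel_measurable M" and f0: "\<And>x. 0 \<le> f x" "\<And>x. f x \<le> B" and b: "0 < b"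
    and tail: "\<And>m. Suc 0 \<le> m \<Longrightarrow> measure M {x \<in> space M. b * m < f x} \<le> exp (- (2 * ln 2) * m)"
  shows "(\<integral>\<^sup>+x. ennreal (f x) \<partial>M) \<le> ennreal (3 / 2 * b)"
proof -
  interpret prob_space M by fact
  define N where "N = nat \<lceil>B / b\<rceil>"
  let ?T = "\<lambda>m::nat. {x \<in> space M. b * m < f x}"
  have pt: "f x \<le> b + (\<Sum>m\<in>{1..N}. b * indicator (?T m) x)" if x: "x \<in> space M" for x
  proof -
    \<comment> \<open>The number of positive integers strictly below f x / b, matching the strict
      inequality in the tail events.\<close>
    define j where "j = nat (\<lceil>f x / b\<rceil> - 1)"
    have fb: "0 \<le> f x / b" using f0 b by simp
    have "f x / b \<le> B / b" using f0(2)[of x] b by (simp add: divide_right_mono)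
    then have jN: "j \<le> N" unfolding j_def N_def by linarith
    have j1: "f x / b \<le> real j + 1" unfolding j_def by linarith
    have "(\<Sum>m\<in>{1..j}. b) \<le> (\<Sum>m\<in>{1..N}. b * indicator (?T m) x)"
    proof -
      have "(\<Sum>m\<in>{1..j}. b) = (\<Sum>m\<in>{1..j}. b * indicator (?T m) x)"
      proof (rule sum.cong[OF refl])
        fix m assume m: "m \<in> {1..j}"
        then have "real m < f x / b" unfolding j_def by (simp, linarith)
        then have "b * m < f x" using b by (simp add: field_simps)
        then show "b = b * indicator (?T m) x" using x by simp
      qed
      also have "\<dots> \<le> (\<Sum>m\<in>{1..N}. b * indicator (?T m) x)"
        using jN b by (intro sum_mono2) auto
      finally show ?thesis .
    qed
    moreover have "f x \<le> b + real j * b" using j1 b by (simp add: field_simps)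
    ultimately show ?thesis by simp
  qed
  have i: "integrable M f" using f0 by (intro integrable_const_bound[of _ B]) auto
  have ii: "integrable M (\<lambda>x. b * indicator (?T m) x)" for m
    by (intro integrable_mult_right integrable_real_indicator) (auto simp: emeasure_eq_measure)
  then have Is: "integrable M (\<lambda>x. \<Sum>m\<in>{1..N}. b * indicator (?T m) x)"
    by (intro Bochner_Integration.integrable_sum)
  have "(\<integral>x. f x \<partial>M) \<le> (\<integral>x. b + (\<Sum>m\<in>{1..N}. b * indicator (?T m) x) \<partial>M)"
    using i Is pt by (intro integral_mono Bochner_Integration.integrable_add) auto
  also have "\<dots> = (\<integral>x. b \<partial>M) + (\<integral>x. (\<Sum>m\<in>{1..N}. b * indicator (?T m) x) \<partial>M)"
    by (rule Bochner_Integration.integral_add[OF _ Is]) simp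
  also have "(\<integral>x. (\<Sum>m\<in>{1..N}. b * indicator (?T m) x) \<partial>M) = (\<Sum>m\<in>{1..N}. \<integral>x. b * indicator (?T m) x \<partial>M)"
    by (rule Bochner_Integration.integral_sum) (rule ii)
  also have "\<dots> = (\<Sum>m\<in>{1..N}. b * measure M (?T m))" by (intro sum.cong) (auto simp: Int_def conj_commute)
  also have "(\<integral>x. b \<partial>M) = b" by (simp add: prob_space)
  also have "b + (\<Sum>m\<in>{1..N}. b * measure M (?T m)) \<le> b + (\<Sum>m\<in>{1..N}. b * exp (- (2 * ln 2) * real m))"
    using b tail by (intro add_left_mono sum_mono mult_left_mono) auto
  also have "\<dots> = b + b * (\<Sum>m\<in>{1..N}. exp (- (2 * ln 2) * real m))" by (simp add: sum_distrib_left)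
  also have "\<dots> \<le> b + b * exp (- ln 2)"
    using b by (intro add_left_mono mult_left_mono sum_exp_shells_le) auto
  also have "exp (- ln 2) = (1/2 :: real)" by (simp add: exp_minus)
  finally show ?thesis using i f0 by (simp add: nn_integral_eq_integral ennreal_leI)
qed

text \<open>The tail bound is integrated; sqrt(d / n) is extracted by rate(k, d) \<le> d * rate(k,
  1), which moves the whole dependence on k into the constant.\<close>

lemma minimax_risk_upper:
  assumes R: "0 < R" and k: "1 \<le> k" and d: "1 \<le> d" and n: "1 \<le> n"
  shows "minimax_risk k d R n \<le> ennreal (3 * est_const R * sqrt (rate k 1) * min (sqrt (real d / real n)) 1)"
proof -
  let ?M = "PiM {..<n} (\<lambda>_. Rd d)"
  define C where "C = 3 * est_const R * sqrt (rate k 1)"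
  have est: "100 \<le> est_const R" by (simp add: est_const_def)
  \<comment> \<open>The Hellinger distance is at most 2 in the bound below, so this constant also
    covers the branch 1 of the minimum.\<close>
  have C: "2 \<le> C"
  proof -
    have "3 * 100 * 1 \<le> 3 * est_const R * sqrt (rate k 1)"
      using est rate_ge_1[OF k, of 1] by (intro mult_mono) auto
    then show ?thesis by (simp add: C_def)
  qed
  obtain X sel where X: "finite X" "X \<subseteq> Gkd k d R" and sel[measurable]: "sel \<in> measurable ?M (count_space X)"
    and selX: "\<And>Y. sel Y \<in> X"
    and tail: "\<And>G L. G \<in> Gkd k d R \<Longrightarrow> ln 2 \<le> L \<Longrightarrow>
      measure (sample n (PGamma k d G)) {Y \<in> space ?M.
        est_const R * sqrt (rate k d / real n * L) < hdist k d (sel Y) G} \<le> exp (- L)"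
    using net_mle[OF R k d n] by blast
  have est_mem: "(\<lambda>Y. PGamma k d (sel Y)) \<in> estimators d n"
    unfolding estimators_def
  proof (rule measurable_compose[OF sel])
    show "PGamma k d \<in> measurable (count_space X) (prob_algebra (Rd d))"
      using X by (auto simp: space_prob_algebra intro: prob_space_PGamma)
  qed
  have "(\<integral>\<^sup>+Y. ennreal (hdist k d (sel Y) G) \<partial>sample n (PGamma k d G)) \<le> ennreal (C * min (sqrt (real d / real n)) 1)"
    if G: "G \<in> Gkd k d R" for G
  proof -
    let ?S = "sample n (PGamma k d G)" and ?h = "\<lambda>Y. hdist k d (sel Y) G"
    interpret S: prob_space ?S by (intro prob_space_sample prob_space_PGamma[OF G])
    have selG: "sel Y \<in> Gkd k d R" for Y using selX X by blast
    \<comment> \<open>The selection has values in a finite discrete space, so every real function of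
      it is measurable.\<close>
    have hm: "?h \<in> borel_measurable ?S"
    proof -
      have "(\<lambda>G'. hdist k d G' G) \<in> borel_measurable (count_space X)" by simp
      from measurable_compose[OF sel this] show ?thesis
        by (simp add: measurable_cong_sets[OF sets_sample_PGamma refl])
    qed
    have h0: "0 \<le> ?h Y" for Y by (rule hellinger_PGamma_nonneg[OF selG G])
    have h2: "?h Y \<le> 2" for Y
      by (rule power2_le_imp_le) (use hellinger_sq_le_2[OF selG G, of Y] in auto)
    \<comment> \<open>Taking L = (2m)^2 in the tail bound gives the threshold b m; L \<ge> ln 2
      already holds for m = 1, and the tail is smaller than the exponential one required.\<close>
    define b where "b = 2 * est_const R * sqrt (rate k d / real n)"
    have b: "0 < b" using est rate_ge_1[OF k, of d] n unfolding b_def by (intro mult_pos_pos) auto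
    have "(\<integral>\<^sup>+Y. ennreal (?h Y) \<partial>?S) \<le> ennreal (3 / 2 * b)"
    proof (rule nn_integral_le_of_tails[OF S.prob_space_axioms hm h0 h2 b])
      fix m assume m: "Suc 0 \<le> m"
      have m2: "ln 2 * real m \<le> 2 * (real m)\<^sup>2"
        using m ln_le_minus_one[of "2::real"] by (intro mult_mono[of "ln 2" "2 * real m" "real m" "real m", THEN order_trans]) (auto simp: power2_eq_square)
      have "ln 2 \<le> (2 * real m)\<^sup>2"
        using ln_le_minus_one[of "2::real"] m one_le_power[of "2 * real m" 2] by simp
      note tail[OF G this]
      also have "est_const R * sqrt (rate k d / real n * (2 * real m)\<^sup>2) = b * m"
        unfolding real_sqrt_mult real_sqrt_abs by (simp add: b_def)
      also have "exp (- (2 * real m)\<^sup>2) \<le> exp (- (2 * ln 2) * m)" using m2 by (simp add: power_mult_distrib mult.commute)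
      finally show "measure ?S {Y \<in> space ?S. b * m < ?h Y} \<le> exp (- (2 * ln 2) * m)"
        by (simp add: space_sample_PGamma)
    qed
    also have "3 / 2 * b \<le> C * sqrt (real d / real n)"
    proof -
      have "rate k d \<le> rate k 1 * d"
      proof -
        define c where "c = (2 * real k) ^ (2 * k + 2)"
        have "c * 1 \<le> c * d" using d by (intro mult_left_mono) (auto simp: c_def)
        then show ?thesis unfolding rate_def c_def[symmetric] by (simp add: algebra_simps)
      qed
      then have "sqrt (rate k d / real n) \<le> sqrt (rate k 1 * (real d / real n))"
        by (simp add: divide_right_mono)
      then have sq: "sqrt (rate k d / real n) \<le> sqrt (rate k 1) * sqrt (real d / real n)"
        unfolding real_sqrt_mult .
      have "3 * est_const R * sqrt (rate k d / real n) \<le> 3 * est_const R * (sqrt (rate k 1) * sqrt (real d / real n))"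
        by (rule mult_left_mono[OF sq]) (use est in simp)
      then show ?thesis by (simp add: b_def C_def)
    qed
    finally have 1: "(\<integral>\<^sup>+Y. ennreal (?h Y) \<partial>?S) \<le> ennreal (C * sqrt (real d / real n))"
      by (simp add: ennreal_leI)
    have "(\<integral>\<^sup>+Y. ennreal (?h Y) \<partial>?S) \<le> (\<integral>\<^sup>+Y. ennreal C \<partial>?S)"
      using h2 C by (intro nn_integral_mono ennreal_leI) (rule order_trans)
    also have "\<dots> = ennreal C" by (simp add: S.emeasure_space_1)
    finally show ?thesis using 1 by (simp add: min_def)
  qed
  then show ?thesis
    unfolding minimax_risk_def C_def[symmetric]
    by (intro INF_lower2[OF est_mem] SUP_least)
qed

text \<open>The tail bound at L = ln(1 / \<delta>); \<delta> < 1/2 ensures L \<ge> ln 2.\<close>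

lemma mle_high_probability:
  assumes R: "0 < R" and k: "1 \<le> k" and d: "1 \<le> d" and n: "1 \<le> n"
  shows "\<exists>W Mu. (\<forall>j<k. (\<lambda>X. W X j) \<in> borel_measurable (PiM {..<n} (\<lambda>_. Rd d))) \<and>
     (\<forall>j<k. \<forall>i<d. (\<lambda>X. Mu X j i) \<in> borel_measurable (PiM {..<n} (\<lambda>_. Rd d))) \<and>
     (\<forall>X \<in> space (PiM {..<n} (\<lambda>_. Rd d)). (W X, Mu X) \<in> Gkd k d R) \<and>
     (\<forall>G\<in>Gkd k d R. \<forall>\<delta>::real. 0 < \<delta> \<longrightarrow> \<delta> < 1/2 \<longrightarrow>
        measure (sample n (PGamma k d G))
          {X \<in> space (sample n (PGamma k d G)).
             hellinger (PGamma k d (W X, Mu X)) (PGamma k d G)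
               \<le> est_const R * sqrt ((real k ^ 4 * real d + (2 * real k) ^ (2 * k + 2)) / real n * ln (1 / \<delta>))}
          \<ge> 1 - \<delta>)"
proof -
  let ?M = "PiM {..<n} (\<lambda>_. Rd d)"
  obtain X sel where X: "finite X" "X \<subseteq> Gkd k d R" and sel[measurable]: "sel \<in> measurable ?M (count_space X)"
    and selX: "\<And>Y. sel Y \<in> X"
    and tail: "\<And>G L. G \<in> Gkd k d R \<Longrightarrow> ln 2 \<le> L \<Longrightarrow>
      measure (sample n (PGamma k d G)) {Y \<in> space ?M.
        est_const R * sqrt (rate k d / real n * L) < hdist k d (sel Y) G} \<le> exp (- L)"
    using net_mle[OF R k d n] by blast
  have bm: "(\<lambda>Y. f (sel Y)) \<in> borel_measurable ?M" for f :: "_ \<Rightarrow> real"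
    by (rule measurable_compose[OF sel]) simp
  show ?thesis
  proof (intro exI[of _ "\<lambda>Y. fst (sel Y)"] exI[of _ "\<lambda>Y. snd (sel Y)"] conjI allI impI ballI)
    show "(\<lambda>Y. fst (sel Y) j) \<in> borel_measurable ?M" for j by (rule bm[of "\<lambda>G. fst G j"])
    show "(\<lambda>Y. snd (sel Y) j i) \<in> borel_measurable ?M" for j i by (rule bm[of "\<lambda>G. snd G j i"])
    show "(fst (sel Y), snd (sel Y)) \<in> Gkd k d R" for Y using selX X by auto
    fix G \<delta> assume G: "G \<in> Gkd k d R" and \<delta>: "0 < \<delta>" "\<delta> < (1/2 :: real)"
    let ?S = "sample n (PGamma k d G)" and ?h = "\<lambda>Y. hdist k d (sel Y) G"
    let ?c = "est_const R * sqrt (rate k d / real n * ln (1 / \<delta>))"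
    interpret S: prob_space ?S by (intro prob_space_sample prob_space_PGamma[OF G])
    have "2 \<le> 1 / \<delta>" using \<delta> by (simp add: field_simps)
    then have L: "ln 2 \<le> ln (1 / \<delta>)" using \<delta> by simp
    have "?h \<in> borel_measurable ?M" by (rule bm)
    then have hm[measurable]: "?h \<in> borel_measurable ?S"
      by (simp add: measurable_cong_sets[OF sets_sample_PGamma refl])
    have "1 - \<delta> \<le> 1 - measure ?S {Y \<in> space ?S. ?c < ?h Y}"
      using tail[OF G L] \<delta> by (simp add: space_sample_PGamma exp_minus)
    also have "\<dots> = measure ?S (space ?S - {Y \<in> space ?S. ?c < ?h Y})"
      by (rule S.prob_compl[symmetric]) measurable
    also have "space ?S - {Y \<in> space ?S. ?c < ?h Y} = {Y \<in> space ?S. ?h Y \<le> ?c}" by auto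
    finally show "1 - \<delta> \<le> measure ?S {Y \<in> space ?S. hellinger (PGamma k d (fst (sel Y), snd (sel Y))) (PGamma k d G)
       \<le> est_const R * sqrt ((real k ^ 4 * real d + (2 * real k) ^ (2 * k + 2)) / real n * ln (1 / \<delta>))}"
      by (simp add: rate_def)
  qed
qed

section \<open>Lower bound\<close>

text \<open>Each further factor p / q moves the mean by m - u once more, and the exponents 1 + 2 +
  ... + j accumulate. All moments of the Gaussian likelihood ratio are thereby explicit.\<close>

lemma gd_power_ratio:
  "gd d m x ^ Suc j / gd d u x ^ j
    = exp (real j * (real j + 1) / 2 * ip d (\<lambda>i. m i - u i) (\<lambda>i. m i - u i)) * gd d (\<lambda>i. u i + (real j + 1) * (m i - u i)) x"
proof (induction j)
  case (Suc j)
  let ?D = "ip d (\<lambda>i. m i - u i) (\<lambda>i. m i - u i)"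
  let ?v = "\<lambda>i. u i + (real j + 1) * (m i - u i)"
  have "gd d m x ^ Suc (Suc j) / gd d u x ^ Suc j = (gd d m x ^ Suc j / gd d u x ^ j) * (gd d m x / gd d u x)"
    by (simp add: mult_ac)
  also have "\<dots> = exp (real j * (real j + 1) / 2 * ?D) * (gd d ?v x * gd d m x / gd d u x)"
    unfolding Suc by simp
  also have "gd d ?v x * gd d m x / gd d u x = exp ((real j + 1) * ?D) * gd d (\<lambda>i. ?v i + m i - u i) x"
    unfolding gd_mult_divide using ip_scale_left[of d "real j + 1" "\<lambda>i. m i - u i" "\<lambda>i. m i - u i"] by simp
  also have "(\<lambda>i. ?v i + m i - u i) = (\<lambda>i. u i + (real (Suc j) + 1) * (m i - u i))"
    by (rule ext) (simp add: algebra_simps)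
  also have "exp (real j * (real j + 1) / 2 * ?D) * (exp ((real j + 1) * ?D) * gd d (\<lambda>i. u i + (real (Suc j) + 1) * (m i - u i)) x)
    = exp (real (Suc j) * (real (Suc j) + 1) / 2 * ?D) * gd d (\<lambda>i. u i + (real (Suc j) + 1) * (m i - u i)) x"
    by (simp add: exp_add[symmetric] mult.assoc[symmetric]) (simp add: field_simps)
  finally show ?case .
qed simp

lemma
  shows integrable_gd_power_ratio: "integrable (Rd d) (\<lambda>x. gd d m x ^ Suc j / gd d u x ^ j)"
    and integral_gd_power_ratio: "(\<integral>x. gd d m x ^ Suc j / gd d u x ^ j \<partial>Rd d)
      = exp (real j * (real j + 1) / 2 * ip d (\<lambda>i. m i - u i) (\<lambda>i. m i - u i))"
  unfolding gd_power_ratio by (auto intro: integrable_gd simp: integral_gd)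

text \<open>\<open>\<bar>Y\<bar> \<ge> \<lambda> Y\<^sup>2 - \<lambda>\<^sup>3 Y\<^sup>4\<close> for the likelihood ratio minus one turns second and fourth moments into a
  lower bound for the total variation distance.\<close>
lemma total_variation_gd_ge:
  assumes D: "ip d (\<lambda>i. m i - u i) (\<lambda>i. m i - u i) \<le> 1 / 4"
  defines "A \<equiv> {x \<in> space (Rd d). gd d u x < gd d m x}"
  shows "sqrt (ip d (\<lambda>i. m i - u i) (\<lambda>i. m i - u i)) / 64
    \<le> measure (density (Rd d) (gd d m)) A - measure (density (Rd d) (gd d u)) A"
proof -
  let ?p = "gd d m" and ?q = "gd d u"
  define D where "D = ip d (\<lambda>i. m i - u i) (\<lambda>i. m i - u i)"
  define s where "s = exp D"
  have D0: "0 \<le> D" "D \<le> 1 / 4" using assms ip_self_nonneg by (auto simp: D_def)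
  have [measurable]: "A \<in> sets (Rd d)" unfolding A_def by measurable
  have ip: "integrable (Rd d) ?p" "integrable (Rd d) ?q" by (rule integrable_gd)+
  have "measure (density (Rd d) ?p) A - measure (density (Rd d) ?q) A
      = (\<integral>x. indicator A x * ?p x \<partial>Rd d) - (\<integral>x. indicator A x * ?q x \<partial>Rd d)"
    by (simp add: measure_density_real gd_nonneg)
  also have "\<dots> = (\<integral>x. indicator A x * ?p x - indicator A x * ?q x \<partial>Rd d)"
    using ip by (intro Bochner_Integration.integral_diff[symmetric]) (auto simp: mult.commute[of "indicator A _"] intro: integrable_real_mult_indicator)
  also have "\<dots> = (\<integral>x. \<bar>?p x - ?q x\<bar> / 2 + (?p x - ?q x) / 2 \<partial>Rd d)"
    by (intro Bochner_Integration.integral_cong refl) (auto simp: A_def indicator_def field_simps)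
  also have "\<dots> = (\<integral>x. \<bar>?p x - ?q x\<bar> \<partial>Rd d) / 2"
    using ip by (simp add: integral_gd)
  finally have tv: "measure (density (Rd d) ?p) A - measure (density (Rd d) ?q) A = (\<integral>x. \<bar>?p x - ?q x\<bar> \<partial>Rd d) / 2" .
  show ?thesis
  proof (cases "D = 0")
    case True
    then show ?thesis unfolding tv D_def[symmetric] by simp
  next
    case False
    define y where "y = s - 1"
    have "1 + D \<le> s" unfolding s_def by (rule exp_ge_add_one_self)
    then have y: "0 < y" "D \<le> y" using False D0 by (auto simp: y_def)
    have s2: "1 \<le> s" "s \<le> 2"
    proof -
      have "exp D \<le> 1 + D + D\<^sup>2" using D0 by (intro exp_bound) auto
      also have "\<dots> \<le> 1 + 1 / 4 + (1 / 4)\<^sup>2" using D0 by (intro add_mono power_mono) auto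
      finally show "s \<le> 2" by (simp add: s_def power2_eq_square)
    qed (use D0 in \<open>simp add: s_def\<close>)
    \<comment> \<open>With this l the second-moment term is sqrt y / 16 and the bound on the
      fourth-moment term is half of it.\<close>
    define l where "l = 1 / (16 * sqrt y)"
    have l: "0 < l" using y by (simp add: l_def)
    let ?r = "\<lambda>j x. ?p x ^ Suc j / ?q x ^ j"
    \<comment> \<open>The expansion of q (l Y^2 - l^3 Y^4) for Y = p / q - 1 in powers of the
      likelihood ratio.\<close>
    let ?U = "\<lambda>x. l * (?r 1 x - 2 * ?p x + ?q x) - l ^ 3 * (?r 3 x - 4 * ?r 2 x + 6 * ?r 1 x - 4 * ?p x + ?q x)"
    have pt: "?U x \<le> \<bar>?p x - ?q x\<bar>" for x
    proof -
      define q where "q = ?q x"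
      define Y where "Y = ?p x / q - 1"
      have q: "0 < q" by (simp add: q_def gd_pos)
      have p: "?p x = q * (Y + 1)" using q by (simp add: Y_def)
      have c: "l * Y\<^sup>2 - l ^ 3 * Y ^ 4 \<le> \<bar>Y\<bar>"
      proof -
        define v where "v = l * \<bar>Y\<bar>"
        have v: "0 \<le> v" using l by (simp add: v_def)
        have "0 \<le> 1 - v + v ^ 3"
        proof (cases "v \<le> 1")
          case True then show ?thesis using v by (simp add: add_nonneg_nonneg)
        next
          case False
          then have "v ^ 1 \<le> v ^ 3" by (intro power_increasing) auto
          then show ?thesis by simp
        qed
        then have "0 \<le> \<bar>Y\<bar> * (1 - v + v ^ 3)" by simp
        also have "\<dots> = \<bar>Y\<bar> - l * \<bar>Y\<bar>\<^sup>2 + l ^ 3 * \<bar>Y\<bar> ^ 4"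
          by (simp add: v_def power2_eq_square power3_eq_cube power4_eq_xxxx algebra_simps)
        finally show ?thesis by simp
      qed
      have "?U x = q * (l * Y\<^sup>2 - l ^ 3 * Y ^ 4)"
        unfolding p q_def[symmetric] using q
        by (simp add: field_simps power2_eq_square power3_eq_cube power4_eq_xxxx eval_nat_numeral)
      also have "\<dots> \<le> q * \<bar>Y\<bar>" using c q by (intro mult_left_mono) auto
      also have "\<dots> = \<bar>?p x - ?q x\<bar>" using q by (simp add: p q_def[symmetric] abs_mult algebra_simps flip: abs_mult_pos)
      finally show ?thesis .
    qed
    have I: "integrable (Rd d) (?r j)" "(\<integral>x. ?r j x \<partial>Rd d) = exp (real j * (real j + 1) / 2 * D)" for j
      unfolding D_def by (rule integrable_gd_power_ratio integral_gd_power_ratio)+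
    have e: "exp (real 1 * (real 1 + 1) / 2 * D) = s" "exp (real 2 * (real 2 + 1) / 2 * D) = s ^ 3" "exp (real 3 * (real 3 + 1) / 2 * D) = s ^ 6"
      by (simp_all add: s_def exp_of_nat_mult[symmetric])
    have iU: "integrable (Rd d) ?U"
      by (intro Bochner_Integration.integrable_diff Bochner_Integration.integrable_add integrable_mult_right I ip)
    have "(\<integral>x. ?U x \<partial>Rd d) = l * (s - 2 + 1) - l ^ 3 * (s ^ 6 - 4 * s ^ 3 + 6 * s - 4 + 1)"
    proof -
      have "(\<integral>x. l * (a x - 2 * ?p x + ?q x) - l ^ 3 * (c x - 4 * b x + 6 * a x - 4 * ?p x + ?q x) \<partial>Rd d)
        = l * ((\<integral>x. a x \<partial>Rd d) - 2 + 1) - l ^ 3 * ((\<integral>x. c x \<partial>Rd d) - 4 * (\<integral>x. b x \<partial>Rd d) + 6 * (\<integral>x. a x \<partial>Rd d) - 4 + 1)"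
        if "integrable (Rd d) a" "integrable (Rd d) b" "integrable (Rd d) c" for a b c
        using that ip by (simp add: integral_gd)
      from this[OF I(1) I(1) I(1), of 1 3 2] show ?thesis unfolding I(2) e .
    qed
    \<comment> \<open>The fourth moment s^6 - 4 s^3 + 6 s - 3 has the double root s = 1, so it is of
      order y^2, the square of the second moment.\<close>
    also have "\<dots> = l * y - l ^ 3 * y\<^sup>2 * (s ^ 4 + 2 * s ^ 3 + 3 * s ^ 2 - 3)"
      by (simp add: y_def algebra_simps power2_eq_square power3_eq_cube eval_nat_numeral)
    also have "\<dots> \<ge> l * y - l ^ 3 * y\<^sup>2 * 128"
    proof -
      have "s ^ 4 \<le> 2 ^ 4" "s ^ 3 \<le> 2 ^ 3" "s ^ 2 \<le> 2 ^ 2" using s2 by (intro power_mono; simp)+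
      then show ?thesis using l by (intro diff_left_mono mult_left_mono) auto
    qed
    also (xtrans) have "l * y - l ^ 3 * y\<^sup>2 * 128 = sqrt y / 32"
    proof -
      define z where "z = sqrt y"
      have "0 < z" "y = z\<^sup>2" using y by (auto simp: z_def)
      then show ?thesis unfolding l_def z_def[symmetric]
        by (simp add: power2_eq_square power3_eq_cube field_simps)
    qed
    finally have "sqrt y / 32 \<le> (\<integral>x. ?U x \<partial>Rd d)" by simp
    also have "\<dots> \<le> (\<integral>x. \<bar>?p x - ?q x\<bar> \<partial>Rd d)"
      using iU ip pt by (intro integral_mono) auto
    finally have "sqrt D / 32 \<le> (\<integral>x. \<bar>?p x - ?q x\<bar> \<partial>Rd d)"
      using y by (smt (verit) divide_right_mono real_sqrt_le_iff)
    then show ?thesis unfolding tv D_def[symmetric] by simp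
  qed
qed

lemma sample_density:
  fixes g :: "'a \<Rightarrow> real"
  assumes P: "prob_space P" and g[measurable]: "g \<in> borel_measurable P" and g0: "\<And>x. 0 \<le> g x"
    and P': "prob_space (density P g)"
  shows "sample n (density P g) = density (sample n P) (\<lambda>X. \<Prod>s<n. g (X s))"
proof -
  interpret P: prob_space P by fact
  interpret P': prob_space "density P g" by fact
  interpret prodP: product_sigma_finite "\<lambda>_::nat. P" by standard
  interpret prodP': product_sigma_finite "\<lambda>_::nat. density P g" by standard
  have "density (sample n P) (\<lambda>X. \<Prod>s<n. g (X s)) = PiM {..<n} (\<lambda>_. density P g)"
  proof (rule prodP'.PiM_eqI)
    show "sets (density (sample n P) (\<lambda>X. \<Prod>s<n. g (X s))) = sets (PiM {..<n} (\<lambda>_. density P g))"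
      unfolding sets_density sample_def by (rule sets_PiM_cong) auto
    fix A assume A: "\<And>i. i \<in> {..<n} \<Longrightarrow> A i \<in> sets (density P g)"
    then have A': "\<And>i. i < n \<Longrightarrow> A i \<in> sets P" by auto
    have Am: "Pi\<^sub>E {..<n} A \<in> sets (sample n P)" unfolding sample_def using A' by (intro sets_PiM_I_finite) auto
    have "emeasure (density (sample n P) (\<lambda>X. \<Prod>s<n. g (X s))) (Pi\<^sub>E {..<n} A)
      = (\<integral>\<^sup>+X. ennreal (\<Prod>s<n. g (X s)) * indicator (Pi\<^sub>E {..<n} A) X \<partial>sample n P)"
      using Am by (intro emeasure_density) (auto simp: sample_def)
    also have "\<dots> = (\<integral>\<^sup>+X. (\<Prod>s<n. ennreal (g (X s)) * indicator (A s) (X s)) \<partial>sample n P)"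
    proof (rule nn_integral_cong)
      fix X assume "X \<in> space (sample n P)"
      then have "X \<in> extensional {..<n}" by (auto simp: sample_def space_PiM PiE_iff)
      then have "indicator (Pi\<^sub>E {..<n} A) X = (\<Prod>s<n. indicator (A s) (X s) :: ennreal)"
        by (auto simp: indicator_def PiE_iff prod_zero_iff split: if_splits intro!: prod.neutral[symmetric])
      then show "ennreal (\<Prod>s<n. g (X s)) * indicator (Pi\<^sub>E {..<n} A) X = (\<Prod>s<n. ennreal (g (X s)) * indicator (A s) (X s))"
        using g0 by (simp add: prod.distrib prod_ennreal)
    qed
    also have "\<dots> = (\<Prod>s<n. \<integral>\<^sup>+x. ennreal (g x) * indicator (A s) x \<partial>P)"
      unfolding sample_def using A' by (intro prodP.product_nn_integral_prod) auto
    also have "\<dots> = (\<Prod>s<n. emeasure (density P g) (A s))"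
      using A' by (intro prod.cong refl) (simp add: emeasure_density)
    finally show "emeasure (density (sample n P) (\<lambda>X. \<Prod>s<n. g (X s))) (Pi\<^sub>E {..<n} A) = (\<Prod>s<n. emeasure (density P g) (A s))" .
  qed simp
  then show ?thesis by (simp add: sample_def)
qed

text \<open>From z \<le> z^2 + 1/4 at z = G - 1, the difference is at most the chi^2-divergence of
  the samples plus 1/4. That divergence is exp(n D) - 1, with D the squared distance of the
  means.\<close>

lemma sample_prob_diff_le:
  assumes P: "P = density (Rd d) (gd d u)" and P': "P' = density (Rd d) (gd d m)"
    and D: "real n * ip d (\<lambda>i. m i - u i) (\<lambda>i. m i - u i) \<le> 1 / 16"
    and B: "B \<in> sets (PiM {..<n} (\<lambda>_. Rd d))"
  shows "measure (sample n P') B - measure (sample n P) B \<le> 1 / 2"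
proof -
  let ?D = "ip d (\<lambda>i. m i - u i) (\<lambda>i. m i - u i)"
  have prob: "prob_space (density (Rd d) (gd d v))" for v
    by (rule prob_spaceI)
      (simp add: emeasure_density nn_integral_eq_integral integrable_gd integral_gd gd_nonneg nn_integral_set_ennreal[symmetric])
  interpret P: prob_space P unfolding P by (rule prob)
  have setsP: "sets P = sets (Rd d)" by (simp add: P)
  define g where "g x = gd d m x / gd d u x" for x
  have [measurable]: "g \<in> borel_measurable (Rd d)" unfolding g_def[abs_def] by measurable
  then have gm[measurable]: "g \<in> borel_measurable P" by (simp add: P)
  have g0: "0 \<le> g x" for x by (simp add: g_def gd_nonneg)
  have dg: "density P g = P'"
  proof -
    have "density P g = density (Rd d) (\<lambda>x. ennreal (gd d u x) * ennreal (g x))"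
      unfolding P by (rule density_density_eq) auto
    also have "(\<lambda>x. ennreal (gd d u x) * ennreal (g x)) = (\<lambda>x. ennreal (gd d m x))"
    proof
      fix x show "ennreal (gd d u x) * ennreal (g x) = ennreal (gd d m x)"
        using gd_pos[of d u x] g0 by (subst ennreal_mult[symmetric]) (auto simp: g_def less_imp_le)
    qed
    finally show ?thesis by (simp add: P')
  qed
  define G where "G X = (\<Prod>s<n. g (X s))" for X
  interpret S: prob_space "sample n P" by (intro prob_space_sample P.prob_space_axioms)
  have SG: "sample n P' = density (sample n P) G"
    unfolding dg[symmetric] G_def using prob[of m] by (intro sample_density P.prob_space_axioms gm g0) (simp add: dg P')
  have setsS: "sets (sample n P) = sets (PiM {..<n} (\<lambda>_. Rd d))"
    unfolding sample_def by (intro sets_PiM_cong) (auto simp: setsP)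
  have Gm[measurable]: "G \<in> borel_measurable (sample n P)" unfolding G_def[abs_def] sample_def by measurable
  have G0: "0 \<le> G X" for X unfolding G_def by (intro prod_nonneg) (simp add: g0)
  have gj: "(\<integral>\<^sup>+x. ennreal (g x ^ Suc j) \<partial>P) = ennreal (exp (real j * (real j + 1) / 2 * ?D))" for j
  proof -
    have "(\<integral>\<^sup>+x. ennreal (g x ^ Suc j) \<partial>P) = (\<integral>\<^sup>+x. ennreal (gd d u x) * ennreal (g x ^ Suc j) \<partial>Rd d)"
      unfolding P by (rule nn_integral_density) auto
    also have "\<dots> = (\<integral>\<^sup>+x. ennreal (gd d m x ^ Suc j / gd d u x ^ j) \<partial>Rd d)"
    proof (rule nn_integral_cong)
      fix x
      have "gd d u x * g x ^ Suc j = gd d m x ^ Suc j / gd d u x ^ j"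
        using gd_pos[of d u x] by (simp add: g_def power_divide)
      then show "ennreal (gd d u x) * ennreal (g x ^ Suc j) = ennreal (gd d m x ^ Suc j / gd d u x ^ j)"
        using gd_nonneg g0 by (metis ennreal_mult zero_le_power)
    qed
    also have "\<dots> = ennreal (\<integral>x. gd d m x ^ Suc j / gd d u x ^ j \<partial>Rd d)"
      using integrable_gd_power_ratio by (intro nn_integral_eq_integral) (auto intro!: AE_I2 divide_nonneg_nonneg zero_le_power mult_nonneg_nonneg gd_nonneg)
    finally show ?thesis by (simp only: integral_gd_power_ratio)
  qed
  have Gj: "has_bochner_integral (sample n P) (\<lambda>X. G X ^ Suc j) (exp (real j * (real j + 1) / 2 * ?D) ^ n)" for j
  proof (rule has_bochner_integral_nn_integral)
    have "(\<integral>\<^sup>+X. ennreal (G X ^ Suc j) \<partial>sample n P) = (\<integral>\<^sup>+X. (\<Prod>s<n. ennreal (g (X s) ^ Suc j)) \<partial>sample n P)"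
      unfolding G_def prod_power_distrib using g0 by (intro nn_integral_cong prod_ennreal[symmetric]) (auto simp del: power_Suc)
    also have "\<dots> = (\<integral>\<^sup>+x. ennreal (g x ^ Suc j) \<partial>P) ^ n"
      by (rule nn_integral_sample_prod[OF P.prob_space_axioms]) measurable
    finally show "(\<integral>\<^sup>+X. ennreal (G X ^ Suc j) \<partial>sample n P) = ennreal (exp (real j * (real j + 1) / 2 * ?D) ^ n)"
      unfolding gj by (simp add: ennreal_power)
  qed (use G0 in \<open>auto intro!: AE_I2 mult_nonneg_nonneg zero_le_power\<close>)
  have B': "B \<in> sets (sample n P)" using B setsS by simp
  have i1: "integrable (sample n P) G" "(\<integral>X. G X \<partial>sample n P) = 1"
    using Gj[of 0] by (auto simp: has_bochner_integral_iff)
  have i2: "integrable (sample n P) (\<lambda>X. G X ^ 2)" "(\<integral>X. G X ^ 2 \<partial>sample n P) = exp ?D ^ n"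
    using Gj[of 1] by (auto simp: has_bochner_integral_iff eval_nat_numeral)
  have iB: "integrable (sample n P) (indicator B :: _ \<Rightarrow> real)" using B' by (simp add: S.emeasure_eq_measure)
  have "measure (sample n P') B - measure (sample n P) B = (\<integral>X. indicator B X * G X \<partial>sample n P) - (\<integral>X. indicator B X \<partial>sample n P)"
    unfolding SG using B' G0 by (simp add: measure_density_real)
  also have "\<dots> = (\<integral>X. indicator B X * G X - indicator B X \<partial>sample n P)"
    using i1 B' iB by (intro Bochner_Integration.integral_diff[symmetric]) (auto simp: mult.commute[of "indicator B _"] intro: integrable_real_mult_indicator)
  also have "\<dots> \<le> (\<integral>X. G X ^ 2 - 2 * G X + 5 / 4 \<partial>sample n P)"
  proof (rule integral_mono)
    fix X
    have "0 \<le> (G X - 1)\<^sup>2" "0 \<le> (G X - 3 / 2)\<^sup>2" by simp_all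
    then show "indicator B X * G X - indicator B X \<le> G X ^ 2 - 2 * G X + 5 / 4"
      by (auto simp: indicator_def power2_eq_square algebra_simps)
  qed (use i1 i2 iB B' in \<open>auto simp: mult.commute[of "indicator B _"] intro!: integrable_real_mult_indicator Bochner_Integration.integrable_diff\<close>)
  also have "\<dots> = exp ?D ^ n - 3 / 4" using i1 i2 by (simp add: S.prob_space)
  also have "\<dots> \<le> 1 / 2"
  proof -
    define x where "x = real n * ?D"
    have x: "0 \<le> x" "x \<le> 1 / 16" using D ip_self_nonneg by (auto simp: x_def)
    have "exp ?D ^ n = exp x" by (simp add: x_def exp_of_nat_mult)
    also have "\<dots> \<le> 1 + x + x\<^sup>2" using x by (intro exp_bound) auto
    also have "\<dots> \<le> 1 + 1 / 16 + (1 / 16)\<^sup>2" using x by (intro add_mono power_mono) auto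
    finally show ?thesis by (simp add: power2_eq_square)
  qed
  finally show ?thesis .
qed

section \<open>Assouad's cube\<close>

definition cube_point :: "real \<Rightarrow> nat set \<Rightarrow> nat \<Rightarrow> real" where
  "cube_point a S i = (if i \<in> S then a else 0)"

text \<open>The atoms of weight zero are also placed at \<open>m\<close>, because the norm
  constraint of the class applies to every atom.\<close>

definition dirac_mix :: "(nat \<Rightarrow> real) \<Rightarrow> mixing" where
  "dirac_mix m = (\<lambda>j. if j = 0 then 1 else 0, \<lambda>_. m)"

lemma mixd_dirac_mix: "1 \<le> k \<Longrightarrow> mixd k d (dirac_mix m) = gd d m"
  by (rule ext) (simp add: mixd_def dirac_mix_def if_distrib[of "\<lambda>c. c * _"] cong: if_cong)

lemma dirac_mix_in_Gkd: "1 \<le> k \<Longrightarrow> enorm d m \<le> R \<Longrightarrow> dirac_mix m \<in> Gkd k d R"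
  by (auto simp: Gkd_def dirac_mix_def)

lemma PGamma_dirac_mix: "1 \<le> k \<Longrightarrow> PGamma k d (dirac_mix m) = density (Rd d) (gd d m)"
  by (simp add: PGamma_eq mixd_dirac_mix)

lemma ip_cube_diff:
  assumes "S \<subseteq> {..<d}" "T \<subseteq> {..<d}"
  shows "ip d (\<lambda>i. cube_point a S i - cube_point a T i) (\<lambda>i. cube_point a S i - cube_point a T i) = a\<^sup>2 * card (sym_diff S T)"
proof -
  have "ip d (\<lambda>i. cube_point a S i - cube_point a T i) (\<lambda>i. cube_point a S i - cube_point a T i)
    = (\<Sum>i<d. if i \<in> sym_diff S T then a\<^sup>2 else 0)"
    unfolding ip_def cube_point_def by (intro sum.cong) (auto simp: power2_eq_square)
  also have "\<dots> = (\<Sum>i\<in>sym_diff S T. a\<^sup>2)"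
  proof -
    have "{..<d} \<inter> sym_diff S T = sym_diff S T" using assms by auto
    then show ?thesis using sum.inter_restrict[of "{..<d}" "\<lambda>_. a\<^sup>2" "sym_diff S T"] by simp
  qed
  finally show ?thesis by simp
qed

text \<open>Assouad's argument.  Distances to the estimate are measured through finitely many Scheffe sets,
  since the Hellinger distance of a random measure is not visibly measurable.\<close>
lemma minimax_risk_lower:
  assumes R: "0 < R" and k: "1 \<le> k" and d: "1 \<le> d" and n: "1 \<le> n"
  shows "ennreal (min R 1 / 2048 * min (sqrt (real d / real n)) 1) \<le> minimax_risk k d R n"
proof -
  let ?M = "PiM {..<n} (\<lambda>_. Rd d)"
  \<comment> \<open>The side of the cube. Its diagonal a sqrt d stays within the ball and in the
    range of the total variation bound, while a sqrt n \<le> 1/4 keeps adjacent vertices hard to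
    distinguish.\<close>
  define a where "a = min R 1 / 4 * min (1 / sqrt n) (1 / sqrt d)"
  have a: "0 < a" using R n d by (simp add: a_def)
  have a_le: "a * sqrt d \<le> min R 1 / 4" "a * sqrt n \<le> 1 / 4"
  proof -
    have "a * sqrt d \<le> (min R 1 / 4 * (1 / sqrt d)) * sqrt d"
      unfolding a_def using R by (intro mult_right_mono mult_left_mono) auto
    then show "a * sqrt d \<le> min R 1 / 4" using d by simp
    have "a * sqrt n \<le> (1 / 4 * (1 / sqrt n)) * sqrt n"
      unfolding a_def using R by (intro mult_right_mono mult_mono) auto
    then show "a * sqrt n \<le> 1 / 4" using n by simp
  qed
  have a_eq: "a * sqrt d = min R 1 / 4 * min (sqrt (real d / real n)) 1"
  proof -
    have "min (1 / sqrt n) (1 / sqrt d) * sqrt d = min (1 / sqrt n * sqrt d) (1 / sqrt d * sqrt d)"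
      by (rule min_mult_distrib_right[THEN trans]) simp
    then show ?thesis using d unfolding a_def by (simp add: real_sqrt_divide mult.assoc)
  qed
  have aa: "a\<^sup>2 * d \<le> 1 / 4" "real n * a\<^sup>2 \<le> 1 / 16"
  proof -
    have "(a * sqrt d)\<^sup>2 \<le> (1 / 4)\<^sup>2" using a a_le(1) R by (intro power_mono) auto
    then have "a\<^sup>2 * d \<le> 1 / 16" by (simp add: power_mult_distrib power_divide)
    then show "a\<^sup>2 * d \<le> 1 / 4" by linarith
    have "(a * sqrt n)\<^sup>2 \<le> (1 / 4)\<^sup>2" using a a_le(2) by (intro power_mono) auto
    then show "real n * a\<^sup>2 \<le> 1 / 16" by (simp add: power_mult_distrib power_divide mult.commute)
  qed
  let ?C = "Pow {..<d}"
  define G where "G S = dirac_mix (cube_point a S)" for S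
  define P where "P S = PGamma k d (G S)" for S
  have Peq: "P S = density (Rd d) (gd d (cube_point a S))" for S
    by (simp add: P_def G_def PGamma_dirac_mix[OF k])
  have G: "G S \<in> Gkd k d R" if "S \<in> ?C" for S
    unfolding G_def
  proof (rule dirac_mix_in_Gkd[OF k])
    have "(\<Sum>i<d. (cube_point a S i)\<^sup>2) \<le> (\<Sum>i<d. a\<^sup>2)" by (intro sum_mono) (simp add: cube_point_def)
    then have "enorm d (cube_point a S) \<le> sqrt (a\<^sup>2 * d)" by (simp add: enorm_def mult.commute)
    also have "\<dots> = a * sqrt d" using a by (simp add: real_sqrt_mult)
    also have "\<dots> \<le> R" using a_le(1) R by simp
    finally show "enorm d (cube_point a S) \<le> R" .
  qed
  have prob: "prob_space (P S)" if "S \<in> ?C" for S using G[OF that] unfolding P_def by (rule prob_space_PGamma)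
  define A where "A = (\<lambda>(S, T). {x \<in> space (Rd d). gd d (cube_point a T) x < gd d (cube_point a S) x})"
  have A: "A p \<in> sets (Rd d)" for p unfolding A_def by (cases p) simp
  show ?thesis
    unfolding minimax_risk_def
  proof (rule INF_greatest)
    fix Ph assume Ph: "Ph \<in> estimators d n"
    then have Ph_m: "Ph \<in> measurable ?M (subprob_algebra (Rd d))"
      unfolding estimators_def by (rule measurable_prob_algebraD)
    have Ph_prob: "prob_space (Ph X)" "sets (Ph X) = sets (Rd d)" if "X \<in> space ?M" for X
      using measurable_space[OF Ph[unfolded estimators_def] that] by (auto simp: space_prob_algebra)
    define D where "D S X = Max ((\<lambda>p. \<bar>measure (Ph X) (A p) - measure (P S) (A p)\<bar>) ` (?C \<times> ?C))" for S X
    have D_m: "D S \<in> borel_measurable ?M" for S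
      unfolding D_def[abs_def]
    proof (rule borel_measurable_Max)
      fix p
      have "(\<lambda>X. measure (Ph X) (A p)) \<in> borel_measurable ?M"
        by (rule measurable_compose[OF Ph_m measurable_measure_subprob_algebra[OF A]])
      then show "(\<lambda>X. \<bar>measure (Ph X) (A p) - measure (P S) (A p)\<bar>) \<in> borel_measurable ?M" by measurable
    qed simp
    have D_ge: "\<bar>measure (Ph X) (A p) - measure (P S) (A p)\<bar> \<le> D S X" if "p \<in> ?C \<times> ?C" for S X p
      unfolding D_def using that by (intro Max_ge) auto
    have D_le: "D S X \<le> hellinger (Ph X) (P S)" if S: "S \<in> ?C" and X: "X \<in> space ?M" for S X
      unfolding D_def
    proof (rule Max.boundedI)
      fix r assume "r \<in> (\<lambda>p. \<bar>measure (Ph X) (A p) - measure (P S) (A p)\<bar>) ` (?C \<times> ?C)"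
      then obtain p where "r = \<bar>measure (Ph X) (A p) - measure (P S) (A p)\<bar>" by blast
      then show "r \<le> hellinger (Ph X) (P S)"
        using total_variation_le_hellinger[OF Ph_prob(1)[OF X] prob[OF S], of "A p"] Ph_prob(2)[OF X] A[of p]
        by (simp add: P_def)
    qed auto
    \<comment> \<open>Replacing the estimate by its closest vertex turns it into a decision about
      each coordinate.\<close>
    obtain sel where sel: "sel \<in> measurable ?M (count_space ?C)" and selC: "\<And>X. sel X \<in> ?C"
      and sel_min: "\<And>X S. S \<in> ?C \<Longrightarrow> D (sel X) X \<le> D S X"
    proof (rule measurable_argmin[of ?C D ?M])
      show "?C \<noteq> {}" by blast
    qed (use D_m in auto)
    \<comment> \<open>The triangle inequality on the Scheffe set of \<open>S\<close> and the
      selected vertex, with the latter minimal, costs a factor 2. As c \<le> d gives sqrt c \<ge> c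
      / sqrt d, the bound becomes linear in the number of wrong coordinates and can be
      summed.\<close>
    have D_lower: "a / (128 * sqrt d) * card (sym_diff S (sel X)) \<le> D S X" if S: "S \<in> ?C" for S X
    proof -
      define T where "T = sel X"
      have T: "T \<in> ?C" using selC by (simp add: T_def)
      define c where "c = card (sym_diff S T)"
      have cd: "c \<le> d"
        using card_mono[of "{..<d}" "sym_diff S T"] S T by (auto simp: c_def)
      have ipc: "ip d (\<lambda>i. cube_point a S i - cube_point a T i) (\<lambda>i. cube_point a S i - cube_point a T i) = a\<^sup>2 * c"
        unfolding c_def using S T by (intro ip_cube_diff) auto
      have "a\<^sup>2 * c \<le> a\<^sup>2 * d" using cd by (intro mult_left_mono) auto
      then have ip4: "a\<^sup>2 * c \<le> 1 / 4" using aa(1) by linarith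
      have "a / sqrt d * c = a * (c / sqrt d)" by simp
      also have "\<dots> \<le> a * sqrt c"
      proof (rule mult_left_mono)
        have "sqrt c * sqrt c \<le> sqrt c * sqrt d" using cd by (intro mult_left_mono) auto
        then show "c / sqrt d \<le> sqrt c" using d by (simp add: divide_le_eq)
      qed (use a in simp)
      also have "\<dots> = sqrt (a\<^sup>2 * c)" using a by (simp add: real_sqrt_mult)
      also have "\<dots> / 64 \<le> measure (P S) (A (S, T)) - measure (P T) (A (S, T))"
        using total_variation_gd_ge[of d "cube_point a S" "cube_point a T"] ip4
        unfolding ipc Peq A_def by simp
      also have "\<dots> \<le> \<bar>measure (Ph X) (A (S, T)) - measure (P S) (A (S, T))\<bar> + \<bar>measure (Ph X) (A (S, T)) - measure (P T) (A (S, T))\<bar>"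
        by linarith
      also have "\<dots> \<le> D S X + D T X" using S T by (intro add_mono D_ge) auto
      also have "\<dots> \<le> 2 * D S X" using sel_min[OF S, of X] by (simp add: T_def)
      finally show ?thesis by (simp add: c_def T_def)
    qed
    define B where "B i = {X \<in> space ?M. i \<in> sel X}" for i
    have Bm: "B i \<in> sets ?M" for i
    proof -
      have "sel -` {S \<in> ?C. i \<in> S} \<inter> space ?M \<in> sets ?M" by (rule measurable_sets[OF sel]) auto
      also have "sel -` {S \<in> ?C. i \<in> S} \<inter> space ?M = B i" using selC by (auto simp: B_def)
      finally show ?thesis .
    qed
    \<comment> \<open>The event that coordinate \<open>i\<close> is decided wrongly when
      \<open>S\<close> is the true vertex.\<close>
    define E where "E S i = (if i \<in> S then space ?M - B i else B i)" for S i
    have Em: "E S i \<in> sets ?M" for S i using Bm by (simp add: E_def)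
    define e where "e S i = measure (sample n (P S)) (E S i)" for S i
    have probS: "prob_space (sample n (P S))" if "S \<in> ?C" for S
      using prob[OF that] by (rule prob_space_sample)
    have setsS: "sets (sample n (P S)) = sets ?M" for S unfolding P_def by (rule sets_sample_PGamma)
    have spaceS: "space (sample n (P S)) = space ?M" for S unfolding P_def by (rule space_sample_PGamma)
    define flip where "flip i S = sym_diff S {i}" for i and S :: "nat set"
    \<comment> \<open>Flipping one coordinate moves the mean by a^2 in squared distance, so no event
      separates the two sample laws by more than 1/2.\<close>
    have two_point: "1 / 2 \<le> e S i + e (flip i S) i" if S: "S \<in> ?C" and i: "i < d" for S i
    proof -
      have T: "flip i S \<in> ?C" using S i by (auto simp: flip_def)
      have sd: "sym_diff S (flip i S) = {i}" "sym_diff (flip i S) S = {i}" by (auto simp: flip_def)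
      have diff: "measure (sample n (P U)) (B i) - measure (sample n (P V)) (B i) \<le> 1 / 2"
        if "U \<in> ?C" "V \<in> ?C" "sym_diff U V = {i}" for U V
      proof (rule sample_prob_diff_le[OF Peq Peq _ Bm])
        have "ip d (\<lambda>i. cube_point a U i - cube_point a V i) (\<lambda>i. cube_point a U i - cube_point a V i) = a\<^sup>2"
          using ip_cube_diff[of U d V a] that by auto
        then show "real n * ip d (\<lambda>i. cube_point a U i - cube_point a V i) (\<lambda>i. cube_point a U i - cube_point a V i) \<le> 1 / 16"
          using aa(2) by simp
      qed
      have compl: "measure (sample n (P U)) (space ?M - B i) = 1 - measure (sample n (P U)) (B i)" if "U \<in> ?C" for U
        using prob_space.prob_compl[OF probS[OF that], of "B i"] Bm by (simp add: setsS spaceS)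
      show ?thesis
      proof (cases "i \<in> S")
        case True
        then have "i \<notin> flip i S" by (simp add: flip_def)
        then show ?thesis using True compl[OF S] diff[OF S T sd(1)] by (simp add: e_def E_def)
      next
        case False
        then have "i \<in> flip i S" by (simp add: flip_def)
        then show ?thesis using False compl[OF T] diff[OF T S sd(2)] by (simp add: e_def E_def)
      qed
    qed
    \<comment> \<open>The flip is an involution of the cube, so averaging over all vertices pairs
      each with its neighbour.\<close>
    have avg: "2 ^ d / 4 \<le> (\<Sum>S\<in>?C. e S i)" if i: "i < d" for i
    proof -
      have "(\<Sum>S\<in>?C. e (flip i S) i) = (\<Sum>S\<in>?C. e S i)"
        using i by (intro sum.reindex_bij_witness[where i = "flip i" and j = "flip i"]) (auto simp: flip_def)
      then have "2 * (\<Sum>S\<in>?C. e S i) = (\<Sum>S\<in>?C. e S i + e (flip i S) i)" by (simp add: sum.distrib)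
      also have "\<dots> \<ge> (\<Sum>S\<in>?C. 1 / 2)" using two_point[OF _ i] by (rule sum_mono)
      finally show ?thesis by (simp add: card_Pow)
    qed
    have "\<exists>S\<in>?C. real d / 4 \<le> (\<Sum>i<d. e S i)"
    proof (rule ccontr)
      assume "\<not> ?thesis"
      then have "\<And>S. S \<in> ?C \<Longrightarrow> (\<Sum>i<d. e S i) < real d / 4" by (meson not_le)
      then have "(\<Sum>S\<in>?C. \<Sum>i<d. e S i) < (\<Sum>S\<in>?C. real d / 4)" by (intro sum_strict_mono) auto
      also have "\<dots> = (\<Sum>i<d. 2 ^ d / 4)" by (simp add: card_Pow)
      also have "\<dots> \<le> (\<Sum>i<d. \<Sum>S\<in>?C. e S i)" using avg by (intro sum_mono) auto
      also have "\<dots> = (\<Sum>S\<in>?C. \<Sum>i<d. e S i)" by (rule sum.swap)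
      finally show False by simp
    qed
    then obtain S where S: "S \<in> ?C" "real d / 4 \<le> (\<Sum>i<d. e S i)" by blast
    interpret S: prob_space "sample n (P S)" by (rule probS[OF S(1)])
    define b where "b = a / (128 * sqrt d)"
    have b: "0 \<le> b" using a by (simp add: b_def)
    have card: "real (card (sym_diff S (sel X))) = (\<Sum>i<d. indicator (E S i) X)" if "X \<in> space ?M" for X
    proof -
      have "(\<Sum>i<d. indicator (E S i) X :: real) = (\<Sum>i<d. if i \<in> sym_diff S (sel X) then 1 else 0)"
        using that by (intro sum.cong) (auto simp: E_def B_def)
      also have "\<dots> = (\<Sum>i\<in>sym_diff S (sel X). 1)"
      proof -
        have "{..<d} \<inter> sym_diff S (sel X) = sym_diff S (sel X)" using S(1) selC[of X] by auto
        then show ?thesis using sum.inter_restrict[of "{..<d}" "\<lambda>_. 1::real" "sym_diff S (sel X)"] by simp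
      qed
      finally show ?thesis by simp
    qed
    \<comment> \<open>The constant is 4 * 128 * 4: from the side of the cube, the separation in
      \<open>D_lower\<close>, and the average error 1/4 per coordinate.\<close>
    have "min R 1 / 2048 * min (sqrt (real d / real n)) 1 = b * (real d / 4)"
    proof -
      have "b * (real d / 4) = a / 512 * (real d / sqrt d)" by (simp add: b_def)
      also have "real d / sqrt d = sqrt d" by (rule real_div_sqrt) simp
      finally have "b * (real d / 4) = a * sqrt d / 512" by simp
      then show ?thesis by (simp add: a_eq)
    qed
    also have "\<dots> \<le> b * (\<Sum>i<d. e S i)" using S(2) b by (rule mult_left_mono)
    also have "\<dots> = (\<Sum>i<d. b * e S i)" by (rule sum_distrib_left)
    finally have "ennreal (min R 1 / 2048 * min (sqrt (real d / real n)) 1) \<le> ennreal (\<Sum>i<d. b * e S i)"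
      by (rule ennreal_leI)
    also have "\<dots> = (\<Sum>i<d. ennreal (b * e S i))" using b by (intro sum_ennreal[symmetric]) (simp add: e_def)
    also have "\<dots> = (\<Sum>i<d. \<integral>\<^sup>+X. ennreal b * indicator (E S i) X \<partial>sample n (P S))"
      using Em b by (intro sum.cong refl) (simp add: setsS nn_integral_cmult_indicator e_def S.emeasure_eq_measure ennreal_mult)
    also have "\<dots> = (\<integral>\<^sup>+X. (\<Sum>i<d. ennreal b * indicator (E S i) X) \<partial>sample n (P S))"
    proof (rule nn_integral_sum[symmetric])
      have [measurable]: "E S i \<in> sets (sample n (P S))" for i using Em by (simp add: setsS)
      show "(\<lambda>X. ennreal b * indicator (E S i) X) \<in> borel_measurable (sample n (P S))" for i by measurable
    qed
    also have "\<dots> \<le> (\<integral>\<^sup>+X. ennreal (hellinger (Ph X) (P S)) \<partial>sample n (P S))"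
    proof (rule nn_integral_mono)
      fix X assume "X \<in> space (sample n (P S))"
      then have X: "X \<in> space ?M" by (simp add: spaceS)
      have "(\<Sum>i<d. ennreal b * indicator (E S i) X) = (\<Sum>i<d. ennreal (b * indicator (E S i) X))"
        using b by (intro sum.cong refl) (simp add: indicator_def)
      also have "\<dots> = ennreal (\<Sum>i<d. b * indicator (E S i) X)" using b by (intro sum_ennreal) simp
      also have "(\<Sum>i<d. b * indicator (E S i) X) = b * card (sym_diff S (sel X))"
        by (simp add: card[OF X] sum_distrib_left)
      also have "ennreal \<dots> \<le> ennreal (hellinger (Ph X) (P S))"
        using D_lower[OF S(1), of X] D_le[OF S(1) X] by (intro ennreal_leI) (simp add: b_def)
      finally show "(\<Sum>i<d. ennreal b * indicator (E S i) X) \<le> ennreal (hellinger (Ph X) (P S))" .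
    qed
    also have "\<dots> \<le> (SUP G\<in>Gkd k d R. \<integral>\<^sup>+X. ennreal (hellinger (Ph X) (PGamma k d G)) \<partial>sample n (PGamma k d G))"
      unfolding P_def by (rule SUP_upper[OF G[OF S(1)]])
    finally show "ennreal (min R 1 / 2048 * min (sqrt (real d / real n)) 1)
      \<le> (SUP G\<in>Gkd k d R. \<integral>\<^sup>+X. ennreal (hellinger (Ph X) (PGamma k d G)) \<partial>sample n (PGamma k d G))" .
  qed
qed

theorem theorem2:
  shows "(\<forall>k::nat. \<forall>R::real. k \<ge> 1 \<longrightarrow> R > 0 \<longrightarrow>
           (\<exists>c C'. 0 < c \<and> c \<le> C' \<and>
              (\<forall>d n::nat. d \<ge> 1 \<longrightarrow> n \<ge> 1 \<longrightarrow>
                 ennreal (c * min (sqrt (real d / real n)) 1) \<le> minimax_risk k d R n \<and>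
                 minimax_risk k d R n \<le> ennreal (C' * min (sqrt (real d / real n)) 1))))
       \<and>
       (\<forall>R::real. R > 0 \<longrightarrow>
          (\<exists>C>0. \<forall>k d n::nat. k \<ge> 1 \<longrightarrow> d \<ge> 1 \<longrightarrow> n \<ge> 1 \<longrightarrow>
             (\<exists>W Mu. (\<forall>j<k. (\<lambda>X. W X j) \<in> borel_measurable (PiM {..<n} (\<lambda>_. Rd d))) \<and>
                     (\<forall>j<k. \<forall>i<d. (\<lambda>X. Mu X j i) \<in> borel_measurable (PiM {..<n} (\<lambda>_. Rd d))) \<and>
                     (\<forall>X \<in> space (PiM {..<n} (\<lambda>_. Rd d)). (W X, Mu X) \<in> Gkd k d R) \<and>
                     (\<forall>G\<in>Gkd k d R. \<forall>\<delta>::real. 0 < \<delta> \<longrightarrow> \<delta> < 1/2 \<longrightarrow>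
                        measure (sample n (PGamma k d G))
                          {X \<in> space (sample n (PGamma k d G)).
                             hellinger (PGamma k d (W X, Mu X)) (PGamma k d G)
                               \<le> C * sqrt ((real k ^ 4 * real d + (2 * real k) ^ (2 * k + 2)) / real n
                                            * ln (1 / \<delta>))}
                          \<ge> 1 - \<delta>))))"
proof (intro conjI allI impI, goal_cases)
  case (1 k R)
  show ?case
  proof (rule exI[of _ "min R 1 / 2048"], rule exI[of _ "3 * est_const R * sqrt (rate k 1)"], intro conjI allI impI)
    have "1 * 1 \<le> 3 * est_const R * sqrt (rate k 1)"
      using rate_ge_1[OF 1(1), of 1] by (intro mult_mono) (auto simp: est_const_def)
    then show "min R 1 / 2048 \<le> 3 * est_const R * sqrt (rate k 1)" by simp
  qed (use 1 minimax_risk_lower minimax_risk_upper in auto)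
next
  case (2 R)
  have "0 < est_const R" by (simp add: est_const_def add_pos_nonneg)
  then show ?case
    by (intro exI[of _ "est_const R"] conjI allI impI mle_high_probability[OF 2])
qed

end
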